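(* Let $n\ge1$, $1\le p,q\le\infty$ and $s\in\mathbb{R}$, and let $p'$ be the conjugate exponent of $p$ ($1/p+1/p'=1$). Put $$\nu_1(p,q)=\max\{0,\,1/q-\min(1/p,1/p')\},\qquad \nu_2(p,q)=\min\{0,\,1/q-\max(1/p,1/p')\}.$$ Then the following are true. (1) If $B^{p,q}_s(\mathbb{R}^n)\hookrightarrow M^{p,q}(\mathbb{R}^n)$, then $s\ge n\nu_1(p,q)$. (2) If $M^{p,q}(\mathbb{R}^n)\hookrightarrow B^{p,q}_s(\mathbb{R}^n)$ and $1\le p,q<\infty$, then $s\le n\nu_2(p,q)$.
   Context: The symbol $\hookrightarrow$ denotes continuous inclusion. $\mathcal{S}(\mathbb{R}^n)$ and $\mathcal{S}'(\mathbb{R}^n)$ denote the Schwartz space and the space of tempered distributions; $\hat f(\xi)=\int e^{-i\xi\cdot x}f(x)\,dx$ and $\mathcal{F}^{-1}f(x)=(2\pi)^{-n}\int e^{ix\cdot\xi}f(\xi)\,d\xi$. Modulation spaces: for a window $\varphi\in\mathcal{S}(\mathbb{R}^n)\setminus\{0\}$ and $f\in\mathcal{S}'(\mathbb{R}^n)$ put $V_\varphi f(x,\xi)=\langle f,M_\xi T_x\varphi\rangle$, where $M_\xi T_x\varphi(t)=e^{i\xi\cdot t}\varphi(t-x)$ and $\langle\cdot,\cdot\rangle$ is the (extended) $L^2$ inner product; for suitable functions $f$, $V_\varphi f(x,\xi)=\int f(t)\overline{\varphi(t-x)}e^{-i\xi\cdot t}\,dt$. $M^{p,q}(\mathbb{R}^n)$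 consists of all $f\in\mathcal{S}'(\mathbb{R}^n)$ with $$\|f\|_{M^{p,q}}=\Big\{\int_{\mathbb{R}^n}\Big(\int_{\mathbb{R}^n}|V_\varphi f(x,\xi)|^p\,dx\Big)^{q/p}d\xi\Big\}^{1/q}<\infty$$ (usual modification if $p$ or $q$ is $\infty$), for one fixed window; different windows give equivalent norms. Besov spaces: let $\eta,\psi\in\mathcal{S}(\mathbb{R}^n)$ satisfy $\operatorname{supp}\eta\subset\{|\xi|\le2\}$, $\operatorname{supp}\psi\subset\{1/2\le|\xi|\le2\}$ and $\eta(\xi)+\sum_{j=1}^\infty\psi(\xi/2^j)=1$ for all $\xi\in\mathbb{R}^n$; set $\varphi_0=\eta$ and $\varphi_j=\psi(\cdot/2^j)$ for $j\ge1$. $B^{p,q}_s(\mathbb{R}^n)$ consists of all $f\in\mathcal{S}'(\mathbb{R}^n)$ with $$\|f\|_{B^{p,q}_s}=\Big(\sum_{j=0}^\infty2^{jsq}\|\mathcal{F}^{-1}[\varphi_j\hat f]\|_{L^p}^q\Big)^{1/q}<\infty$$ (usual modification if $q=\infty$). *)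

theory Defs
  imports "HOL-Probability.Essential_Supremum"
begin

section \<open>Lebesgue norms with exponent in [1,\<infinity>]\<close>

text \<open>Real powers on \<^typ>\<open>ennreal\<close>; only used with positive exponent \<^term>\<open>r\<close>.\<close>

definition ennpowr :: "ennreal \<Rightarrow> real \<Rightarrow> ennreal" where
  "ennpowr a r = (if a = \<infinity> then \<infinity> else ennreal (enn2real a powr r))"

text \<open>The norm is \<infinity> exactly when the (measurable) function is not in the Lebesgue space. With
  counting measure on the naturals this is the sequence norm.\<close>

definition Lnorm :: "ennreal \<Rightarrow> 'a measure \<Rightarrow> ('a \<Rightarrow> ennreal) \<Rightarrow> ennreal" where
  "Lnorm p M u =
     (if p = \<infinity> then esssup M u
      else ennpowr (\<integral>\<^sup>+ x. ennpowr (u x) (enn2real p) \<partial>M) (1 / enn2real p))"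

definition conj_exponent :: "ennreal \<Rightarrow> ennreal" where
  "conj_exponent p = 1 / (1 - 1 / p)"

lemma conj_exponent_iff:
  assumes "1 \<le> p"
  shows "1 / p + 1 / r = 1 \<longleftrightarrow> r = conj_exponent p"
proof -
  have le: "1 / p \<le> 1"
    using assms
    by (metis divide_le_posI_ennreal mult.right_neutral not_gr_zero not_one_le_zero)
  have inv: "1 / (1 / x) = x" for x :: ennreal
  proof (cases x)
    case (real r)
    then show ?thesis
      by (cases "r = 0") (simp_all add: divide_ennreal_def inverse_ennreal)
  qed (simp add: divide_ennreal_def)
  show ?thesis
  proof
    assume "1 / p + 1 / r = 1"
    then have "1 / r = 1 - 1 / p"
      using le by (metis \<open>1 / p + 1 / r = 1\<close> ennreal_add_diff_cancel_left ennreal_add_eq_top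
          ennreal_top_neq_one)
    then show "r = conj_exponent p"
      unfolding conj_exponent_def using inv[of r] by simp
  next
    assume "r = conj_exponent p"
    then show "1 / p + 1 / r = 1"
      unfolding conj_exponent_def inv using le by simp
  qed
qed

text \<open>The real number 1/p, with 1/\<infinity> = 0.\<close>

definition recip :: "ennreal \<Rightarrow> real" where
  "recip p = enn2real (1 / p)"

definition nu1 :: "ennreal \<Rightarrow> ennreal \<Rightarrow> real" where
  "nu1 p q = max 0 (recip q - min (recip p) (recip (conj_exponent p)))"

definition nu2 :: "ennreal \<Rightarrow> ennreal \<Rightarrow> real" where
  "nu2 p q = min 0 (recip q - max (recip p) (recip (conj_exponent p)))"

section \<open>Schwartz functions and tempered distributions\<close>

definition partial :: "'n::finite \<Rightarrow> (real^'n \<Rightarrow> complex) \<Rightarrow> real^'n \<Rightarrow> complex" where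
  "partial i f x = frechet_derivative f (at x) (axis i 1)"

text \<open>Multi-indices are encoded as lists of coordinate directions.\<close>

definition partials :: "'n::finite list \<Rightarrow> (real^'n \<Rightarrow> complex) \<Rightarrow> real^'n \<Rightarrow> complex" where
  "partials \<alpha> f = foldr partial \<alpha> f"

text \<open>Everywhere (Frechet) differentiability of every iterated partial derivative is smoothness.\<close>

definition schwartz :: "(real^'n::finite \<Rightarrow> complex) set" where
  "schwartz = {f. \<forall>\<alpha>. partials \<alpha> f differentiable_on UNIV \<and>
     (\<forall>N::nat. bdd_above (range (\<lambda>x. (1 + norm x) ^ N * norm (partials \<alpha> f x))))}"

text \<open>An increasing family of seminorms generating the topology of the Schwartz space.\<close>

definition schwartz_seminorm :: "nat \<Rightarrow> (real^'n::finite \<Rightarrow> complex) \<Rightarrow> real" where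
  "schwartz_seminorm N f =
     (SUP (\<alpha>, x) \<in> {\<alpha>. length \<alpha> \<le> N} \<times> UNIV. (1 + norm x) ^ N * norm (partials \<alpha> f x))"

type_synonym 'n functional = "(real^'n \<Rightarrow> complex) \<Rightarrow> complex"

text \<open>Continuous (complex-)linear functionals on the Schwartz space. As HOL functions are total,
  a functional is given the value 0 outside the Schwartz space, so that equality of
  distributions is equality in HOL.\<close>

definition tempered :: "'n::finite functional set" where
  "tempered = {T.
     (\<forall>f. f \<notin> schwartz \<longrightarrow> T f = 0) \<and>
     (\<forall>f\<in>schwartz. \<forall>g\<in>schwartz. T (\<lambda>x. f x + g x) = T f + T g) \<and>
     (\<forall>c. \<forall>f\<in>schwartz. T (\<lambda>x. c * f x) = c * T f) \<and>
     (\<forall>f\<in>schwartz. \<forall>\<epsilon>>0. \<exists>N. \<exists>\<delta>>0. \<forall>g\<in>schwartz.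
        schwartz_seminorm N (\<lambda>x. g x - f x) < \<delta> \<longrightarrow> norm (T g - T f) < \<epsilon>)}"

definition dist_diff :: "'n::finite functional \<Rightarrow> 'n functional \<Rightarrow> 'n functional" where
  "dist_diff T U = (\<lambda>f. T f - U f)"

definition fourier :: "(real^'n::finite \<Rightarrow> complex) \<Rightarrow> real^'n \<Rightarrow> complex" where
  "fourier f \<xi> = (LINT x|lborel. cis (- (\<xi> \<bullet> x)) * f x)"

definition inv_fourier :: "(real^'n::finite \<Rightarrow> complex) \<Rightarrow> real^'n \<Rightarrow> complex" where
  "inv_fourier f x = (LINT \<xi>|lborel. cis (x \<bullet> \<xi>) * f \<xi>) / of_real ((2 * pi) ^ CARD('n))"

text \<open>Operations on distributions by duality with respect to the bilinear pairing.\<close>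

definition dist_fourier :: "'n::finite functional \<Rightarrow> 'n functional" where
  "dist_fourier T = (\<lambda>f. if f \<in> schwartz then T (fourier f) else 0)"

definition dist_inv_fourier :: "'n::finite functional \<Rightarrow> 'n functional" where
  "dist_inv_fourier T = (\<lambda>f. if f \<in> schwartz then T (inv_fourier f) else 0)"

definition dist_mult :: "(real^'n::finite \<Rightarrow> complex) \<Rightarrow> 'n functional \<Rightarrow> 'n functional" where
  "dist_mult g T = (\<lambda>f. if f \<in> schwartz then T (\<lambda>x. g x * f x) else 0)"

definition represents :: "(real^'n::finite \<Rightarrow> complex) \<Rightarrow> 'n functional \<Rightarrow> bool" where
  "represents g T \<longleftrightarrow> g \<in> borel_measurable lborel \<and>
     (\<forall>f\<in>schwartz. integrable lborel (\<lambda>x. g x * f x) \<and> T f = (LINT x|lborel. g x * f x))"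

text \<open>The Lebesgue norm of a distribution: that of the (almost everywhere unique) function
  representing it, and \<infinity> if there is none.\<close>

definition dist_Lnorm :: "ennreal \<Rightarrow> 'n::finite functional \<Rightarrow> ennreal" where
  "dist_Lnorm p T = (INF g \<in> {g. represents g T}. Lnorm p lborel (\<lambda>x. ennreal (norm (g x))))"

section \<open>Modulation spaces\<close>

definition time_freq_shift ::
    "real^'n::finite \<Rightarrow> real^'n \<Rightarrow> (real^'n \<Rightarrow> complex) \<Rightarrow> real^'n \<Rightarrow> complex" where
  "time_freq_shift x \<xi> \<phi> t = cis (\<xi> \<bullet> t) * \<phi> (t - x)"

text \<open>The conjugate turns the bilinear pairing into the extended (sesquilinear) inner product.\<close>

definition stft ::
    "(real^'n::finite \<Rightarrow> complex) \<Rightarrow> 'n functional \<Rightarrow> real^'n \<Rightarrow> real^'n \<Rightarrow> complex" where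
  "stft \<phi> T x \<xi> = T (\<lambda>t. cnj (time_freq_shift x \<xi> \<phi> t))"

definition modulation_norm ::
    "(real^'n::finite \<Rightarrow> complex) \<Rightarrow> ennreal \<Rightarrow> ennreal \<Rightarrow> 'n functional \<Rightarrow> ennreal" where
  "modulation_norm \<phi> p q T =
     Lnorm q lborel (\<lambda>\<xi>. Lnorm p lborel (\<lambda>x. ennreal (norm (stft \<phi> T x \<xi>))))"

definition modulation_space ::
    "(real^'n::finite \<Rightarrow> complex) \<Rightarrow> ennreal \<Rightarrow> ennreal \<Rightarrow> 'n functional set" where
  "modulation_space \<phi> p q = {T \<in> tempered. modulation_norm \<phi> p q T < \<infinity>}"

section \<open>Besov spaces\<close>

definition dyadic_partition ::
    "(real^'n::finite \<Rightarrow> complex) \<Rightarrow> (real^'n \<Rightarrow> complex) \<Rightarrow> bool" where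
  "dyadic_partition \<eta> \<psi> \<longleftrightarrow> \<eta> \<in> schwartz \<and> \<psi> \<in> schwartz \<and>
     closure {\<xi>. \<eta> \<xi> \<noteq> 0} \<subseteq> {\<xi>. norm \<xi> \<le> 2} \<and>
     closure {\<xi>. \<psi> \<xi> \<noteq> 0} \<subseteq> {\<xi>. 1/2 \<le> norm \<xi> \<and> norm \<xi> \<le> 2} \<and>
     (\<forall>\<xi>. (\<lambda>j. \<psi> (\<xi> /\<^sub>R 2 ^ Suc j)) sums (1 - \<eta> \<xi>))"

definition dyadic ::
    "(real^'n::finite \<Rightarrow> complex) \<Rightarrow> (real^'n \<Rightarrow> complex) \<Rightarrow> nat \<Rightarrow> real^'n \<Rightarrow> complex" where
  "dyadic \<eta> \<psi> j = (if j = 0 then \<eta> else (\<lambda>\<xi>. \<psi> (\<xi> /\<^sub>R 2 ^ j)))"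

definition besov_norm ::
    "(real^'n::finite \<Rightarrow> complex) \<Rightarrow> (real^'n \<Rightarrow> complex) \<Rightarrow>
      ennreal \<Rightarrow> ennreal \<Rightarrow> real \<Rightarrow> 'n functional \<Rightarrow> ennreal" where
  "besov_norm \<eta> \<psi> p q s T =
     Lnorm q (count_space UNIV) (\<lambda>j. ennreal (2 powr (real j * s)) *
       dist_Lnorm p (dist_inv_fourier (dist_mult (dyadic \<eta> \<psi> j) (dist_fourier T))))"

definition besov_space ::
    "(real^'n::finite \<Rightarrow> complex) \<Rightarrow> (real^'n \<Rightarrow> complex) \<Rightarrow>
      ennreal \<Rightarrow> ennreal \<Rightarrow> real \<Rightarrow> 'n functional set" where
  "besov_space \<eta> \<psi> p q s = {T \<in> tempered. besov_norm \<eta> \<psi> p q s T < \<infinity>}"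

section \<open>Continuous inclusion of normed spaces of distributions\<close>

definition continuously_included ::
    "'n::finite functional set \<Rightarrow> ('n functional \<Rightarrow> ennreal) \<Rightarrow>
     'n functional set \<Rightarrow> ('n functional \<Rightarrow> ennreal) \<Rightarrow> bool" where
  "continuously_included X normX Y normY \<longleftrightarrow> X \<subseteq> Y \<and>
     (\<forall>T\<in>X. \<forall>\<epsilon>::real>0. \<exists>\<delta>::real>0. \<forall>U\<in>X.
        normX (dist_diff U T) < ennreal \<delta> \<longrightarrow> normY (dist_diff U T) < ennreal \<epsilon>)"

end

theory Submission
  imports Defs "HOL-Probability.Characteristic_Functions" "HOL-Probability.Sinc_Integral"
begin

text \<open>Both embeddings are tested on wave packets
  f(t) = \<tau> \<rho>^n \<Sum> exp(i \<rho> k\<cdot>t) g(\<rho> t - a(k)), the sum ranging over a finite 1-separated set S of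
  m frequencies k. Here g has its Fourier transform in a small ball, the frequencies \<rho> k lie near a point
  of the sphere of radius 2^j, and the positions a(k) are far apart. Then sup |f| is of order
  \<tau> \<rho>^n and the integral of |f| of order \<tau> m; interpolating between the two
  gives Besov norm \<tau> 2^(js) \<rho>^(n(1 - 1/p)) m^(1/p), the lower bound coming from pairing the j-th
  frequency piece of f with the conjugate of f. The short-time Fourier transform of f is concentrated on m boxes that
  are bounded in x and of size \<rho> in \<xi>, so the modulation norm is \<tau> (\<rho>^n m)^(1/q). Comparing these two
  expressions for bounded \<rho> and m = 1, for bounded \<rho> and m of order 2^(jn), and for \<rho> = 2^j and
  m = 1, as j tends to infinity, yields the three bounds contained in \<nu>1 and in \<nu>2.\<close>

section \<open>Lebesgue norms\<close>

text \<open>Part (1) needs Besov norms from above and modulation norms from below, part (2) the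
  reverse. Every upper bound comes from a supremum bound A and an integral bound B through A^(1 -
  1/p) B^(1/p), for functions as for sequences. Lower Besov bounds go through duality because the
  norm of a frequency piece is an infimum over representing functions, while a pairing has the same
  value for all of them. Spreading the positions serves two purposes: otherwise the m terms could
  pile up in the supremum, and in the short-time transform one packet could cancel another. The
  pairing has no cross terms in any case, since the Fourier supports of the packets are disjoint.
  Bounded \<rho> is not simply 1: after rescaling a packet to unit size the window is dilated by
  1/\<rho>, and the lower bound for the transform asks that this window be nearly constant where g
  lives. Norms may be infinite and functions such as the norm in x of the transform are not shown
  measurable; for finite exponents the nonnegative integral is monotone without measurability, and
  for \<infinity> a non-measurable function has infinite norm, which is harmless in lower
  bounds.\<close>

lemma ennpowr_ennreal: "0 \<le> x \<Longrightarrow> ennpowr (ennreal x) r = ennreal (x powr r)"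
  by (simp add: ennpowr_def)

lemma ennpowr_mono:
  assumes "a \<le> b" "0 < r"
  shows "ennpowr a r \<le> ennpowr b r"
proof (cases "b = \<infinity>")
  case False
  then obtain x y where "a = ennreal x" "b = ennreal y" "0 \<le> x" "0 \<le> y"
    using assms(1) by (metis ennreal_cases infinity_ennreal_def top.extremum_uniqueI)
  then show ?thesis
    using assms by (auto simp: ennpowr_ennreal intro!: ennreal_leI powr_mono2)
qed (simp add: ennpowr_def)

lemma exponent_cases:
  assumes "1 \<le> p"
  obtains (inf) "p = \<infinity>" "recip p = 0"
    | (fin) r where "1 \<le> r" "p = ennreal r" "recip p = 1 / r" "enn2real p = r"
proof (cases p)
  case (real r)
  then have "1 \<le> r" using assms by (metis ennreal_1 ennreal_le_iff)
  moreover have "1 / p = ennreal (1 / r)"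
    using \<open>1 \<le> r\<close> real divide_ennreal[of 1 r] by simp
  then have "recip p = 1 / r"
    using \<open>1 \<le> r\<close> by (simp add: recip_def)
  ultimately show ?thesis using real fin by simp
qed (use inf in \<open>simp add: recip_def\<close>)

lemma recip_bounds:
  assumes "1 \<le> p"
  shows "0 \<le> recip p" "recip p \<le> 1"
  using assms by (cases p rule: exponent_cases; simp)+

lemma recip_conj_exponent:
  assumes "1 \<le> p"
  shows "recip (conj_exponent p) = 1 - recip p"
proof -
  have "1 / p + 1 / conj_exponent p = 1"
    using assms conj_exponent_iff by blast
  then have "enn2real (1 / p + 1 / conj_exponent p) = 1" by simp
  moreover have "1 / p < top" "1 / conj_exponent p < top"
    using \<open>1 / p + 1 / conj_exponent p = 1\<close>
    by (metis ennreal_add_eq_top ennreal_top_neq_one top.not_eq_extremum)+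
  ultimately show ?thesis
    unfolding recip_def by (subst (asm) enn2real_plus) auto
qed

lemma Lnorm_top: "Lnorm top M u = esssup M u"
  by (simp add: Lnorm_def)

lemma Lnorm_ennreal:
  "0 \<le> r \<Longrightarrow> Lnorm (ennreal r) M u = ennpowr (\<integral>\<^sup>+ x. ennpowr (u x) r \<partial>M) (1 / r)"
  by (simp add: Lnorm_def)

lemma Lnorm_zero:
  assumes "1 \<le> p"
  shows "Lnorm p M (\<lambda>_. 0) = 0"
  using assms
proof (cases p rule: exponent_cases)
  case inf
  have "esssup M (\<lambda>_. 0::ennreal) \<le> 0" by (rule esssup_I) auto
  then show ?thesis using inf by (simp add: Lnorm_top)
next
  case (fin r)
  then show ?thesis by (simp add: Lnorm_ennreal ennpowr_def)
qed

text \<open>For finite exponent r the pointwise bound u^r \<le> A^(r-1) w is integrated. The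
  majorant \<open>w\<close> is kept apart from \<open>u\<close> because the nonnegative integral is
  monotone without measurability of \<open>u\<close>; only the essential supremum asks for
  it.\<close>

lemma Lnorm_le_interpolation:
  assumes p: "1 \<le> p"
    and w [measurable]: "w \<in> borel_measurable M"
    and uw: "\<And>x. x \<in> space M \<Longrightarrow> u x \<le> w x"
    and wA: "\<And>x. x \<in> space M \<Longrightarrow> w x \<le> ennreal A"
    and wB: "(\<integral>\<^sup>+ x. w x \<partial>M) \<le> ennreal B"
    and A: "0 \<le> A" and B: "0 \<le> B"
    and u: "p = \<infinity> \<Longrightarrow> u \<in> borel_measurable M"
  shows "Lnorm p M u \<le> ennreal (A powr (1 - recip p) * B powr recip p)"
  using p
proof (cases p rule: exponent_cases)
  case inf
  show ?thesis
  \<comment> \<open>In HOL \<open>0 powr 0 = 0\<close>, so for \<open>B = 0\<close> the claimed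
    bound is 0. It holds because \<open>w\<close>, and with it \<open>u\<close>, vanishes almost
    everywhere.\<close>
  proof (cases "B = 0")
    case True
    then have "AE x in M. w x = 0"
      using wB by (simp add: nn_integral_0_iff_AE)
    moreover have "AE x in M. u x \<le> w x"
      using uw by (rule AE_I2)
    ultimately have "AE x in M. u x \<le> 0"
      by eventually_elim auto
    then have "esssup M u \<le> 0"
      using inf u by (intro esssup_I) auto
    then show ?thesis
      using inf True by (simp add: Lnorm_top)
  next
    case False
    have "esssup M u \<le> ennreal A"
      using u inf uw wA by (intro esssup_I) (auto intro!: AE_I2 intro: order_trans)
    then show ?thesis using inf A B False
      by (cases "A = 0") (auto simp: Lnorm_top)
  qed
next
  case (fin r)
  have *: "ennpowr (u x) r \<le> ennreal (A powr (r - 1)) * w x" if x: "x \<in> space M" for x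
  proof -
    obtain y where y: "w x = ennreal y" "0 \<le> y" "y \<le> A"
      using wA[OF x] A by (metis ennreal_cases ennreal_le_iff ennreal_neq_top neq_top_trans)
    have "ennpowr (u x) r \<le> ennpowr (w x) r"
      using uw[OF x] fin by (intro ennpowr_mono) auto
    also have "\<dots> = ennreal (y powr r)"
      using y by (simp add: ennpowr_ennreal)
    also have "y powr r = y powr (r - 1) * y"
      using y(2) by (cases "y = 0") (auto simp: powr_diff)
    also have "\<dots> \<le> A powr (r - 1) * y"
      using y fin by (intro mult_right_mono powr_mono2) auto
    finally show ?thesis
      using y by (simp add: ennreal_mult ennreal_leI)
  qed
  have "(\<integral>\<^sup>+ x. ennpowr (u x) r \<partial>M) \<le> (\<integral>\<^sup>+ x. ennreal (A powr (r - 1)) * w x \<partial>M)"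
    by (intro nn_integral_mono *)
  also have "\<dots> = ennreal (A powr (r - 1)) * (\<integral>\<^sup>+ x. w x \<partial>M)"
    by (rule nn_integral_cmult) measurable
  also have "\<dots> \<le> ennreal (A powr (r - 1)) * ennreal B"
    by (intro mult_left_mono wB) auto
  also have "\<dots> = ennreal (A powr (r - 1) * B)"
    using B by (simp add: ennreal_mult)
  finally have "Lnorm p M u \<le> ennpowr (ennreal (A powr (r - 1) * B)) (1 / r)"
    using fin by (auto simp: Lnorm_ennreal intro!: ennpowr_mono)
  also have "\<dots> = ennreal ((A powr (r - 1) * B) powr (1 / r))"
    using B by (intro ennpowr_ennreal) auto
  also have "(A powr (r - 1) * B) powr (1 / r) = A powr (1 - recip p) * B powr recip p"
    using fin A B by (simp add: powr_mult powr_powr diff_divide_distrib)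
  finally show ?thesis .
qed

text \<open>The function dominates c times the indicator of E. Measurability of \<open>u\<close> is
  not assumed: the nonnegative integral is monotone anyway, and the essential supremum of a
  non-measurable function is \<infinity>.\<close>

lemma Lnorm_ge:
  assumes p: "1 \<le> p"
    and E: "E \<in> sets M" "emeasure M E = ennreal b" "0 < b"
    and u: "\<And>x. x \<in> E \<Longrightarrow> ennreal c \<le> u x" and c: "0 \<le> c"
  shows "ennreal (c * b powr recip p) \<le> Lnorm p M u"
  using p
proof (cases p rule: exponent_cases)
  case inf
  show ?thesis
  proof (cases "u \<in> borel_measurable M")
    case True
    have "ennreal c \<le> esssup M u"
    proof (rule ccontr)
      assume "\<not> ennreal c \<le> esssup M u"
      then have less: "esssup M u < ennreal c" by simp
      have "AE x in M. u x \<le> esssup M u" by (rule esssup_AE)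
      then have "AE x in M. x \<notin> E"
        using less u by (auto elim!: eventually_mono) (meson leD order_le_less_trans)
      then have "emeasure M E = 0"
        using E(1) by (metis AE_iff_null_sets null_setsD1)
      then show False using E by simp
    qed
    then show ?thesis using inf E by (simp add: Lnorm_top)
  qed (use inf in \<open>simp add: Lnorm_top esssup_non_measurable\<close>)
next
  case (fin r)
  have "ennreal (c powr r * b) = ennreal (c powr r) * emeasure M E"
    using E by (simp add: ennreal_mult)
  also have "\<dots> = (\<integral>\<^sup>+ x. ennreal (c powr r) * indicator E x \<partial>M)"
    using E by (simp add: nn_integral_cmult_indicator)
  also have "\<dots> \<le> (\<integral>\<^sup>+ x. ennpowr (u x) r \<partial>M)"
  proof (rule nn_integral_mono)
    fix x
    show "ennreal (c powr r) * indicator E x \<le> ennpowr (u x) r"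
      using ennpowr_mono[OF u[of x], of r] fin c by (auto simp: indicator_def ennpowr_ennreal)
  qed
  finally have "ennpowr (ennreal (c powr r * b)) (1 / r) \<le> Lnorm p M u"
    using fin by (auto simp: Lnorm_ennreal intro!: ennpowr_mono)
  also have "ennpowr (ennreal (c powr r * b)) (1 / r) = ennreal ((c powr r * b) powr (1 / r))"
    using E by (intro ennpowr_ennreal) auto
  also have "(c powr r * b) powr (1 / r) = c * b powr recip p"
    using fin c E by (simp add: powr_mult powr_powr)
  finally show ?thesis .
qed

text \<open>With \<mu> balancing both terms, a \<le> \<mu> + \<mu> powr (1 - r) * a powr r
  replaces Hoelder's inequality at the price of a factor 2.\<close>

lemma pairing_le_Lnorm:
  fixes g h :: "'a \<Rightarrow> complex"
  assumes p: "1 \<le> p" "p < \<infinity>"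
    and g [measurable]: "g \<in> borel_measurable M"
    and h [measurable]: "h \<in> borel_measurable M"
    and hA: "\<And>x. norm (h x) \<le> A" and hB: "(\<integral>\<^sup>+ x. ennreal (norm (h x)) \<partial>M) \<le> ennreal B"
    and A: "0 < A" and B: "0 < B"
  shows "ennreal (norm (LINT x|M. g x * h x) / (2 * A powr recip p * B powr (1 - recip p)))
    \<le> Lnorm p M (\<lambda>x. ennreal (norm (g x)))"
proof (cases "Lnorm p M (\<lambda>x. ennreal (norm (g x)))")
  case (real \<nu>)
  obtain r where r: "1 \<le> r" "p = ennreal r" "recip p = 1 / r"
    using p by (metis exponent_cases less_irrefl)
  define J where "J = (\<integral>\<^sup>+ x. ennreal (norm (g x) powr r) \<partial>M)"
  have J: "ennpowr J (1 / r) = ennreal \<nu>"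
    using real r by (simp add: Lnorm_ennreal ennpowr_ennreal J_def)
  have J': "J = ennreal (\<nu> powr r)"
  proof (cases J)
    case (real y)
    then have "ennreal (y powr (1 / r)) = ennreal \<nu>" using J by (simp add: ennpowr_ennreal)
    then have "y powr (1 / r) = \<nu>" using \<open>0 \<le> \<nu>\<close> by (subst (asm) ennreal_inj) auto
    then show ?thesis using real r by (auto simp: powr_powr)
  qed (use J in \<open>simp add: ennpowr_def\<close>)
  have est: "norm (LINT x|M. g x * h x) \<le> 2 * A powr recip p * B powr (1 - recip p) * \<nu>"
  proof (cases "\<nu> = 0")
    case True
    then have "AE x in M. ennreal (norm (g x) powr r) = 0"
      using J' unfolding J_def by (subst nn_integral_0_iff_AE[symmetric]) auto
    then have "AE x in M. g x * h x = 0"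
      by (auto elim!: eventually_mono)
    then have "(LINT x|M. g x * h x) = (LINT x|M. 0)"
      by (intro integral_cong_AE) auto
    then show ?thesis using True by simp
  next
    case False
    then have \<nu>: "0 < \<nu>" using real by simp
    \<comment> \<open>The solution of
      \<open>\<mu> * B = \<mu> powr (1 - r) * A * \<nu> powr r\<close>: the two integrated terms
      become equal, which is the origin of the factor 2.\<close>
    define \<mu> where "\<mu> = (A / B) powr (1 / r) * \<nu>"
    have \<mu>: "0 < \<mu>" using A B \<nu> by (simp add: \<mu>_def)
    have pt: "norm (g x * h x) \<le> \<mu> * norm (h x) + \<mu> powr (1 - r) * A * norm (g x) powr r" for x
    proof -
      have "norm (g x) \<le> \<mu> + \<mu> powr (1 - r) * norm (g x) powr r"
      proof (cases "norm (g x) \<le> \<mu>")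
        case True
        then show ?thesis by (auto intro: order_trans)
      next
        case False
        then have "\<mu> powr (r - 1) \<le> norm (g x) powr (r - 1)"
          using r \<mu> by (intro powr_mono2) auto
        then have "norm (g x) * \<mu> powr (r - 1) \<le> norm (g x) * norm (g x) powr (r - 1)"
          by (intro mult_left_mono) auto
        also have "\<dots> = norm (g x) powr r"
          using False \<mu> by (simp add: powr_diff)
        finally have "norm (g x) \<le> norm (g x) powr r / \<mu> powr (r - 1)"
          using \<mu> by (simp add: pos_le_divide_eq)
        also have "\<dots> = \<mu> powr (1 - r) * norm (g x) powr r"
          using \<mu> by (simp add: powr_diff field_simps)
        finally show ?thesis using \<mu> by linarith
      qed
      then have "norm (g x) * norm (h x)
          \<le> (\<mu> + \<mu> powr (1 - r) * norm (g x) powr r) * norm (h x)"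
        by (intro mult_right_mono) auto
      also have "\<dots> = \<mu> * norm (h x) + (\<mu> powr (1 - r) * norm (g x) powr r) * norm (h x)"
        by (simp add: algebra_simps)
      also have "\<dots> \<le> \<mu> * norm (h x) + (\<mu> powr (1 - r) * norm (g x) powr r) * A"
        using hA by (intro add_left_mono mult_left_mono) auto
      finally show ?thesis by (simp add: norm_mult mult_ac)
    qed
    \<comment> \<open>If the product is not integrable, its Bochner integral is 0 by convention and
      the inequality is trivial.\<close>
    have "ennreal (norm (LINT x|M. g x * h x)) \<le> (\<integral>\<^sup>+ x. ennreal (norm (g x * h x)) \<partial>M)"
      by (cases "integrable M (\<lambda>x. g x * h x)")
        (auto simp: integral_norm_bound_ennreal not_integrable_integral_eq)
    also have "\<dots> \<le> (\<integral>\<^sup>+ x. ennreal \<mu> * ennreal (norm (h x))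
        + ennreal (\<mu> powr (1 - r) * A) * ennreal (norm (g x) powr r) \<partial>M)"
      using pt A \<mu> by (intro nn_integral_mono)
        (simp add: ennreal_leI flip: ennreal_mult ennreal_plus)
    also have "\<dots> = ennreal \<mu> * (\<integral>\<^sup>+ x. ennreal (norm (h x)) \<partial>M) + ennreal (\<mu> powr (1 - r) * A) * J"
      unfolding J_def by (subst nn_integral_add) (auto simp: nn_integral_cmult)
    also have "\<dots> \<le> ennreal \<mu> * ennreal B + ennreal (\<mu> powr (1 - r) * A) * ennreal (\<nu> powr r)"
      unfolding J' by (intro add_right_mono mult_left_mono hB) auto
    also have "\<dots> = ennreal (\<mu> * B + \<mu> powr (1 - r) * A * \<nu> powr r)"
      using \<mu> A B by (simp add: ennreal_mult ennreal_plus)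
    finally have "norm (LINT x|M. g x * h x) \<le> \<mu> * B + \<mu> powr (1 - r) * A * \<nu> powr r"
      using \<mu> A B by (subst (asm) ennreal_le_iff) auto
    also have "\<mu> powr (1 - r) * A * \<nu> powr r = \<mu> * B"
    proof -
      have "\<mu> powr r = A / B * \<nu> powr r"
        using A B \<nu> r by (simp add: \<mu>_def powr_mult powr_powr)
      then show ?thesis
        using A B \<nu> \<mu> by (simp add: powr_diff field_simps)
    qed
    also have "\<mu> * B = A powr recip p * B powr (1 - recip p) * \<nu>"
      using A B r by (simp add: \<mu>_def powr_divide powr_diff)
    finally show ?thesis by (simp add: mult_ac)
  qed
  then show ?thesis
    unfolding real using A B by (intro ennreal_leI) (simp add: divide_le_eq mult_ac)
qed simp

section \<open>Integration on Euclidean space\<close>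

lemma one_plus_norm_pos: "0 < 1 + norm x"
  by (simp add: add_pos_nonneg)

lemma borel_measurable_cis [measurable]:
  assumes [measurable]: "f \<in> borel_measurable M"
  shows "(\<lambda>x. cis (f x)) \<in> borel_measurable M"
  unfolding cis_conv_exp by measurable

lemma nn_integral_lborel_affine:
  fixes t :: "'a::euclidean_space"
  assumes [measurable]: "f \<in> borel_measurable borel" and c: "c \<noteq> 0"
  shows "(\<integral>\<^sup>+x. f x \<partial>lborel) = ennreal (\<bar>c\<bar> ^ DIM('a)) * (\<integral>\<^sup>+x. f (t + c *\<^sub>R x) \<partial>lborel)"
  by (subst lborel_affine[OF c, of t])
    (simp add: nn_integral_density nn_integral_distr nn_integral_cmult)

lemma integrable_lborel_affine:
  fixes f :: "'a::euclidean_space \<Rightarrow> 'b::{banach, second_countable_topology}"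
  assumes f: "integrable lborel f" and c: "c \<noteq> 0"
  shows "integrable lborel (\<lambda>x. f (t + c *\<^sub>R x))"
  using f f[THEN borel_measurable_integrable] c unfolding integrable_iff_bounded
  by (subst (asm) nn_integral_lborel_affine[where c=c and t=t]) (auto simp: ennreal_mult_less_top)

lemma integral_lborel_affine:
  fixes f :: "'a::euclidean_space \<Rightarrow> 'b::{banach, second_countable_topology}"
  assumes f: "integrable lborel f" and c: "c \<noteq> 0"
  shows "(LINT x|lborel. f (t + c *\<^sub>R x)) = (LINT x|lborel. f x) /\<^sub>R \<bar>c\<bar> ^ DIM('a)"
proof -
  have "(LINT x|lborel. f x) = \<bar>c\<bar> ^ DIM('a) *\<^sub>R (LINT x|lborel. f (t + c *\<^sub>R x))"
    using c f f[THEN borel_measurable_integrable] integrable_lborel_affine[OF f c, of t]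
    by (subst lborel_affine[OF c, of t]) (simp add: integral_density integral_distr)
  then show ?thesis using c by simp
qed

text \<open>Fubini: Lebesgue measure is the image of the product, over the basis, of one-dimensional
  Lebesgue measures.\<close>

lemma has_bochner_integral_lborel_prod:
  fixes f :: "'a::euclidean_space \<Rightarrow> real \<Rightarrow> 'b::{real_normed_field, banach, second_countable_topology}"
  assumes f: "\<And>b. b \<in> Basis \<Longrightarrow> integrable lborel (f b)"
  shows "has_bochner_integral lborel (\<lambda>x. \<Prod>b\<in>Basis. f b (x \<bullet> b)) (\<Prod>b\<in>Basis. LINT x|lborel. f b x)"
proof -
  interpret product_sigma_finite "\<lambda>_::'a. lborel :: real measure" by standard
  have [measurable]: "b \<in> Basis \<Longrightarrow> f b \<in> borel_measurable borel" for b
    using f borel_measurable_integrable by fastforce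
  have meas: "(\<lambda>x::'a. \<Prod>b\<in>Basis. f b (x \<bullet> b)) \<in> borel_measurable borel"
    by measurable
  have T: "(\<lambda>g. \<Sum>b\<in>Basis. g b *\<^sub>R b) \<in> measurable (\<Pi>\<^sub>M b\<in>(Basis::'a set). (lborel::real measure)) (borel::'a measure)"
    by measurable
  have eq: "(\<Prod>b\<in>Basis. f b ((\<Sum>i\<in>Basis. g i *\<^sub>R i) \<bullet> b)) = (\<Prod>b\<in>Basis. f b (g b))" for g :: "'a \<Rightarrow> real"
    by (intro prod.cong) (auto simp: inner_sum_left_Basis)
  have "integrable lborel (\<lambda>x::'a. \<Prod>b\<in>Basis. f b (x \<bullet> b))"
    by (subst lborel_eq, subst integrable_distr_eq[OF T meas], unfold eq)
      (intro product_integrable_prod f finite_Basis)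
  moreover have "(LINT x|lborel. (\<Prod>b\<in>Basis. f b (x \<bullet> b))) = (\<Prod>b\<in>Basis. LINT x|lborel. f b x)"
    by (subst lborel_eq, subst integral_distr[OF T meas], unfold eq)
      (intro product_integral_prod f finite_Basis)
  ultimately show ?thesis by (simp add: has_bochner_integral_iff)
qed

text \<open>The exponent provides two powers per coordinate: (1 + |x|)^2 is at least 1 + t^2 for
  each coordinate t of x, so the weight is dominated by a product of the integrable functions 1 / (1
  + t^2).\<close>

lemma integrable_polynomial_decay:
  "integrable lborel (\<lambda>x::'a::euclidean_space. 1 / (1 + norm x) ^ (2 * DIM('a)))"
proof (rule Bochner_Integration.integrable_bound)
  have "integrable lborel (\<lambda>x::real. 1 / (1 + x\<^sup>2))"
    using integrable_inverse_1_plus_square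
    by (simp add: set_integrable_def inverse_eq_divide einterval_eq)
  then show "integrable lborel (\<lambda>x::'a. \<Prod>b\<in>Basis. 1 / (1 + (x \<bullet> b)\<^sup>2))"
    using has_bochner_integral_lborel_prod[of "\<lambda>(_::'a) x. 1 / (1 + x\<^sup>2)"]
    by (simp add: has_bochner_integral_iff)
  show "AE x in lborel. norm (1 / (1 + norm x) ^ (2 * DIM('a)))
      \<le> norm (\<Prod>b\<in>(Basis::'a set). 1 / (1 + (x \<bullet> b)\<^sup>2))"
  proof (rule AE_I2)
    fix x :: 'a
    have "1 / (1 + norm x) ^ (2 * DIM('a)) = (\<Prod>b\<in>(Basis::'a set). 1 / (1 + norm x)\<^sup>2)"
      by (simp add: power_mult power_one_over)
    also have "\<dots> \<le> (\<Prod>b\<in>(Basis::'a set). 1 / (1 + (x \<bullet> b)\<^sup>2))"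
    proof (intro prod_mono conjI divide_left_mono)
      fix b :: 'a assume b: "b \<in> Basis"
      have "(x \<bullet> b)\<^sup>2 \<le> (norm x)\<^sup>2"
        using Basis_le_norm[OF b, of x] by (simp flip: abs_le_square_iff)
      then show "1 + (x \<bullet> b)\<^sup>2 \<le> (1 + norm x)\<^sup>2"
        by (simp add: power2_sum add_increasing2)
    next
      show "0 < (1 + norm x)\<^sup>2 * (1 + (x \<bullet> b)\<^sup>2)" for b
        by (intro mult_pos_pos zero_less_power one_plus_norm_pos) (simp add: add_pos_nonneg)
    qed auto
    finally show "norm (1 / (1 + norm x) ^ (2 * DIM('a)))
      \<le> norm (\<Prod>b\<in>(Basis::'a set). 1 / (1 + (x \<bullet> b)\<^sup>2))"
      by (simp add: abs_of_nonneg prod_nonneg)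
  qed
qed measurable

lemma integrable_pair_kernel:
  fixes f :: "'a::euclidean_space \<Rightarrow> complex" and g :: "'b::euclidean_space \<Rightarrow> complex"
  assumes f: "integrable lborel f" and g: "integrable lborel g"
    and k [measurable]: "(\<lambda>(x, y). k x y) \<in> borel_measurable (lborel \<Otimes>\<^sub>M lborel)"
    and k1: "\<And>x y. norm (k x y) \<le> 1"
  shows "integrable (lborel \<Otimes>\<^sub>M lborel) (\<lambda>(x, y). f x * g y * (k x y :: complex))"
proof (rule Bochner_Integration.integrable_bound)
  have [measurable]: "f \<in> borel_measurable borel" "g \<in> borel_measurable borel"
    using f g borel_measurable_integrable by fastforce+
  show "integrable (lborel \<Otimes>\<^sub>M lborel) (\<lambda>(x, y). f x * g y)"
    by (rule lborel_pair.Fubini_integrable)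
      (use f g in \<open>auto simp: norm_mult\<close>)
  show "AE z in lborel \<Otimes>\<^sub>M lborel. norm (case z of (x, y) \<Rightarrow> f x * g y * k x y)
      \<le> norm (case z of (x, y) \<Rightarrow> f x * g y)"
    using k1 by (auto simp: norm_mult intro!: AE_I2 mult_left_le)
  show "(\<lambda>(x, y). f x * g y * k x y) \<in> borel_measurable (lborel \<Otimes>\<^sub>M lborel)"
    by measurable
qed

lemma cis_mult_integrable:
  fixes f :: "'a::euclidean_space \<Rightarrow> complex"
  assumes "integrable lborel f"
  shows "integrable lborel (\<lambda>x. cis (a \<bullet> x) * f x)" "integrable lborel (\<lambda>x. cis (- (a \<bullet> x)) * f x)"
  by (rule Bochner_Integration.integrable_bound[OF assms];
      use assms[THEN borel_measurable_integrable] in \<open>auto simp: norm_mult\<close>)+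

section \<open>The Fourier transform on integrable functions\<close>

lemma fourier_norm_le:
  "norm (fourier f \<xi>) \<le> (LINT x|lborel. norm (f x))"
  unfolding fourier_def
  by (rule order_trans[OF integral_norm_bound]) (simp add: norm_mult)

text \<open>Fubini for a kernel of modulus 1. This is the duality behind Fourier inversion, the
  convolution theorem and the action of multipliers on distributions.\<close>

lemma fourier_multiplication:
  fixes f g :: "real^'n::finite \<Rightarrow> complex"
  assumes f: "integrable lborel f" and g: "integrable lborel g"
  shows "(LINT x|lborel. fourier f x * g x) = (LINT x|lborel. f x * fourier g x)"
proof -
  have int: "integrable (lborel \<Otimes>\<^sub>M lborel) (\<lambda>(x, y). f x * g y * cis (- (y \<bullet> x)))"
    by (intro integrable_pair_kernel f g) auto
  have "(LINT x|lborel. f x * fourier g x) = (LINT x|lborel. LINT y|lborel. f x * g y * cis (- (y \<bullet> x)))"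
    unfolding fourier_def
    by (subst integral_mult_right_zero[symmetric]) (simp add: mult_ac inner_commute)
  also have "\<dots> = (LINT y|lborel. LINT x|lborel. f x * g y * cis (- (y \<bullet> x)))"
    using lborel_pair.Fubini_integral[OF int] by simp
  also have "\<dots> = (LINT y|lborel. fourier f y * g y)"
  proof (intro Bochner_Integration.integral_cong refl)
    fix y :: "real^'n"
    show "(LINT x|lborel. f x * g y * cis (- (y \<bullet> x))) = fourier f y * g y"
      unfolding fourier_def by (subst integral_mult_left_zero[symmetric]) (simp add: mult_ac)
  qed
  finally show ?thesis by simp
qed

lemma fourier_affine:
  fixes f :: "real^'n::finite \<Rightarrow> complex"
  assumes f: "integrable lborel f" and c: "0 < c"
  shows "fourier (\<lambda>x. cis (a \<bullet> x) * f (c *\<^sub>R x - b)) \<xi> =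
    cis ((a - \<xi>) \<bullet> b / c) * fourier f ((\<xi> - a) /\<^sub>R c) / of_real (c ^ CARD('n))"
proof -
  define F where "F = (\<lambda>x. cis (- (((\<xi> - a) /\<^sub>R c) \<bullet> x)) * f x)"
  have F: "integrable lborel F" unfolding F_def by (intro cis_mult_integrable f)
  have eq: "cis (- (\<xi> \<bullet> x)) * (cis (a \<bullet> x) * f (c *\<^sub>R x - b)) =
      cis ((a - \<xi>) \<bullet> b / c) * F (- b + c *\<^sub>R x)" for x
  proof -
    have "- (\<xi> \<bullet> x) + a \<bullet> x = (a - \<xi>) \<bullet> b / c + - (((\<xi> - a) /\<^sub>R c) \<bullet> (- b + c *\<^sub>R x))"
      using c by (simp add: inner_simps field_simps)
    then show ?thesis by (simp add: F_def cis_mult flip: mult.assoc)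
  qed
  have "fourier (\<lambda>x. cis (a \<bullet> x) * f (c *\<^sub>R x - b)) \<xi> =
      cis ((a - \<xi>) \<bullet> b / c) * (LINT x|lborel. F (- b + c *\<^sub>R x))"
    unfolding fourier_def eq by simp
  also have "(LINT x|lborel. F (- b + c *\<^sub>R x)) = (LINT x|lborel. F x) /\<^sub>R \<bar>c\<bar> ^ CARD('n)"
    using integral_lborel_affine[OF F, of c "- b"] c by simp
  finally show ?thesis using c
    by (simp add: fourier_def F_def scaleR_conv_of_real divide_inverse mult_ac)
qed

lemma inv_fourier_eq_fourier:
  "inv_fourier f x = fourier f (- x) / of_real ((2 * pi) ^ CARD('n))"
  for f :: "real^'n::finite \<Rightarrow> complex"
  by (simp add: inv_fourier_def fourier_def)

lemma cnj_fourier: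
  "cnj (fourier f \<xi>) = fourier (\<lambda>x. cnj (f x)) (- \<xi>)"
  unfolding fourier_def Bochner_Integration.integral_cnj[symmetric] by (simp add: cis_cnj)

section \<open>The Gaussian as an eigenfunction of the Fourier transform\<close>

definition gauss :: "real^'n::finite \<Rightarrow> complex" where
  "gauss x = of_real (exp (- (norm x)\<^sup>2 / 2))"

text \<open>Up to the factor \<open>sqrt (2 * pi)\<close> of the density, this is the characteristic
  function of the standard normal distribution at -t.\<close>

lemma gauss_1d:
  "has_bochner_integral lborel (\<lambda>x::real. cis (- (t * x)) * of_real (exp (- x\<^sup>2 / 2)))
     (of_real (sqrt (2 * pi) * exp (- t\<^sup>2 / 2)))"
proof -
  have "integrable lborel (\<lambda>x. sqrt (2 * pi) * std_normal_density x)" by simp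
  then have "integrable lborel (\<lambda>x::real. exp (- x\<^sup>2 / 2))"
    by (simp add: std_normal_density_def)
  then have int: "integrable lborel (\<lambda>x::real. complex_of_real (exp (- x\<^sup>2 / 2)))"
    by (rule integrable_of_real)
  then have 1: "integrable lborel (\<lambda>x::real. cis (- (t * x)) * of_real (exp (- x\<^sup>2 / 2)))"
    by (rule Bochner_Integration.integrable_bound) (auto simp: norm_mult)
  have "complex_of_real (exp (- t\<^sup>2 / 2)) = char std_normal_distribution (- t)"
    by (simp add: char_std_normal_distribution)
  also have "\<dots> = (LINT x|lborel. std_normal_density x *\<^sub>R cis (- (t * x)))"
    unfolding char_def by (subst integral_density) (auto simp: cis_conv_exp)
  also have "\<dots> = (LINT x|lborel. of_real (1 / sqrt (2 * pi)) * (cis (- (t * x)) * of_real (exp (- x\<^sup>2 / 2))))"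
    by (simp add: std_normal_density_def scaleR_conv_of_real mult_ac)
  also have "\<dots> = of_real (1 / sqrt (2 * pi)) * (LINT x|lborel. (cis (- (t * x)) * of_real (exp (- x\<^sup>2 / 2))))"
    by simp
  finally have "(LINT x|lborel. (cis (- (t * x)) * of_real (exp (- x\<^sup>2 / 2))))
     = of_real (sqrt (2 * pi) * exp (- t\<^sup>2 / 2))"
    by (simp add: field_simps)
  with 1 show ?thesis by (simp add: has_bochner_integral_iff)
qed

lemma gauss_fourier_integral:
  fixes \<xi> :: "real^'n::finite"
  shows "has_bochner_integral lborel (\<lambda>x. cis (- (\<xi> \<bullet> x)) * gauss x)
     (of_real (sqrt (2 * pi) ^ CARD('n)) * gauss \<xi>)"
proof -
  have nrm: "(norm x)\<^sup>2 = (\<Sum>b\<in>Basis. (x \<bullet> b)\<^sup>2)" for x :: "real^'n"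
    unfolding power2_norm_eq_inner by (subst euclidean_inner) (simp add: power2_eq_square)
  have g: "gauss x = (\<Prod>b\<in>Basis. of_real (exp (- (x \<bullet> b)\<^sup>2 / 2)))" for x :: "real^'n"
  proof -
    have "- (norm x)\<^sup>2 / 2 = (\<Sum>b\<in>Basis. - (x \<bullet> b)\<^sup>2 / 2)"
      by (simp add: nrm sum_negf sum_divide_distrib)
    then show ?thesis by (simp only: gauss_def exp_sum finite_Basis of_real_prod)
  qed
  have c: "cis (- (\<xi> \<bullet> x)) = (\<Prod>b\<in>Basis. cis (- ((\<xi> \<bullet> b) * (x \<bullet> b))))" for x
  proof -
    have "\<i> * complex_of_real (- (\<xi> \<bullet> x)) = (\<Sum>b\<in>Basis. \<i> * complex_of_real (- ((\<xi> \<bullet> b) * (x \<bullet> b))))"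
      by (subst euclidean_inner) (simp add: sum_distrib_left sum_negf)
    then show ?thesis by (simp only: cis_conv_exp exp_sum finite_Basis)
  qed
  have "has_bochner_integral lborel (\<lambda>x. \<Prod>b\<in>Basis. cis (- ((\<xi> \<bullet> b) * (x \<bullet> b))) * of_real (exp (- (x \<bullet> b)\<^sup>2 / 2)))
     (\<Prod>b\<in>(Basis :: (real^'n) set). LINT x|lborel. cis (- ((\<xi> \<bullet> b) * x)) * of_real (exp (- x\<^sup>2 / 2)))"
    using gauss_1d by (intro has_bochner_integral_lborel_prod) (auto simp: has_bochner_integral_iff)
  also have "(\<Prod>b\<in>(Basis :: (real^'n) set). LINT x|lborel. cis (- ((\<xi> \<bullet> b) * x)) * of_real (exp (- x\<^sup>2 / 2)))
     = (\<Prod>b\<in>(Basis :: (real^'n) set). of_real (sqrt (2 * pi) * exp (- (\<xi> \<bullet> b)\<^sup>2 / 2)))"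
    using gauss_1d by (intro prod.cong) (auto simp: has_bochner_integral_iff)
  also have "\<dots> = of_real (sqrt (2 * pi) ^ CARD('n)) * gauss \<xi>"
    by (simp add: prod.distrib g)
  finally show ?thesis
    by (simp add: c g prod.distrib)
qed

lemma integrable_gauss: "integrable lborel (gauss :: real^'n::finite \<Rightarrow> complex)"
  using gauss_fourier_integral[of "0 :: real^'n"] by (simp add: has_bochner_integral_iff)

lemma fourier_gauss: "fourier gauss \<xi> = of_real (sqrt (2 * pi) ^ CARD('n)) * gauss \<xi>"
  for \<xi> :: "real^'n::finite"
  unfolding fourier_def using gauss_fourier_integral[of \<xi>] by (simp add: has_bochner_integral_iff)

lemma integral_gauss: "(LINT x::real^'n|lborel. gauss x) = of_real (sqrt (2 * pi) ^ CARD('n::finite))"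
  using fourier_gauss[of "0::real^'n"] by (simp add: fourier_def gauss_def)

section \<open>The Schwartz space\<close>

lemma partials_Nil [simp]: "partials [] f = f"
  and partials_Cons [simp]: "partials (i # \<alpha>) f = partial i (partials \<alpha> f)"
  and partials_snoc: "partials (\<alpha> @ [i]) f = partials \<alpha> (partial i f)"
  by (simp_all add: partials_def)

text \<open>Coinduction: closure properties are obtained by exhibiting a class of rapidly
  decreasing differentiable functions that is stable under partial derivatives.\<close>

lemma schwartz_coinduct:
  assumes f: "f \<in> S"
    and diff: "\<And>g x. g \<in> S \<Longrightarrow> g differentiable (at x)"
    and part: "\<And>g i. g \<in> S \<Longrightarrow> partial i g \<in> S"
    and dec: "\<And>g N. g \<in> S \<Longrightarrow> \<exists>C. \<forall>x. (1 + norm x) ^ N * norm (g x) \<le> C"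
  shows "f \<in> schwartz"
proof -
  have *: "partials \<alpha> f \<in> S" for \<alpha>
    by (induction \<alpha>) (simp_all add: f part)
  show ?thesis
    unfolding schwartz_def
  proof (intro CollectI allI conjI)
    fix \<alpha> N
    show "partials \<alpha> f differentiable_on UNIV"
      using diff[OF *] by (simp add: differentiable_on_def)
    show "bdd_above (range (\<lambda>x. (1 + norm x) ^ N * norm (partials \<alpha> f x)))"
      using dec[OF *, of N \<alpha>] by (auto simp: bdd_above_def)
  qed
qed

lemma schwartz_partial:
  assumes "f \<in> schwartz"
  shows "partial i f \<in> schwartz"
  using assms unfolding schwartz_def
  by (auto simp flip: partials_snoc simp del: fun_upd_apply)

lemma schwartz_differentiable:
  assumes "f \<in> schwartz"
  shows "f differentiable (at x)"
proof -
  have "partials [] f differentiable_on UNIV"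
    using assms unfolding schwartz_def by blast
  then show ?thesis by (simp add: differentiable_on_def)
qed

lemma schwartz_bdd_above:
  "f \<in> schwartz \<Longrightarrow> bdd_above (range (\<lambda>x. (1 + norm x) ^ N * norm (partials \<alpha> f x)))"
  by (simp add: schwartz_def)

lemma schwartz_has_derivative:
  "f \<in> schwartz \<Longrightarrow> (f has_derivative frechet_derivative f (at x)) (at x)"
  using schwartz_differentiable frechet_derivative_works by blast

lemma schwartz_decay:
  assumes "f \<in> schwartz"
  obtains C where "0 < C" "\<And>x. (1 + norm x) ^ N * norm (f x) \<le> C"
proof -
  obtain C where "\<forall>x. (1 + norm x) ^ N * norm (f x) \<le> C"
    using schwartz_bdd_above[OF assms, of N "[]"] by (auto simp: bdd_above_def)
  then show ?thesis
    using that[of "max 1 C"] by (auto simp: le_max_iff_disj)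
qed

lemma schwartz_decay_ex:
  "f \<in> schwartz \<Longrightarrow> \<exists>C. \<forall>x. (1 + norm x) ^ N * norm (f x) \<le> C"
  using schwartz_decay by metis

lemma schwartz_decay':
  assumes "f \<in> schwartz"
  obtains C where "0 < C" "\<And>x. norm (f x) \<le> C / (1 + norm x) ^ N"
proof -
  obtain C where "0 < C" and C: "\<And>x. (1 + norm x) ^ N * norm (f x) \<le> C"
    using schwartz_decay[OF assms] by blast
  moreover have "0 < (1 + norm x) ^ N" for x :: "real^'a"
    by (simp add: add_pos_nonneg)
  ultimately show ?thesis
    by (intro that[of C]) (auto simp: pos_le_divide_eq mult.commute)
qed

lemma schwartz_continuous: "f \<in> schwartz \<Longrightarrow> continuous_on UNIV f"
  by (meson continuous_at_imp_continuous_on differentiable_imp_continuous_within schwartz_differentiable)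

lemma schwartz_measurable [measurable_dest]: "f \<in> schwartz \<Longrightarrow> f \<in> borel_measurable borel"
  by (intro borel_measurable_continuous_onI schwartz_continuous)

lemma partial_eq:
  "(f has_derivative D) (at x) \<Longrightarrow> partial i f x = D (axis i 1)"
  unfolding partial_def using frechet_derivative_at by metis

section \<open>Closure properties of the Schwartz space\<close>

lemma schwartz_zero: "(\<lambda>x. 0) \<in> schwartz"
proof (rule schwartz_coinduct[where S = "{\<lambda>x. 0}"])
  show "partial i g \<in> {\<lambda>x. 0}" if "g \<in> {\<lambda>x. 0}" for i and g :: "real^'n \<Rightarrow> complex"
    using that by (auto intro!: ext partial_eq)
qed auto

lemma schwartz_lincomb:
  assumes "f \<in> schwartz" "g \<in> schwartz"
  shows "(\<lambda>x. c * f x + d * g x) \<in> schwartz"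
proof (rule schwartz_coinduct[where S = "{\<lambda>x. c * f x + d * g x | f g. f \<in> schwartz \<and> g \<in> schwartz}"])
  show "(\<lambda>x. c * f x + d * g x) \<in> {\<lambda>x. c * f x + d * g x | f g. f \<in> schwartz \<and> g \<in> schwartz}"
    using assms by blast
next
  fix h x assume "h \<in> {\<lambda>x. c * f x + d * g x | f g. f \<in> schwartz \<and> g \<in> schwartz}"
  then obtain f g where h: "h = (\<lambda>x. c * f x + d * g x)" and fg: "f \<in> schwartz" "g \<in> schwartz"
    by blast
  have D: "(h has_derivative (\<lambda>y. c * frechet_derivative f (at x) y + d * frechet_derivative g (at x) y)) (at x)" for x
    unfolding h by (intro derivative_intros schwartz_has_derivative fg)
  then show "h differentiable (at x)" by (auto simp: differentiable_def)
  have "partial i h = (\<lambda>x. c * partial i f x + d * partial i g x)" for i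
    using partial_eq[OF D] by (auto simp: partial_def)
  then show "partial i h \<in> {\<lambda>x. c * f x + d * g x | f g. f \<in> schwartz \<and> g \<in> schwartz}" for i
    using fg schwartz_partial by blast
  fix N
  obtain C1 C2 where C: "\<And>x. (1 + norm x) ^ N * norm (f x) \<le> C1"  "\<And>x. (1 + norm x) ^ N * norm (g x) \<le> C2"
    using fg by (meson schwartz_decay_ex)
  have "(1 + norm x) ^ N * norm (h x) \<le> norm c * C1 + norm d * C2" for x
  proof -
    have "(1 + norm x) ^ N * norm (h x) \<le> (1 + norm x) ^ N * (norm c * norm (f x) + norm d * norm (g x))"
      unfolding h by (intro mult_left_mono order_trans[OF norm_triangle_ineq]) (auto simp: norm_mult)
    also have "\<dots> = norm c * ((1 + norm x) ^ N * norm (f x)) + norm d * ((1 + norm x) ^ N * norm (g x))"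
      by (simp add: algebra_simps)
    also have "\<dots> \<le> norm c * C1 + norm d * C2"
      by (intro add_mono mult_left_mono C) auto
    finally show ?thesis .
  qed
  then show "\<exists>C. \<forall>x. (1 + norm x) ^ N * norm (h x) \<le> C" by blast
qed

lemma schwartz_add: "f \<in> schwartz \<Longrightarrow> g \<in> schwartz \<Longrightarrow> (\<lambda>x. f x + g x) \<in> schwartz"
  using schwartz_lincomb[of f g 1 1] by simp

lemma schwartz_cmult: "f \<in> schwartz \<Longrightarrow> (\<lambda>x. c * f x) \<in> schwartz"
  using schwartz_lincomb[of f f c 0] by simp

lemma schwartz_diff: "f \<in> schwartz \<Longrightarrow> g \<in> schwartz \<Longrightarrow> (\<lambda>x. f x - g x) \<in> schwartz"
  using schwartz_lincomb[of f g 1 "-1"] by simp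

lemma schwartz_sum:
  "finite K \<Longrightarrow> (\<And>k. k \<in> K \<Longrightarrow> f k \<in> schwartz) \<Longrightarrow> (\<lambda>x. \<Sum>k\<in>K. f k x) \<in> schwartz"
  by (induction K rule: finite_induct) (simp_all add: schwartz_zero schwartz_add)

lemma schwartz_cnj:
  assumes "f \<in> schwartz"
  shows "(\<lambda>x. cnj (f x)) \<in> schwartz"
proof (rule schwartz_coinduct[where S = "{\<lambda>x. cnj (f x) | f. f \<in> schwartz}"])
  fix h x assume "h \<in> {\<lambda>x. cnj (f x) | f. f \<in> schwartz}"
  then obtain f where h: "h = (\<lambda>x. cnj (f x))" and f: "f \<in> schwartz"
    by blast
  have D: "(h has_derivative (\<lambda>y. cnj (frechet_derivative f (at x) y))) (at x)" for x
    unfolding h by (intro derivative_intros schwartz_has_derivative f)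
  then show "h differentiable (at x)" by (auto simp: differentiable_def)
  have "partial i h = (\<lambda>x. cnj (partial i f x))" for i
    using partial_eq[OF D] by (auto simp: partial_def)
  then show "partial i h \<in> {\<lambda>x. cnj (f x) | f. f \<in> schwartz}" for i
    using f schwartz_partial by blast
  show "\<exists>C. \<forall>x. (1 + norm x) ^ N * norm (h x) \<le> C" for N
    using schwartz_decay_ex[OF f, of N] by (simp add: h)
qed (use assms in blast)

lemma has_derivative_affine_schwartz:
  fixes f :: "real^'n::finite \<Rightarrow> complex"
  assumes "f \<in> schwartz"
  shows "((\<lambda>x. f (c *\<^sub>R x + b)) has_derivative (\<lambda>y. frechet_derivative f (at (c *\<^sub>R x + b)) (c *\<^sub>R y))) (at x)"
  by (rule has_derivative_compose[OF _ schwartz_has_derivative[OF assms]])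
    (auto intro!: derivative_eq_intros)

lemma partial_affine:
  fixes f :: "real^'n::finite \<Rightarrow> complex"
  assumes "f \<in> schwartz"
  shows "partial i (\<lambda>x. f (c *\<^sub>R x + b)) = (\<lambda>x. of_real c * partial i f (c *\<^sub>R x + b))"
proof
  fix x
  have "linear (frechet_derivative f (at (c *\<^sub>R x + b)))"
    by (rule linear_frechet_derivative[OF schwartz_differentiable[OF assms]])
  then show "partial i (\<lambda>x. f (c *\<^sub>R x + b)) x = of_real c * partial i f (c *\<^sub>R x + b)"
    using partial_eq[OF has_derivative_affine_schwartz[OF assms]]
    by (simp add: partial_def linear_scale scaleR_conv_of_real[where 'a=complex])
qed

lemma schwartz_affine:
  fixes f :: "real^'n::finite \<Rightarrow> complex"
  assumes f: "f \<in> schwartz" and c: "c \<noteq> 0"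
  shows "(\<lambda>x. f (c *\<^sub>R x + b)) \<in> schwartz"
proof (rule schwartz_coinduct[where S = "{\<lambda>x. f (c *\<^sub>R x + b) | f. f \<in> schwartz}"])
  fix h x assume "h \<in> {\<lambda>x. f (c *\<^sub>R x + b) | f. f \<in> schwartz}"
  then obtain f where h: "h = (\<lambda>x. f (c *\<^sub>R x + b))" and f: "f \<in> schwartz"
    by blast
  show "h differentiable (at x)"
    using has_derivative_affine_schwartz[OF f] by (auto simp: h differentiable_def)
  show "partial i h \<in> {\<lambda>x. f (c *\<^sub>R x + b) | f. f \<in> schwartz}" for i
    using schwartz_cmult[OF schwartz_partial[OF f], of "of_real c"] by (auto simp: h partial_affine[OF f])
  fix N
  obtain C where C: "0 < C" "\<And>x. (1 + norm x) ^ N * norm (f x) \<le> C"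
    using schwartz_decay[OF f] by blast
  \<comment> \<open>From |x| \<le> (|c x + b| + |b|) / |c|: with this constant the weight at x is at
    most \<open>K\<close> times the weight at c x + b.\<close>
  define K where "K = 1 + (1 + norm b) / \<bar>c\<bar>"
  have K: "1 + norm x \<le> K * (1 + norm (c *\<^sub>R x + b))" for x
  proof -
    have "\<bar>c\<bar> * norm x \<le> norm (c *\<^sub>R x + b) + norm b"
      using norm_triangle_ineq4[of "c *\<^sub>R x + b" b] by simp
    then have "norm x \<le> (norm (c *\<^sub>R x + b) + norm b) / \<bar>c\<bar>"
      using c by (simp add: pos_le_divide_eq mult.commute)
    also have "\<dots> \<le> (1 + norm b) / \<bar>c\<bar> * (1 + norm (c *\<^sub>R x + b))"
      using c by (simp add: field_simps)
    finally show ?thesis by (simp add: K_def distrib_right add_increasing)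
  qed
  have "(1 + norm x) ^ N * norm (h x) \<le> K ^ N * C" for x
  proof -
    have "(1 + norm x) ^ N * norm (h x) \<le> (K * (1 + norm (c *\<^sub>R x + b))) ^ N * norm (h x)"
      by (intro mult_right_mono power_mono K) auto
    also have "\<dots> = K ^ N * ((1 + norm (c *\<^sub>R x + b)) ^ N * norm (f (c *\<^sub>R x + b)))"
      by (simp add: h power_mult_distrib)
    also have "\<dots> \<le> K ^ N * C"
      by (intro mult_left_mono C) (simp add: K_def)
    finally show ?thesis .
  qed
  then show "\<exists>C. \<forall>x. (1 + norm x) ^ N * norm (h x) \<le> C" by blast
qed (use f in blast)

text \<open>For fixed frequency \<open>a\<close> the class of modulated Schwartz functions is
  stable, since a partial derivative merely replaces f by i a_i f +
  \<open>partial i f\<close>.\<close>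

lemma schwartz_cis_mult:
  fixes f :: "real^'n::finite \<Rightarrow> complex"
  assumes f: "f \<in> schwartz"
  shows "(\<lambda>x. cis (a \<bullet> x) * f x) \<in> schwartz"
proof (rule schwartz_coinduct[where S = "{\<lambda>x. cis (a \<bullet> x) * f x | f. f \<in> schwartz}"])
  fix h x assume "h \<in> {\<lambda>x. cis (a \<bullet> x) * f x | f. f \<in> schwartz}"
  then obtain f where h: "h = (\<lambda>x. cis (a \<bullet> x) * f x)" and f: "f \<in> schwartz"
    by blast
  have D: "(h has_derivative (\<lambda>y. cis (a \<bullet> x) * (\<i> * of_real (a \<bullet> y) * f x + frechet_derivative f (at x) y))) (at x)" for x
  proof -
    have "((\<lambda>x. cis (a \<bullet> x)) has_derivative (\<lambda>y. (a \<bullet> y) *\<^sub>R (\<i> * cis (a \<bullet> x)))) (at x)"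
      by (rule has_derivative_cis) (auto intro!: derivative_eq_intros)
    from has_derivative_mult[OF this schwartz_has_derivative[OF f]] show ?thesis
      unfolding h by (rule has_derivative_eq_rhs) (auto simp: scaleR_conv_of_real algebra_simps)
  qed
  then show "h differentiable (at x)" by (auto simp: differentiable_def)
  have *: "partial i h = (\<lambda>x. cis (a \<bullet> x) * (\<i> * of_real (a $ i) * f x + 1 * partial i f x))" for i
    using partial_eq[OF D] by (auto simp: partial_def inner_axis)
  show "partial i h \<in> {\<lambda>x. cis (a \<bullet> x) * f x | f. f \<in> schwartz}" for i
    unfolding * mem_Collect_eq
    by (rule exI[of _ "\<lambda>x. \<i> * of_real (a $ i) * f x + 1 * partial i f x"])
      (intro conjI refl schwartz_partial schwartz_lincomb f)
  show "\<exists>C. \<forall>x. (1 + norm x) ^ N * norm (h x) \<le> C" for N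
    using schwartz_decay_ex[OF f, of N] by (simp add: h norm_mult)
qed (use f in blast)

text \<open>Differentiating the factor \<open>x $ k\<close> leaves a plain Schwartz function behind;
  the summand g in the coinductive class absorbs it.\<close>

lemma schwartz_coordinate_mult:
  fixes f :: "real^'n::finite \<Rightarrow> complex"
  assumes f: "f \<in> schwartz"
  shows "(\<lambda>x. of_real (x $ k) * f x) \<in> schwartz"
proof (rule schwartz_coinduct[where S = "{\<lambda>x. of_real (x $ k) * f x + g x | f g. f \<in> schwartz \<and> g \<in> schwartz}"])
  show "(\<lambda>x. of_real (x $ k) * f x) \<in> {\<lambda>x. of_real (x $ k) * f x + g x | f g. f \<in> schwartz \<and> g \<in> schwartz}"
    using f schwartz_zero by force
next
  fix h x assume "h \<in> {\<lambda>x. of_real (x $ k) * f x + g x | f g. f \<in> schwartz \<and> g \<in> schwartz}"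
  then obtain f g where h: "h = (\<lambda>x. of_real (x $ k) * f x + g x)" and fg: "f \<in> schwartz" "g \<in> schwartz"
    by blast
  have D: "(h has_derivative (\<lambda>y. of_real (x $ k) * frechet_derivative f (at x) y + (of_real (y $ k) * f x + frechet_derivative g (at x) y))) (at x)" for x
    unfolding h
    by (auto intro!: derivative_eq_intros schwartz_has_derivative fg bounded_linear_imp_has_derivative
        bounded_linear_compose[OF bounded_linear_of_real] bounded_linear_vec_nth
        simp: algebra_simps)
  then show "h differentiable (at x)" by (auto simp: differentiable_def)
  have *: "partial i h = (\<lambda>x. of_real (x $ k) * partial i f x + ((if i = k then 1 else 0) * f x + 1 * partial i g x))" for i
    using partial_eq[OF D] by (auto simp: partial_def axis_def)
  show "partial i h \<in> {\<lambda>x. of_real (x $ k) * f x + g x | f g. f \<in> schwartz \<and> g \<in> schwartz}" for i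
    unfolding * mem_Collect_eq
    by (rule exI[of _ "partial i f"], rule exI[of _ "\<lambda>x. (if i = k then 1 else 0) * f x + 1 * partial i g x"])
      (intro conjI refl schwartz_partial schwartz_lincomb fg)
  fix N
  obtain C1 C2 where C: "\<And>x. (1 + norm x) ^ Suc N * norm (f x) \<le> C1"  "\<And>x. (1 + norm x) ^ N * norm (g x) \<le> C2"
    using fg by (meson schwartz_decay_ex)
  have "(1 + norm x) ^ N * norm (h x) \<le> C1 + C2" for x
  proof -
    have "norm (h x) \<le> \<bar>x $ k\<bar> * norm (f x) + norm (g x)"
      unfolding h by (intro order_trans[OF norm_triangle_ineq]) (auto simp: norm_mult)
    also have "\<dots> \<le> (1 + norm x) * norm (f x) + norm (g x)"
      using component_le_norm_cart[of x k] by (intro add_right_mono mult_right_mono) auto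
    finally have "(1 + norm x) ^ N * norm (h x) \<le> (1 + norm x) ^ N * ((1 + norm x) * norm (f x) + norm (g x))"
      by (intro mult_left_mono) auto
    also have "\<dots> \<le> C1 + C2"
      using add_mono[OF C] by (simp add: algebra_simps)
    finally show ?thesis .
  qed
  then show "\<exists>C. \<forall>x. (1 + norm x) ^ N * norm (h x) \<le> C" by blast
qed

text \<open>By the Leibniz rule a derivative of a product is a sum of two products, so a class
  stable under differentiation has to contain sums.\<close>

inductive_set schwartz_products :: "(real^'n::finite \<Rightarrow> complex) set" where
  mult: "f \<in> schwartz \<Longrightarrow> g \<in> schwartz \<Longrightarrow> (\<lambda>x. f x * g x) \<in> schwartz_products"
| add: "f \<in> schwartz_products \<Longrightarrow> g \<in> schwartz_products \<Longrightarrow> (\<lambda>x. f x + g x) \<in> schwartz_products"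

lemma has_derivative_mult_schwartz:
  assumes "f \<in> schwartz" "g \<in> schwartz"
  shows "((\<lambda>x. f x * g x) has_derivative
     (\<lambda>y. f x * frechet_derivative g (at x) y + frechet_derivative f (at x) y * g x)) (at x)"
  by (intro has_derivative_mult schwartz_has_derivative assms)

lemma partial_mult:
  assumes "f \<in> schwartz" "g \<in> schwartz"
  shows "partial i (\<lambda>x. f x * g x) = (\<lambda>x. f x * partial i g x + partial i f x * g x)"
  using partial_eq[OF has_derivative_mult_schwartz[OF assms]] by (auto simp: partial_def)

lemma schwartz_products_differentiable: "f \<in> schwartz_products \<Longrightarrow> f differentiable (at x)"
  by (induction rule: schwartz_products.induct)
    (auto intro: differentiable_mult differentiable_add schwartz_differentiable)

lemma partial_add:
  assumes "f differentiable (at x)" "g differentiable (at x)"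
  shows "partial i (\<lambda>x. f x + g x) x = partial i f x + partial i g x"
  using assms partial_eq[OF has_derivative_add]
  unfolding frechet_derivative_works partial_def by blast

lemma schwartz_mult:
  fixes f :: "real^'n::finite \<Rightarrow> complex"
  assumes "f \<in> schwartz" "g \<in> schwartz"
  shows "(\<lambda>x. f x * g x) \<in> schwartz"
proof (rule schwartz_coinduct)
  show "(\<lambda>x. f x * g x) \<in> schwartz_products"
    using assms by (rule schwartz_products.mult)
next
  fix h :: "real^'n \<Rightarrow> complex" and x i N assume h: "h \<in> schwartz_products"
  show d: "h differentiable (at x)" for x
    using h by (rule schwartz_products_differentiable)
  show "partial i h \<in> schwartz_products"
    using h
  proof induction
    case (mult f g)
    then show ?case
      by (simp add: partial_mult schwartz_partial schwartz_products.intros)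
  next
    case (add f g)
    have "partial i (\<lambda>x. f x + g x) = (\<lambda>x. partial i f x + partial i g x)"
      using add by (intro ext partial_add schwartz_products_differentiable)
    then show ?case using add by (simp add: schwartz_products.intros)
  qed
  show "\<exists>C. \<forall>x. (1 + norm x) ^ N * norm (h x) \<le> C"
    using h
  proof induction
    case (mult f g)
    obtain C1 C2 where C: "0 < C1" "\<And>x. (1 + norm x) ^ N * norm (f x) \<le> C1"
       "0 < C2" "\<And>x. (1 + norm x) ^ 0 * norm (g x) \<le> C2"
      using mult by (meson schwartz_decay)
    have "(1 + norm x) ^ N * norm (f x * g x) \<le> C1 * C2" for x
      using mult_mono[OF C(2) C(4), of x x] C by (simp add: norm_mult mult.assoc)
    then show ?case by blast
  next
    case (add f g)
    then obtain C1 C2 where C: "\<And>x. (1 + norm x) ^ N * norm (f x) \<le> C1"  "\<And>x. (1 + norm x) ^ N * norm (g x) \<le> C2"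
      by blast
    have "(1 + norm x) ^ N * norm (f x + g x) \<le> C1 + C2" for x
    proof -
      have "(1 + norm x) ^ N * norm (f x + g x) \<le> (1 + norm x) ^ N * (norm (f x) + norm (g x))"
        by (intro mult_left_mono norm_triangle_ineq) auto
      also have "\<dots> \<le> C1 + C2"
        using add_mono[OF C] by (simp add: algebra_simps)
      finally show ?thesis .
    qed
    then show ?case by blast
  qed
qed

section \<open>Integrals of Schwartz functions and of their derivatives\<close>

lemma schwartz_integrable_weighted:
  fixes f :: "real^'n::finite \<Rightarrow> complex"
  assumes f: "f \<in> schwartz"
  shows "integrable lborel (\<lambda>x. (1 + norm x) ^ N * norm (f x))"
proof -
  let ?L = "2 * DIM(real^'n)"
  obtain C where C: "\<And>x. (1 + norm x) ^ (N + ?L) * norm (f x) \<le> C"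
    using schwartz_decay[OF f] by metis
  have [measurable]: "f \<in> borel_measurable borel" by (rule schwartz_measurable[OF f])
  have *: "(1 + norm x) ^ N * norm (f x) \<le> C * (1 / (1 + norm x) ^ ?L)" for x
    using C[of x] one_plus_norm_pos[of x]
    by (simp add: power_add pos_le_divide_eq mult_ac)
  have "integrable lborel (\<lambda>x::real^'n. C * (1 / (1 + norm x) ^ ?L))"
    by (intro integrable_mult_right integrable_polynomial_decay)
  then show ?thesis
    by (rule Bochner_Integration.integrable_bound)
      (use * in \<open>auto simp del: times_divide_eq_right intro!: AE_I2 order_trans[OF *]\<close>)
qed

lemma schwartz_integrable: "f \<in> schwartz \<Longrightarrow> integrable lborel f"
  using schwartz_integrable_weighted[of f 0] schwartz_measurable[of f]
  by (simp add: integrable_norm_iff)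

lemma schwartz_directional_derivative:
  fixes f :: "real^'n::finite \<Rightarrow> complex"
  assumes f: "f \<in> schwartz"
  shows "((\<lambda>s. f (x + s *\<^sub>R axis i 1)) has_vector_derivative partial i f (x + s *\<^sub>R axis i 1)) (at s within A)"
proof -
  have "linear (frechet_derivative f (at (x + s *\<^sub>R axis i 1)))"
    by (rule linear_frechet_derivative[OF schwartz_differentiable[OF f]])
  moreover have "((\<lambda>s. f (x + s *\<^sub>R axis i 1)) has_derivative
      (\<lambda>h. frechet_derivative f (at (x + s *\<^sub>R axis i 1)) (h *\<^sub>R axis i 1))) (at s within A)"
    by (rule has_derivative_compose[OF _ schwartz_has_derivative[OF f]])
      (auto intro!: derivative_eq_intros)
  ultimately show ?thesis
    by (simp add: has_vector_derivative_def partial_def linear_scale)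
qed

lemma schwartz_difference_le:
  fixes f :: "real^'n::finite \<Rightarrow> complex"
  assumes f: "f \<in> schwartz" and C: "\<And>y. norm (partial i f y) \<le> C y" 
    and le: "\<And>s. 0 \<le> s \<Longrightarrow> s \<le> t \<Longrightarrow> C (x + s *\<^sub>R axis i 1) \<le> B" and t: "0 \<le> t"
  shows "norm (f (x + t *\<^sub>R axis i 1) - f x) \<le> B * t"
proof -
  have "norm (f (x + t *\<^sub>R axis i 1) - f (x + 0 *\<^sub>R axis i 1)) \<le> B * norm (t - 0)"
    by (rule differentiable_bound[where S = "{0..t}" and f' = "\<lambda>s h. h *\<^sub>R partial i f (x + s *\<^sub>R axis i 1)"])
      (use schwartz_directional_derivative[OF f] t order_trans[OF C le] in \<open>auto simp: has_vector_derivative_def onorm_scaleR_left onorm_id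
         intro!: onorm_le simp: mult.commute mult_right_mono\<close>)
  then show ?thesis using t by simp
qed

text \<open>Differentiating the translation invariance of the integral.\<close>

lemma integral_partial:
  fixes f :: "real^'n::finite \<Rightarrow> complex"
  assumes f: "f \<in> schwartz"
  shows "(LINT x|lborel. partial i f x) = 0"
proof -
  let ?e = "axis i 1 :: real^'n"
  let ?L = "2 * DIM(real^'n)"
  define t where "t k = inverse (real (Suc k))" for k
  have t: "0 < t k" "t k \<le> 1" for k by (auto simp: t_def inverse_eq_divide)
  have t0: "t \<longlonglongrightarrow> 0" unfolding t_def by (rule LIMSEQ_inverse_real_of_nat)
  define q where "q k x = (f (x + t k *\<^sub>R ?e) - f x) /\<^sub>R t k" for k x
  have meas [measurable]: "f \<in> borel_measurable borel" "partial i f \<in> borel_measurable borel"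
    using f by (auto intro: schwartz_measurable schwartz_partial)
  have int: "integrable lborel f" by (rule schwartz_integrable[OF f])
  have int_t: "integrable lborel (\<lambda>x. f (x + t k *\<^sub>R ?e))" for k
    using integrable_lborel_affine[OF int, of 1 "t k *\<^sub>R ?e"] by (simp add: add.commute)
  have int0: "(LINT x|lborel. q k x) = 0" for k
  proof -
    have "(LINT x|lborel. f (x + t k *\<^sub>R ?e)) = (LINT x|lborel. f x)"
      using integral_lborel_affine[OF int, of 1 "t k *\<^sub>R ?e"] by (simp add: add.commute)
    then show ?thesis
      unfolding q_def using int int_t[of k] by simp
  qed
  obtain C where "0 < C" and C: "\<And>x. norm (partial i f x) \<le> C / (1 + norm x) ^ ?L"
    using schwartz_decay'[OF schwartz_partial[OF f]] by metis
  have aux: "a \<le> b + c \<Longrightarrow> c \<le> 1 \<Longrightarrow> 0 \<le> b \<Longrightarrow> 1 + a \<le> 2 * (1 + b)" for a b c :: real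
    by simp
  \<comment> \<open>A majorant independent of k for dominated convergence. The steps have length at
    most 1, along which the weight 1 + |x| changes by at most a factor 2; hence the constant
    \<open>2 ^ ?L\<close>.\<close>
  have bound: "norm (q k x) \<le> C * 2 ^ ?L * (1 / (1 + norm x) ^ ?L)" for k x
  proof -
    have "norm (f (x + t k *\<^sub>R ?e) - f x) \<le> C * 2 ^ ?L * (1 / (1 + norm x) ^ ?L) * t k"
    proof (rule schwartz_difference_le[OF f C])
      fix s :: real assume s: "0 \<le> s" "s \<le> t k"
      have "norm x \<le> norm (x + s *\<^sub>R ?e) + norm (s *\<^sub>R ?e)"
        using norm_triangle_ineq4[of "x + s *\<^sub>R ?e" "s *\<^sub>R ?e"] by simp
      moreover have "norm (s *\<^sub>R ?e) \<le> 1"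
        using s t(2)[of k] by simp
      ultimately have "1 + norm x \<le> 2 * (1 + norm (x + s *\<^sub>R ?e))"
        by (intro aux[OF _ _ norm_ge_zero])
      then have "(1 + norm x) ^ ?L \<le> 2 ^ ?L * (1 + norm (x + s *\<^sub>R ?e)) ^ ?L"
        by (metis power_mono power_mult_distrib one_plus_norm_pos less_imp_le)
      then have "C * (1 + norm x) ^ ?L \<le> C * (2 ^ ?L * (1 + norm (x + s *\<^sub>R ?e)) ^ ?L)"
        using \<open>0 < C\<close> by (intro mult_left_mono) auto
      then show "C / (1 + norm (x + s *\<^sub>R ?e)) ^ ?L \<le> C * 2 ^ ?L * (1 / (1 + norm x) ^ ?L)"
        using one_plus_norm_pos[of x] one_plus_norm_pos[of "x + s *\<^sub>R ?e"]
        by (simp add: pos_divide_le_eq pos_le_divide_eq mult_ac)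
    qed (use t less_imp_le in auto)
    then show ?thesis
      using t(1)[of k] by (simp add: q_def pos_divide_le_eq divide_inverse mult_ac) (simp add: field_simps)
  qed
  have lim: "(\<lambda>k. q k x) \<longlonglongrightarrow> partial i f x" for x
  proof -
    have D: "((\<lambda>s. norm (f (x + s *\<^sub>R ?e) - f x - s *\<^sub>R partial i f x) / norm s) \<longlongrightarrow> 0) (at 0)"
      using schwartz_directional_derivative[OF f, of x i 0 UNIV]
      by (simp add: has_vector_derivative_def has_derivative_at)
    have "norm (f (x + s *\<^sub>R ?e) - f x - s *\<^sub>R partial i f x) / norm s =
        norm ((f (x + s *\<^sub>R ?e) - f x) /\<^sub>R s - partial i f x)" if "s \<noteq> 0" for s
    proof -
      have "(f (x + s *\<^sub>R ?e) - f x) /\<^sub>R s - partial i f x = (f (x + s *\<^sub>R ?e) - f x - s *\<^sub>R partial i f x) /\<^sub>R s"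
        using that by (simp add: scaleR_diff_right)
      then show ?thesis by (simp add: divide_inverse mult.commute)
    qed
    then have "\<forall>\<^sub>F s in at 0. norm (f (x + s *\<^sub>R ?e) - f x - s *\<^sub>R partial i f x) / norm s =
        norm ((f (x + s *\<^sub>R ?e) - f x) /\<^sub>R s - partial i f x)"
      unfolding eventually_at_filter by (intro always_eventually allI impI)
    with D have "((\<lambda>s. norm ((f (x + s *\<^sub>R ?e) - f x) /\<^sub>R s - partial i f x)) \<longlongrightarrow> 0) (at 0)"
      by (rule Lim_transform_eventually)
    then have *: "((\<lambda>s. (f (x + s *\<^sub>R ?e) - f x) /\<^sub>R s) \<longlongrightarrow> partial i f x) (at 0)"
      by (rule LIM_zero_cancel[OF tendsto_norm_zero_cancel])
    show ?thesis
      unfolding q_def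
      by (rule filterlim_compose[OF *])
        (use t(1) in \<open>auto simp: filterlim_at less_le intro!: always_eventually t0\<close>)
  qed
  have "(\<lambda>k. LINT x|lborel. q k x) \<longlonglongrightarrow> (LINT x|lborel. partial i f x)"
  proof (rule integral_dominated_convergence[where w = "\<lambda>x. C * 2 ^ ?L * (1 / (1 + norm x) ^ ?L)"])
    show "integrable lborel (\<lambda>x::real^'n. C * 2 ^ ?L * (1 / (1 + norm x) ^ ?L))"
      by (intro integrable_mult_right integrable_polynomial_decay)
    show "q k \<in> borel_measurable lborel" for k unfolding q_def by measurable
  qed (use lim bound in auto)
  then show ?thesis
    by (simp add: int0 LIMSEQ_const_iff)
qed

section \<open>The Fourier transform on the Schwartz space and its inversion\<close>

lemma fourier_partial:
  fixes f :: "real^'n::finite \<Rightarrow> complex"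
  assumes f: "f \<in> schwartz"
  shows "fourier (partial i f) \<xi> = \<i> * of_real (\<xi> $ i) * fourier f \<xi>"
proof -
  \<comment> \<open>Integration by parts: the integral of \<open>partial i h\<close> vanishes by
    \<open>integral_partial\<close>, and the product rule splits it into the two sides of the
    claim.\<close>
  define h where "h = (\<lambda>x. cis ((- \<xi>) \<bullet> x) * f x)"
  have D: "(h has_derivative (\<lambda>y. cis ((-\<xi>) \<bullet> x) * frechet_derivative f (at x) y + ((-\<xi>) \<bullet> y) *\<^sub>R (\<i> * cis ((-\<xi>) \<bullet> x)) * f x)) (at x)" for x
  proof -
    have "((\<lambda>x. cis ((-\<xi>) \<bullet> x)) has_derivative (\<lambda>y. ((-\<xi>) \<bullet> y) *\<^sub>R (\<i> * cis ((-\<xi>) \<bullet> x)))) (at x)"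
      by (rule has_derivative_cis) (auto intro!: derivative_eq_intros)
    from has_derivative_mult[OF this schwartz_has_derivative[OF f]] show ?thesis
      unfolding h_def .
  qed
  have p: "partial i h x = cis (- (\<xi> \<bullet> x)) * partial i f x - \<i> * of_real (\<xi> $ i) * (cis (- (\<xi> \<bullet> x)) * f x)" for x
    using partial_eq[OF D] by (simp add: partial_def inner_axis scaleR_conv_of_real[where 'a=complex] mult_ac)
  have "0 = (LINT x|lborel. partial i h x)"
    using integral_partial[of h i] schwartz_cis_mult[OF f, of "- \<xi>"] by (simp add: h_def)
  also have "\<dots> = fourier (partial i f) \<xi> - \<i> * of_real (\<xi> $ i) * fourier f \<xi>"
    unfolding p fourier_def
    by (subst Bochner_Integration.integral_diff)
      (auto intro!: cis_mult_integrable(2) schwartz_integrable[OF schwartz_partial[OF f]] schwartz_integrable[OF f])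
  finally show ?thesis by simp
qed

lemma fourier_cmult: "fourier (\<lambda>x. c * f x) \<xi> = c * fourier f \<xi>"
  by (simp add: fourier_def mult.left_commute)

lemma one_plus_norm_le_sum: "1 + norm x \<le> 1 + (\<Sum>i\<in>UNIV. \<bar>x $ i\<bar>)"
  for x :: "real^'n::finite"
  by (simp add: norm_le_l1_cart)

text \<open>Each power of the weight is traded for a derivative of f: 1 + |\<xi>| is at most 1 plus
  the sum of the |\<xi>_i|, and \<xi>_i times the transform is, up to a factor of modulus 1, the
  transform of \<open>partial i f\<close>. The induction therefore has f arbitrary.\<close>

lemma fourier_decay:
  fixes f :: "real^'n::finite \<Rightarrow> complex"
  assumes "f \<in> schwartz"
  shows "\<exists>C. \<forall>\<xi>. (1 + norm \<xi>) ^ N * norm (fourier f \<xi>) \<le> C"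
  using assms
proof (induction N arbitrary: f)
  case 0
  then show ?case using fourier_norm_le[of f] by auto
next
  case (Suc N)
  obtain C0 where C0: "\<And>\<xi>. (1 + norm \<xi>) ^ N * norm (fourier f \<xi>) \<le> C0"
    using Suc by blast
  have "\<forall>i. \<exists>C. \<forall>\<xi>. (1 + norm \<xi>) ^ N * norm (fourier (partial i f) \<xi>) \<le> C"
    using Suc schwartz_partial by blast
  then obtain C where C: "\<And>i \<xi>. (1 + norm \<xi>) ^ N * norm (fourier (partial i f) \<xi>) \<le> C i"
    by metis
  have "(1 + norm \<xi>) ^ Suc N * norm (fourier f \<xi>) \<le> C0 + (\<Sum>i\<in>UNIV. C i)" for \<xi>
  proof -
    have "(1 + norm \<xi>) ^ Suc N * norm (fourier f \<xi>) = (1 + norm \<xi>) * ((1 + norm \<xi>) ^ N * norm (fourier f \<xi>))"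
      by simp
    also have "\<dots> \<le> (1 + (\<Sum>i\<in>UNIV. \<bar>\<xi> $ i\<bar>)) * ((1 + norm \<xi>) ^ N * norm (fourier f \<xi>))"
      by (intro mult_right_mono one_plus_norm_le_sum) auto
    also have "\<dots> = (1 + norm \<xi>) ^ N * norm (fourier f \<xi>) +
        (\<Sum>i\<in>UNIV. (1 + norm \<xi>) ^ N * norm (fourier (partial i f) \<xi>))"
      by (simp add: fourier_partial[OF Suc.prems] norm_mult algebra_simps sum_distrib_left)
    also have "\<dots> \<le> C0 + (\<Sum>i\<in>UNIV. C i)"
      by (intro add_mono sum_mono C C0)
    finally show ?thesis .
  qed
  then show ?case by blast
qed

lemma norm_cis_minus_linear_le: "norm (cis (a + b) - cis a - \<i> * of_real b * cis a) \<le> b\<^sup>2"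
proof -
  have "cis (a + b) - cis a - \<i> * of_real b * cis a = cis a * (iexp b - (\<Sum>k\<le>1. (\<i> * of_real b) ^ k / fact k))"
    by (simp add: algebra_simps cis_conv_exp exp_add)
  also have "norm \<dots> \<le> 1 * (\<bar>b\<bar> ^ Suc 1 / fact (Suc 1))"
    unfolding norm_mult using iexp_approx1[of b 1] by (intro mult_mono) auto
  also have "\<dots> \<le> b\<^sup>2" by (simp add: power2_eq_square)
  finally show ?thesis .
qed

text \<open>Differentiation under the integral by an explicit remainder: the second-order bound for
  \<open>cis\<close>, integrated against |f|, gives an error of at most K |h|^2, where K is a
  weighted integral that is finite for Schwartz functions.\<close>

lemma has_derivative_fourier:
  fixes f :: "real^'n::finite \<Rightarrow> complex"
  assumes f: "f \<in> schwartz"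
  shows "(fourier f has_derivative
    (\<lambda>h. \<Sum>i\<in>UNIV. of_real (h $ i) * fourier (\<lambda>x. - \<i> * (of_real (x $ i) * f x)) \<xi>)) (at \<xi>)"
proof -
  let ?D = "\<lambda>h::real^'n. \<Sum>i\<in>UNIV. of_real (h $ i) * fourier (\<lambda>x. - \<i> * (of_real (x $ i) * f x)) \<xi>"
  define K where "K = (LINT x|lborel. (1 + norm x)\<^sup>2 * norm (f x))"
  have D: "?D h = (LINT x|lborel. - \<i> * of_real (h \<bullet> x) * (cis (- (\<xi> \<bullet> x)) * f x))"
    and intD: "integrable lborel (\<lambda>x. - \<i> * of_real (h \<bullet> x) * (cis (- (\<xi> \<bullet> x)) * f x))" for h
  proof -
    have eq: "(\<Sum>i\<in>UNIV. of_real (h $ i) * (cis (- (\<xi> \<bullet> x)) * (- \<i> * (of_real (x $ i) * f x)))) =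
       - \<i> * of_real (h \<bullet> x) * (cis (- (\<xi> \<bullet> x)) * f x)" for x
      by (simp add: inner_vec_def sum_distrib_left sum_distrib_right mult_ac sum_negf)
    have int: "integrable lborel (\<lambda>x. of_real (h $ i) * (cis (- (\<xi> \<bullet> x)) * (- \<i> * (of_real (x $ i) * f x))))" for i
      by (intro integrable_mult_right cis_mult_integrable schwartz_integrable schwartz_cmult
          schwartz_coordinate_mult f)
    show "?D h = (LINT x|lborel. - \<i> * of_real (h \<bullet> x) * (cis (- (\<xi> \<bullet> x)) * f x))"
      unfolding fourier_def eq[symmetric] by (subst Bochner_Integration.integral_sum) (use int in auto)
    show "integrable lborel (\<lambda>x. - \<i> * of_real (h \<bullet> x) * (cis (- (\<xi> \<bullet> x)) * f x))"
      unfolding eq[symmetric] by (intro Bochner_Integration.integrable_sum int)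
  qed
  have est: "norm (fourier f (\<xi> + h) - fourier f \<xi> - ?D h) \<le> K * (norm h)\<^sup>2" for h
  proof -
    have i: "integrable lborel (\<lambda>x. cis (- (\<xi> \<bullet> x)) * f x)" for \<xi>
      by (intro cis_mult_integrable schwartz_integrable f)
    have "fourier f (\<xi> + h) - fourier f \<xi> - ?D h = fourier f (\<xi> + h) - fourier f \<xi> -
      (LINT x|lborel. - \<i> * of_real (h \<bullet> x) * (cis (- (\<xi> \<bullet> x)) * f x))"
      by (simp only: D)
    also have "\<dots> =
      (LINT x|lborel. cis (- ((\<xi> + h) \<bullet> x)) * f x - cis (- (\<xi> \<bullet> x)) * f x - (- \<i> * of_real (h \<bullet> x) * (cis (- (\<xi> \<bullet> x)) * f x)))"
      unfolding fourier_def using i intD[of h] by (simp del: mult_minus_left)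
    also have "norm \<dots> \<le> (LINT x|lborel. (norm h)\<^sup>2 * ((1 + norm x)\<^sup>2 * norm (f x)))"
    proof (rule Bochner_Integration.integral_norm_bound_integral)
      show "integrable lborel (\<lambda>x. (norm h)\<^sup>2 * ((1 + norm x)\<^sup>2 * norm (f x)))"
        by (intro integrable_mult_right schwartz_integrable_weighted f)
      show "integrable lborel (\<lambda>x. cis (- ((\<xi> + h) \<bullet> x)) * f x - cis (- (\<xi> \<bullet> x)) * f x - (- \<i> * of_real (h \<bullet> x) * (cis (- (\<xi> \<bullet> x)) * f x)))"
        by (intro Bochner_Integration.integrable_diff i intD)
      fix x
      have "cis (- ((\<xi> + h) \<bullet> x)) * f x - cis (- (\<xi> \<bullet> x)) * f x - (- \<i> * of_real (h \<bullet> x) * (cis (- (\<xi> \<bullet> x)) * f x)) =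
        (cis (- (\<xi> \<bullet> x) + - (h \<bullet> x)) - cis (- (\<xi> \<bullet> x)) - \<i> * of_real (- (h \<bullet> x)) * cis (- (\<xi> \<bullet> x))) * f x"
        by (simp add: inner_add_left algebra_simps)
      also have "norm \<dots> \<le> (h \<bullet> x)\<^sup>2 * norm (f x)"
        unfolding norm_mult using norm_cis_minus_linear_le[of "- (\<xi> \<bullet> x)" "- (h \<bullet> x)"]
        by (intro mult_right_mono) auto
      also have "\<dots> \<le> (norm h)\<^sup>2 * (1 + norm x)\<^sup>2 * norm (f x)"
      proof (intro mult_right_mono)
        have "\<bar>h \<bullet> x\<bar> \<le> norm h * (1 + norm x)"
          using Cauchy_Schwarz_ineq2[of h x] by (simp add: distrib_left add_increasing)
        then show "(h \<bullet> x)\<^sup>2 \<le> (norm h)\<^sup>2 * (1 + norm x)\<^sup>2"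
          by (metis power_mult_distrib power2_abs abs_ge_zero power_mono)
      qed auto
      finally show "norm (cis (- ((\<xi> + h) \<bullet> x)) * f x - cis (- (\<xi> \<bullet> x)) * f x - (- \<i> * of_real (h \<bullet> x) * (cis (- (\<xi> \<bullet> x)) * f x)))
         \<le> (norm h)\<^sup>2 * ((1 + norm x)\<^sup>2 * norm (f x))"
        by (simp add: mult.assoc)
    qed
    also have "\<dots> = K * (norm h)\<^sup>2" by (simp add: K_def mult.commute)
    finally show ?thesis .
  qed
  have "bounded_linear ?D"
    by (intro bounded_linear_sum bounded_linear_mult_const
        bounded_linear_compose[OF bounded_linear_of_real] bounded_linear_vec_nth)
  moreover have "((\<lambda>h. norm (fourier f (\<xi> + h) - fourier f \<xi> - ?D h) / norm h) \<longlongrightarrow> 0) (at 0)"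
  proof (rule Lim_null_comparison)
    show "\<forall>\<^sub>F h in at 0. norm (norm (fourier f (\<xi> + h) - fourier f \<xi> - ?D h) / norm h) \<le> K * norm h"
      using est unfolding eventually_at
      by (intro exI[of _ 1]) (auto simp: pos_divide_le_eq power2_eq_square mult.assoc)
    show "((\<lambda>h. K * norm h) \<longlongrightarrow> 0) (at 0)"
      by (auto intro!: tendsto_eq_intros)
  qed
  ultimately show ?thesis by (simp add: has_derivative_at)
qed

text \<open>A derivative of the transform of f is the transform of -i x_i f, again a Schwartz
  function. Thus the image of the Schwartz space is itself a class to which
  \<open>schwartz_coinduct\<close> applies.\<close>

lemma schwartz_fourier:
  fixes f :: "real^'n::finite \<Rightarrow> complex"
  assumes "f \<in> schwartz"
  shows "fourier f \<in> schwartz"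
proof (rule schwartz_coinduct[where S = "fourier ` schwartz"])
  fix g :: "real^'n \<Rightarrow> complex" and x i N assume "g \<in> fourier ` schwartz"
  then obtain f where g: "g = fourier f" and f: "f \<in> schwartz" by blast
  show "g differentiable (at x)"
    using has_derivative_fourier[OF f] by (auto simp: g differentiable_def)
  have "partial i g = fourier (\<lambda>x. - \<i> * (of_real (x $ i) * f x))"
    using partial_eq[OF has_derivative_fourier[OF f]]
    by (auto simp: g axis_def if_distrib[of of_real] if_distrib[where f = "\<lambda>x. x * _"] cong: if_cong)
  then show "partial i g \<in> fourier ` schwartz"
    by (simp only:) (intro imageI schwartz_cmult schwartz_coordinate_mult f)
  show "\<exists>C. \<forall>x. (1 + norm x) ^ N * norm (g x) \<le> C"
    using fourier_decay[OF f] by (simp add: g)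
qed (use assms in blast)

lemma schwartz_inv_fourier:
  fixes f :: "real^'n::finite \<Rightarrow> complex"
  assumes "f \<in> schwartz"
  shows "inv_fourier f \<in> schwartz"
proof -
  have "(\<lambda>x. 1 / of_real ((2 * pi) ^ CARD('n)) * fourier f ((-1) *\<^sub>R x + 0)) \<in> schwartz"
    by (intro schwartz_cmult schwartz_affine schwartz_fourier assms) auto
  then show ?thesis
    by (subst inv_fourier_eq_fourier[abs_def]) simp
qed

text \<open>Gaussian summation: \<open>fourier_multiplication\<close> for f and a modulated, dilated
  Gaussian equates an inversion integral damped by gauss(t y) with a Gaussian average of f at
  distance of order t from x. Both sides converge as t tends to 0.\<close>

lemma fourier_inv_fourier:
  fixes f :: "real^'n::finite \<Rightarrow> complex"
  assumes f: "f \<in> schwartz"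
  shows "fourier (inv_fourier f) x = f x"
proof -
  let ?n = "CARD('n)"
  \<comment> \<open>The constant (2 pi)^(n/2) occurs twice, as the eigenvalue in
    \<open>fourier_gauss\<close> and as the total mass of the Gaussian; the product is the (2 pi)^n
    of the inversion formula.\<close>
  define c where "c = complex_of_real (sqrt (2 * pi) ^ ?n)"
  define t where "t k = inverse (real (Suc k))" for k
  have t: "0 < t k" for k by (auto simp: t_def)
  have t0: "t \<longlonglongrightarrow> 0" unfolding t_def by (rule LIMSEQ_inverse_real_of_nat)
  have cont [continuous_intros]: "continuous_on S (gauss :: real^'n \<Rightarrow> complex)" for S
    unfolding gauss_def by (intro continuous_intros) auto
  have cont_at: "isCont gauss (y :: real^'n)" for y
    using cont[of UNIV] by (simp add: continuous_on_eq_continuous_at)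
  have meas [measurable]: "f \<in> borel_measurable borel" "fourier f \<in> borel_measurable borel"
     "(gauss :: real^'n \<Rightarrow> complex) \<in> borel_measurable borel"
    using f cont by (auto intro: schwartz_measurable schwartz_fourier borel_measurable_continuous_onI)
  have int_f: "integrable lborel f" and int_F: "integrable lborel (fourier f)"
    using f by (auto intro: schwartz_integrable schwartz_fourier)
  have gauss_le: "norm (gauss y) \<le> 1" for y :: "real^'n"
    by (simp add: gauss_def)
  have int_G: "integrable lborel (\<lambda>y. gauss (t k *\<^sub>R y - 0) :: complex)" for k
    using integrable_lborel_affine[OF integrable_gauss, of "t k" 0] t[of k] by simp
  have eq: "(LINT y|lborel. fourier f y * (cis (x \<bullet> y) * gauss (t k *\<^sub>R y - 0))) =
      c * (LINT z|lborel. f (x + t k *\<^sub>R z) * gauss z)" for k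
  proof -
    have int: "integrable lborel (\<lambda>y. f y * gauss ((y - x) /\<^sub>R t k))"
      by (rule Bochner_Integration.integrable_bound[OF int_f])
        (auto simp: norm_mult intro!: mult_left_le gauss_le)
    have "(LINT y|lborel. fourier f y * (cis (x \<bullet> y) * gauss (t k *\<^sub>R y - 0))) =
        (LINT y|lborel. f y * fourier (\<lambda>y. cis (x \<bullet> y) * gauss (t k *\<^sub>R y - 0)) y)"
      by (rule fourier_multiplication[OF int_f cis_mult_integrable(1)[OF int_G]])
    also have "\<dots> = (LINT y|lborel. c / of_real (t k ^ ?n) * (f y * gauss ((y - x) /\<^sub>R t k)))"
      by (subst fourier_affine[OF integrable_gauss t]) (simp add: fourier_gauss c_def mult_ac)
    also have "\<dots> = c * ((LINT y|lborel. f y * gauss ((y - x) /\<^sub>R t k)) /\<^sub>R \<bar>t k\<bar> ^ DIM(real^'n))"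
      using t[of k] by (simp add: scaleR_conv_of_real[where 'a=complex] divide_inverse)
    also have "(LINT y|lborel. f y * gauss ((y - x) /\<^sub>R t k)) /\<^sub>R \<bar>t k\<bar> ^ DIM(real^'n) =
        (LINT z|lborel. f (x + t k *\<^sub>R z) * gauss z)"
      using integral_lborel_affine[OF int, of "t k" x] t[of k] by simp
    finally show ?thesis .
  qed
  have 1: "(\<lambda>k. LINT y|lborel. fourier f y * (cis (x \<bullet> y) * gauss (t k *\<^sub>R y - 0))) \<longlonglongrightarrow>
      (LINT y|lborel. fourier f y * (cis (x \<bullet> y) * gauss (0::real^'n)))"
  proof (rule integral_dominated_convergence[where w = "\<lambda>y. norm (fourier f y)"])
    have "(\<lambda>k. gauss (t k *\<^sub>R y - 0)) \<longlonglongrightarrow> gauss (0 :: real^'n)" for y :: "real^'n"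
      by (rule isCont_tendsto_compose[where g = gauss, OF cont_at]) (auto intro!: tendsto_eq_intros t0)
    then show "AE y in lborel. (\<lambda>k. fourier f y * (cis (x \<bullet> y) * gauss (t k *\<^sub>R y - 0)))
       \<longlonglongrightarrow> fourier f y * (cis (x \<bullet> y) * gauss (0::real^'n))"
      by (intro AE_I2 tendsto_intros) auto
  qed (use int_F gauss_le in \<open>auto simp: norm_mult intro!: mult_left_le\<close>)
  obtain C where C: "\<And>y. norm (f y) \<le> C"
    using schwartz_decay[OF f, of 0] by auto
  have "(\<lambda>k. LINT z|lborel. f (x + t k *\<^sub>R z) * gauss z) \<longlonglongrightarrow> (LINT z|lborel. f x * gauss (z :: real^'n))"
  proof (rule integral_dominated_convergence[where w = "\<lambda>z::real^'n. C * norm (gauss z)"])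
    show "integrable lborel (\<lambda>z::real^'n. C * norm (gauss z))"
      by (intro integrable_mult_right integrable_norm integrable_gauss)
    show "AE z in lborel. norm (f (x + t k *\<^sub>R z) * gauss z) \<le> C * norm (gauss z)" for k
      using C by (auto simp: norm_mult intro!: mult_right_mono)
    have "(\<lambda>k. f (x + t k *\<^sub>R z)) \<longlonglongrightarrow> f x" for z
      by (rule isCont_tendsto_compose[where g = f])
        (use schwartz_continuous[OF f] in \<open>auto simp: continuous_on_eq_continuous_at intro!: tendsto_eq_intros t0\<close>)
    then show "AE z in lborel. (\<lambda>k. f (x + t k *\<^sub>R z) * gauss z) \<longlonglongrightarrow> f x * gauss z"
      by (intro AE_I2 tendsto_intros) auto
  qed measurable
  then have 2: "(\<lambda>k. c * (LINT z|lborel. f (x + t k *\<^sub>R z) * gauss z)) \<longlonglongrightarrow>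
      c * (LINT z|lborel. f x * gauss (z :: real^'n))"
    by (rule tendsto_mult_left)
  have cc: "c * c = of_real ((2 * pi) ^ ?n)"
  proof -
    have "sqrt (2 * pi) ^ ?n * sqrt (2 * pi) ^ ?n = (2 * pi) ^ ?n"
      unfolding power_mult_distrib[symmetric] by simp
    then show ?thesis
      unfolding c_def of_real_mult[symmetric] by (simp only:)
  qed
  have "(LINT y|lborel. cis (x \<bullet> y) * fourier f y) =
      (LINT y|lborel. fourier f y * (cis (x \<bullet> y) * gauss (0::real^'n)))"
    by (intro Bochner_Integration.integral_cong refl) (simp add: gauss_def)
  also have "\<dots> = c * (LINT z|lborel. f x * gauss (z :: real^'n))"
    by (rule LIMSEQ_unique[OF 1 2[folded eq]])
  also have "(LINT z|lborel. f x * gauss (z :: real^'n)) = f x * c"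
    by (simp add: integral_gauss c_def)
  also have "c * (f x * c) = of_real ((2 * pi) ^ ?n) * f x"
    unfolding cc[symmetric] by (simp only: mult_ac)
  finally have *: "(LINT y|lborel. cis (x \<bullet> y) * fourier f y) = of_real ((2 * pi) ^ ?n) * f x" .
  \<comment> \<open>So far the inverse transform of \<open>fourier f\<close> has been identified
    with f. The reflection y -> -y interchanges the two transforms.\<close>
  have "fourier (inv_fourier f) x =
      (LINT y|lborel. cis (- (x \<bullet> y)) * fourier f (- y) / of_real ((2 * pi) ^ ?n))"
    by (subst fourier_def) (simp only: inv_fourier_eq_fourier times_divide_eq_right)
  also have "\<dots> = (LINT y|lborel. cis (x \<bullet> (- y)) * fourier f (- y)) / of_real ((2 * pi) ^ ?n)"
    by (simp only: integral_divide_zero inner_minus_right)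
  also have "(LINT y|lborel. cis (x \<bullet> (- y)) * fourier f (- y)) = (LINT y|lborel. cis (x \<bullet> y) * fourier f y)"
    using integral_lborel_affine[OF cis_mult_integrable(1)[OF int_F], of "-1" x 0] by simp
  finally show ?thesis by (simp only: *) simp
qed

section \<open>Distributions given by Schwartz functions\<close>

text \<open>The value 0 outside the Schwartz space follows the convention of
  \<open>tempered\<close>, which makes equality of these distributions equality in HOL.\<close>

definition dist_of :: "(real^'n::finite \<Rightarrow> complex) \<Rightarrow> 'n functional" where
  "dist_of f = (\<lambda>h. if h \<in> schwartz then LINT x|lborel. f x * h x else 0)"

lemma norm_le_schwartz_seminorm:
  fixes h :: "real^'n::finite \<Rightarrow> complex"
  assumes h: "h \<in> schwartz"
  shows "norm (h x) \<le> schwartz_seminorm 0 h"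
proof -
  have "(\<lambda>(\<alpha>, x). (1 + norm x) ^ 0 * norm (partials \<alpha> h x)) ([], x) \<le> schwartz_seminorm 0 h"
    unfolding schwartz_seminorm_def
  proof (rule cSUP_upper)
    \<comment> \<open>The only multi-index of order 0 is the empty list, so the supremum runs over
      the values of |h| alone; \<open>cSUP_upper\<close> requires it to be bounded.\<close>
    have "{\<alpha>::'n list. length \<alpha> \<le> 0} \<times> (UNIV :: (real^'n) set) = Pair [] ` UNIV" by auto
    then have "(\<lambda>(\<alpha>, x). (1 + norm x) ^ 0 * norm (partials \<alpha> h x)) ` ({\<alpha>. length \<alpha> \<le> 0} \<times> UNIV) =
        range (\<lambda>x. (1 + norm x) ^ 0 * norm (partials [] h x))"
      by (simp only: image_image prod.case)
    then show "bdd_above ((\<lambda>(\<alpha>, x). (1 + norm x) ^ 0 * norm (partials \<alpha> h x)) ` ({\<alpha>. length \<alpha> \<le> 0} \<times> UNIV))"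
      using schwartz_bdd_above[OF h, of 0 "[]"] by (simp only:)
  qed auto
  then show ?thesis by simp
qed

lemma integrable_mult_schwartz:
  assumes f: "integrable lborel f" and h: "h \<in> schwartz"
  shows "integrable lborel (\<lambda>x. f x * h x)"
proof -
  obtain C where C: "\<And>x. norm (h x) \<le> C"
    using schwartz_decay[OF h, of 0] by auto
  have [measurable]: "f \<in> borel_measurable borel" "h \<in> borel_measurable borel"
    using f h borel_measurable_integrable schwartz_measurable by fastforce+
  have "integrable lborel (\<lambda>x. C * norm (f x))"
    using f by auto
  then show ?thesis
    by (rule Bochner_Integration.integrable_bound)
      (use mult_right_mono[OF C norm_ge_zero] in
        \<open>auto simp: norm_mult mult.commute[of "norm (f _)"] intro!: AE_I2 order_trans[OF _ abs_ge_self]\<close>)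
qed

lemma dist_of_tempered:
  fixes f :: "real^'n::finite \<Rightarrow> complex"
  assumes f: "f \<in> schwartz"
  shows "dist_of f \<in> tempered"
proof -
  note int = integrable_mult_schwartz[OF schwartz_integrable[OF f]]
  \<comment> \<open>The summand 1 keeps \<open>K\<close> positive for f = 0, so that e / K is a
    legitimate radius.\<close>
  define K where "K = 1 + (LINT x|lborel. norm (f x))"
  have K: "0 < K" unfolding K_def by (simp add: add_pos_nonneg)
  have "norm (dist_of f g - dist_of f h) \<le> K * schwartz_seminorm 0 (\<lambda>x. g x - h x)"
    if gh: "g \<in> schwartz" "h \<in> schwartz" for g h
  proof -
    let ?c = "schwartz_seminorm 0 (\<lambda>x. g x - h x)"
    have d: "(\<lambda>x. g x - h x) \<in> schwartz" by (intro schwartz_diff gh)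
    have c: "norm (g x - h x) \<le> ?c" for x
      using norm_le_schwartz_seminorm[OF d] by simp
    have "dist_of f g - dist_of f h = (LINT x|lborel. f x * (g x - h x))"
      using gh int by (simp add: dist_of_def right_diff_distrib)
    also have "norm \<dots> \<le> (LINT x|lborel. ?c * norm (f x))"
    proof (rule Bochner_Integration.integral_norm_bound_integral)
      show "norm (f x * (g x - h x)) \<le> ?c * norm (f x)" for x
        using mult_right_mono[OF c norm_ge_zero, of x "f x"] by (simp add: norm_mult mult.commute)
    qed (use int[OF d] schwartz_integrable[OF f] in auto)
    also have "\<dots> \<le> K * ?c"
      using order_trans[OF norm_ge_zero c] by (simp add: K_def algebra_simps)
    finally show ?thesis .
  qed
  note lip = this
  have "\<exists>N. \<exists>\<delta>>0. \<forall>g\<in>schwartz. schwartz_seminorm N (\<lambda>x. g x - h x) < \<delta> \<longrightarrow> norm (dist_of f g - dist_of f h) < e"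
    if h: "h \<in> schwartz" and e: "0 < e" for h e
  proof (intro exI conjI ballI impI)
    show "0 < e / K" using K e by simp
    fix g assume g: "g \<in> schwartz" and "schwartz_seminorm 0 (\<lambda>x. g x - h x) < e / K"
    then show "norm (dist_of f g - dist_of f h) < e"
      using lip[OF g h] K by (simp add: pos_less_divide_eq mult.commute)
  qed
  moreover have "dist_of f (\<lambda>x. g x + h x) = dist_of f g + dist_of f h"
    if "g \<in> schwartz" "h \<in> schwartz" for g h
    using that int schwartz_add[OF that] by (simp add: dist_of_def distrib_left)
  moreover have "dist_of f (\<lambda>x. c * g x) = c * dist_of f g" if "g \<in> schwartz" for c g
    using that schwartz_cmult[OF that, of c] by (simp add: dist_of_def mult.left_commute)
  ultimately show ?thesis
    unfolding tempered_def by (auto simp: dist_of_def)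
qed

lemma dist_diff_dist_of:
  assumes "f \<in> schwartz"
  shows "dist_diff (dist_of f) (dist_of (\<lambda>x. 0)) = dist_of f"
  by (auto simp: dist_diff_def dist_of_def)

lemma represents_dist_of:
  assumes "f \<in> schwartz"
  shows "represents f (dist_of f)"
  using integrable_mult_schwartz[OF schwartz_integrable[OF assms]] schwartz_measurable[OF assms]
  by (auto simp: represents_def dist_of_def)

lemma dist_Lnorm_dist_of_le:
  fixes f :: "real^'n::finite \<Rightarrow> complex"
  assumes "f \<in> schwartz"
  shows "dist_Lnorm p (dist_of f) \<le> Lnorm p lborel (\<lambda>x. ennreal (norm (f x)))"
  unfolding dist_Lnorm_def using represents_dist_of[OF assms] by (intro INF_lower) simp

lemma dist_Lnorm_dist_of_zero:
  assumes "1 \<le> p"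
  shows "dist_Lnorm p (dist_of (\<lambda>x::real^'n::finite. 0)) = 0"
  using dist_Lnorm_dist_of_le[OF schwartz_zero, of p, where 'n = 'n] Lnorm_zero[OF assms, of "lborel :: (real^'n) measure"]
  by simp

lemma nn_integral_norm_schwartz:
  assumes "h \<in> schwartz"
  shows "(\<integral>\<^sup>+x. ennreal (norm (h x)) \<partial>lborel) = ennreal (LINT x|lborel. norm (h x))"
  by (intro nn_integral_eq_integral integrable_norm schwartz_integrable assms) auto

text \<open>All functions representing U have the same integral against h, namely U h. The bound
  from \<open>pairing_le_Lnorm\<close> is therefore common to all of them and passes to the
  infimum.\<close>

lemma dist_Lnorm_ge:
  assumes p: "1 \<le> p" "p < \<infinity>" and h: "h \<in> schwartz"
    and A: "\<And>x. norm (h x) \<le> A" "0 < A" and B: "(LINT x|lborel. norm (h x)) \<le> B" "0 < B"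
  shows "ennreal (norm (U h) / (2 * A powr recip p * B powr (1 - recip p))) \<le> dist_Lnorm p U"
  unfolding dist_Lnorm_def
proof (rule INF_greatest)
  fix g assume "g \<in> {g. represents g U}"
  then have g: "g \<in> borel_measurable lborel" "U h = (LINT x|lborel. g x * h x)"
    using h by (auto simp: represents_def)
  have "(\<integral>\<^sup>+x. ennreal (norm (h x)) \<partial>lborel) \<le> ennreal B"
    using B by (simp add: nn_integral_norm_schwartz[OF h] ennreal_leI)
  then show "ennreal (norm (U h) / (2 * A powr recip p * B powr (1 - recip p)))
      \<le> Lnorm p lborel (\<lambda>x. ennreal (norm (g x)))"
    unfolding g(2) using schwartz_measurable[OF h] by (intro pairing_le_Lnorm p g A B(2)) auto
qed

lemma inv_fourier_multiplication:
  fixes f g :: "real^'n::finite \<Rightarrow> complex"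
  assumes f: "f \<in> schwartz" and g: "g \<in> schwartz"
  shows "(LINT x|lborel. inv_fourier f x * g x) = (LINT x|lborel. f x * inv_fourier g x)"
proof -
  have f': "(\<lambda>x. f (- x)) \<in> schwartz"
    using schwartz_affine[OF f, of "-1" 0] by simp
  have refl: "fourier f (- x) = fourier (\<lambda>x. f (- x)) x" for x
    using fourier_def[of f "- x"]
      integral_lborel_affine[OF cis_mult_integrable(2)[OF schwartz_integrable[OF f], of "- x"], of "-1" 0]
    by (simp add: fourier_def)
  have int: "integrable lborel (\<lambda>x. f x * fourier g (- x))"
    using integrable_mult_schwartz[OF schwartz_integrable[OF f]] schwartz_affine[OF schwartz_fourier[OF g], of "-1" 0]
    by simp
  have "(LINT x|lborel. fourier f (- x) * g x) = (LINT x|lborel. f (- x) * fourier g x)"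
    unfolding refl by (intro fourier_multiplication schwartz_integrable f' g)
  also have "\<dots> = (LINT x|lborel. f x * fourier g (- x))"
    using integral_lborel_affine[OF int, of "-1" 0] by simp
  finally show ?thesis
    by (simp add: inv_fourier_eq_fourier)
qed

text \<open>The multiplication formulas move each operation from the test function back to f. A
  frequency piece of a Schwartz function is thus again given by a Schwartz function.\<close>

lemma frequency_localization:
  fixes f :: "real^'n::finite \<Rightarrow> complex"
  assumes f: "f \<in> schwartz" and m: "m \<in> schwartz"
  shows "dist_inv_fourier (dist_mult m (dist_fourier (dist_of f))) = dist_of (inv_fourier (\<lambda>\<xi>. m \<xi> * fourier f \<xi>))"
proof
  fix h :: "real^'n \<Rightarrow> complex"
  show "dist_inv_fourier (dist_mult m (dist_fourier (dist_of f))) h = dist_of (inv_fourier (\<lambda>\<xi>. m \<xi> * fourier f \<xi>)) h"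
  proof (cases "h \<in> schwartz")
    case h: True
    have mh: "(\<lambda>x. m x * inv_fourier h x) \<in> schwartz"
      by (intro schwartz_mult m schwartz_inv_fourier h)
    have "dist_inv_fourier (dist_mult m (dist_fourier (dist_of f))) h =
        (LINT x|lborel. f x * fourier (\<lambda>x. m x * inv_fourier h x) x)"
      using h mh schwartz_inv_fourier[OF h] schwartz_fourier[OF mh]
      by (simp add: dist_inv_fourier_def dist_mult_def dist_fourier_def dist_of_def)
    also have "\<dots> = (LINT x|lborel. fourier f x * (m x * inv_fourier h x))"
      by (intro fourier_multiplication[symmetric] schwartz_integrable f mh)
    also have "\<dots> = (LINT x|lborel. inv_fourier (\<lambda>\<xi>. m \<xi> * fourier f \<xi>) x * h x)"
      by (subst inv_fourier_multiplication[OF schwartz_mult[OF m schwartz_fourier[OF f]] h])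
        (simp add: mult_ac)
    finally show ?thesis using h by (simp add: dist_of_def)
  qed (simp add: dist_inv_fourier_def dist_of_def)
qed

text \<open>The convolution theorem, obtained from the multiplication formula for f and the
  modulated multiplier.\<close>

lemma inv_fourier_mult_fourier:
  fixes f m :: "real^'n::finite \<Rightarrow> complex"
  assumes f: "f \<in> schwartz" and m: "m \<in> schwartz"
  shows "inv_fourier (\<lambda>\<xi>. m \<xi> * fourier f \<xi>) x = (LINT y|lborel. f y * inv_fourier m (x - y))"
proof -
  have "inv_fourier (\<lambda>\<xi>. m \<xi> * fourier f \<xi>) x =
      (LINT \<xi>|lborel. fourier f \<xi> * (cis (x \<bullet> \<xi>) * m (1 *\<^sub>R \<xi> - 0))) / of_real ((2 * pi) ^ CARD('n))"
    by (simp add: inv_fourier_def mult_ac)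
  also have "(LINT \<xi>|lborel. fourier f \<xi> * (cis (x \<bullet> \<xi>) * m (1 *\<^sub>R \<xi> - 0))) =
      (LINT y|lborel. f y * fourier (\<lambda>\<xi>. cis (x \<bullet> \<xi>) * m (1 *\<^sub>R \<xi> - 0)) y)"
    using schwartz_cis_mult[OF m, of x] by (intro fourier_multiplication schwartz_integrable f) simp
  also have "\<dots> = (LINT y|lborel. f y * fourier m (y - x))"
    by (subst fourier_affine) (auto intro: schwartz_integrable m)
  finally show ?thesis
    by (simp add: inv_fourier_eq_fourier)
qed

text \<open>The two endpoint cases of Young's inequality: convolution with the kernel
  \<open>inv_fourier m\<close> multiplies a supremum bound and an integral bound by the integral of
  the modulus of the kernel.\<close>

lemma frequency_localization_bounds:
  fixes f m :: "real^'n::finite \<Rightarrow> complex"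
  assumes f: "f \<in> schwartz" and m: "m \<in> schwartz"
    and A: "\<And>x. norm (f x) \<le> A" and B: "(LINT x|lborel. norm (f x)) \<le> B"
  defines "u \<equiv> inv_fourier (\<lambda>\<xi>. m \<xi> * fourier f \<xi>)"
    and "k \<equiv> LINT x|lborel. norm (inv_fourier m x)"
  shows "norm (u x) \<le> A * k" and "(\<integral>\<^sup>+x. ennreal (norm (u x)) \<partial>lborel) \<le> ennreal (B * k)"
proof -
  let ?K = "inv_fourier m"
  have K: "?K \<in> schwartz" by (rule schwartz_inv_fourier[OF m])
  have Kx: "(\<lambda>y. ?K (x - y)) \<in> schwartz" for x
    using schwartz_affine[OF K, of "-1" x] by simp
  have kx: "(LINT y|lborel. norm (?K (x - y))) = k" for x
    using integral_lborel_affine[OF integrable_norm[OF schwartz_integrable[OF K]], of "-1" x]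
    by (simp add: k_def)
  have ky: "(\<integral>\<^sup>+x. ennreal (norm (?K (x - y))) \<partial>lborel) = ennreal k" for y
  proof -
    have "(\<lambda>x. ?K (x - y)) \<in> schwartz"
      using schwartz_affine[OF K, of 1 "- y"] by simp
    then have "(\<integral>\<^sup>+x. ennreal (norm (?K (x - y))) \<partial>lborel) = ennreal (LINT x|lborel. norm (?K (x - y)))"
      by (rule nn_integral_norm_schwartz)
    also have "(LINT x|lborel. norm (?K (x - y))) = k"
      using integral_lborel_affine[OF integrable_norm[OF schwartz_integrable[OF K]], of "1" "- y"]
      by (simp add: k_def)
    finally show ?thesis .
  qed
  have u: "u x = (LINT y|lborel. f y * ?K (x - y))" for x
    unfolding u_def by (rule inv_fourier_mult_fourier[OF f m])
  have int: "integrable lborel (\<lambda>y. f y * ?K (x - y))" for x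
    by (intro integrable_mult_schwartz schwartz_integrable f Kx)
  have "norm (u x) \<le> (LINT y|lborel. A * norm (?K (x - y)))"
    unfolding u
  proof (rule Bochner_Integration.integral_norm_bound_integral[OF int])
    show "integrable lborel (\<lambda>y. A * norm (?K (x - y)))"
      by (intro integrable_mult_right integrable_norm schwartz_integrable Kx)
    show "norm (f y * ?K (x - y)) \<le> A * norm (?K (x - y))" for y
      unfolding norm_mult by (intro mult_right_mono A) auto
  qed
  then show "norm (u x) \<le> A * k" by (simp add: kx)
  have [measurable]: "f \<in> borel_measurable borel" "?K \<in> borel_measurable borel"
    using f K by (auto intro: schwartz_measurable)
  have k: "0 \<le> k" by (simp add: k_def)
  have "(\<integral>\<^sup>+x. ennreal (norm (u x)) \<partial>lborel) \<le> (\<integral>\<^sup>+x. \<integral>\<^sup>+y. ennreal (norm (f y)) * ennreal (norm (?K (x - y))) \<partial>lborel \<partial>lborel)"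
  proof (rule nn_integral_mono)
    fix x
    have "ennreal (norm (u x)) \<le> (\<integral>\<^sup>+y. ennreal (norm (f y * ?K (x - y))) \<partial>lborel)"
      unfolding u by (rule integral_norm_bound_ennreal[OF int])
    then show "ennreal (norm (u x)) \<le> (\<integral>\<^sup>+y. ennreal (norm (f y)) * ennreal (norm (?K (x - y))) \<partial>lborel)"
      by (simp add: norm_mult ennreal_mult)
  qed
  also have "\<dots> = (\<integral>\<^sup>+y. \<integral>\<^sup>+x. ennreal (norm (f y)) * ennreal (norm (?K (x - y))) \<partial>lborel \<partial>lborel)"
    by (rule lborel_pair.Fubini') measurable
  also have "\<dots> = (\<integral>\<^sup>+y. ennreal (norm (f y)) * ennreal k \<partial>lborel)"
    by (subst nn_integral_cmult) (auto simp: ky)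
  also have "\<dots> = ennreal (LINT x|lborel. norm (f x)) * ennreal k"
    by (simp add: nn_integral_multc nn_integral_norm_schwartz[OF f])
  also have "\<dots> \<le> ennreal (B * k)"
    using B k by (subst ennreal_mult''[symmetric]) (auto intro!: ennreal_leI mult_right_mono)
  finally show "(\<integral>\<^sup>+x. ennreal (norm (u x)) \<partial>lborel) \<le> ennreal (B * k)" .
qed

lemma dist_Lnorm_frequency_localization_le:
  fixes f m :: "real^'n::finite \<Rightarrow> complex"
  assumes p: "1 \<le> p" and f: "f \<in> schwartz" and m: "m \<in> schwartz"
    and A: "\<And>x. norm (f x) \<le> A" "0 \<le> A" and B: "(LINT x|lborel. norm (f x)) \<le> B" "0 \<le> B"
    and k: "(LINT x|lborel. norm (inv_fourier m x)) \<le> k"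
  shows "dist_Lnorm p (dist_inv_fourier (dist_mult m (dist_fourier (dist_of f))))
    \<le> ennreal (k * (A powr (1 - recip p) * B powr recip p))"
proof -
  let ?u = "inv_fourier (\<lambda>\<xi>. m \<xi> * fourier f \<xi>)"
  let ?k = "LINT x|lborel. norm (inv_fourier m x)"
  have u: "?u \<in> schwartz" by (intro schwartz_inv_fourier schwartz_mult m schwartz_fourier f)
  have k0: "0 \<le> ?k" by simp
  have "dist_Lnorm p (dist_of ?u) \<le> Lnorm p lborel (\<lambda>x. ennreal (norm (?u x)))"
    by (rule dist_Lnorm_dist_of_le[OF u])
  also have "\<dots> \<le> ennreal ((A * ?k) powr (1 - recip p) * (B * ?k) powr recip p)"
    using frequency_localization_bounds[OF f m A(1) B(1)] schwartz_measurable[OF u] A(2) B(2) k0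
    by (intro Lnorm_le_interpolation[where w = "\<lambda>x. ennreal (norm (?u x))"] p) (auto simp: ennreal_leI)
  also have "\<dots> \<le> ennreal (k * (A powr (1 - recip p) * B powr recip p))"
  proof (rule ennreal_leI)
    have "(A * ?k) powr (1 - recip p) * (B * ?k) powr recip p = 
      (?k powr (1 - recip p) * ?k powr recip p) * (A powr (1 - recip p) * B powr recip p)"
      using A B k0 by (simp add: powr_mult mult_ac)
    \<comment> \<open>The two endpoint factors recombine to exponent 1; a vanishing
      \<open>?k\<close> is separate because \<open>0 powr 0 = 0\<close>.\<close>
    also have "?k powr (1 - recip p) * ?k powr recip p = ?k"
      using k0 by (cases "?k = 0") (auto simp flip: powr_add)
    finally show "(A * ?k) powr (1 - recip p) * (B * ?k) powr recip p \<le> k * (A powr (1 - recip p) * B powr recip p)"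
      using k by (simp add: mult_right_mono)
  qed
  finally show ?thesis by (simp add: frequency_localization[OF f m])
qed

lemma stft_dist_of:
  fixes f \<phi> :: "real^'n::finite \<Rightarrow> complex"
  assumes f: "f \<in> schwartz" and \<phi>: "\<phi> \<in> schwartz"
  shows "stft \<phi> (dist_of f) x \<xi> = fourier (\<lambda>t. f t * cnj (\<phi> (t - x))) \<xi>"
proof -
  have "(\<lambda>t. cnj (time_freq_shift x \<xi> \<phi> t)) \<in> schwartz"
    unfolding time_freq_shift_def
    using schwartz_affine[OF \<phi>, of 1 "- x"] by (intro schwartz_cnj schwartz_cis_mult) simp
  then show ?thesis
    by (simp add: stft_def dist_of_def fourier_def time_freq_shift_def cis_cnj mult_ac)
qed

section \<open>Besov norms of frequency-localized functions\<close>

lemma schwartz_dyadic: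
  assumes "dyadic_partition \<eta> \<psi>"
  shows "dyadic \<eta> \<psi> i \<in> schwartz"
proof (cases "i = 0")
  case False
  have "(\<lambda>\<xi>. \<psi> (inverse (2 ^ i) *\<^sub>R \<xi> + 0)) \<in> schwartz"
    using assms by (intro schwartz_affine) (auto simp: dyadic_partition_def)
  then show ?thesis using False by (simp add: dyadic_def)
qed (use assms in \<open>simp add: dyadic_def dyadic_partition_def\<close>)

text \<open>Dilating the multiplier rescales the kernel so that its integral norm is preserved. This
  makes the dyadic kernels bounded uniformly in the index.\<close>

lemma integral_norm_inv_fourier_dilation:
  fixes m :: "real^'n::finite \<Rightarrow> complex"
  assumes m: "m \<in> schwartz" and c: "0 < c"
  shows "(LINT x|lborel. norm (inv_fourier (\<lambda>\<xi>. m (c *\<^sub>R \<xi>)) x)) = (LINT x|lborel. norm (inv_fourier m x))"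
proof -
  let ?G = "\<lambda>x. norm (inv_fourier m x)"
  have eq: "norm (inv_fourier (\<lambda>\<xi>. m (c *\<^sub>R \<xi>)) x) = ?G (0 + inverse c *\<^sub>R x) / c ^ CARD('n)" for x
    using fourier_affine[OF schwartz_integrable[OF m] c, of 0 0 "- x"] c
    by (simp add: inv_fourier_eq_fourier norm_divide norm_mult norm_power)
  have "integrable lborel ?G"
    by (intro integrable_norm schwartz_integrable schwartz_inv_fourier m)
  from integral_lborel_affine[OF this, of "inverse c" 0] show ?thesis
    unfolding eq using c by (simp add: power_inverse divide_inverse)
qed

lemma dyadic_kernel_bound:
  fixes \<eta> \<psi> :: "real^'n::finite \<Rightarrow> complex"
  assumes "dyadic_partition \<eta> \<psi>"
  obtains k where "0 < k" "\<And>i. (LINT x|lborel. norm (inv_fourier (dyadic \<eta> \<psi> i) x)) \<le> k"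
proof
  let ?I = "\<lambda>m. LINT x|lborel. norm (inv_fourier m x)"
  have nn: "0 \<le> ?I m" for m :: "real^'n \<Rightarrow> complex" by simp
  show "0 < 1 + ?I \<eta> + ?I \<psi>" using nn[of \<eta>] nn[of \<psi>] by linarith
  show "?I (dyadic \<eta> \<psi> i) \<le> 1 + ?I \<eta> + ?I \<psi>" for i
  proof (cases "i = 0")
    case False
    then have "dyadic \<eta> \<psi> i = (\<lambda>\<xi>. \<psi> (inverse (2 ^ i) *\<^sub>R \<xi>))"
      by (simp add: dyadic_def)
    moreover have "?I (\<lambda>\<xi>. \<psi> (inverse (2 ^ i) *\<^sub>R \<xi>)) = ?I \<psi>"
      using assms by (intro integral_norm_inv_fourier_dilation) (auto simp: dyadic_partition_def)
    ultimately show ?thesis using nn[of \<eta>] by simp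
  qed (use nn[of \<psi>] in \<open>simp add: dyadic_def\<close>)
qed

lemma dyadic_support:
  assumes dp: "dyadic_partition \<eta> \<psi>" and nz: "dyadic \<eta> \<psi> i \<xi> \<noteq> 0"
  shows "norm \<xi> \<le> 2 * 2 ^ i" "0 < i \<Longrightarrow> 2 ^ i \<le> 2 * norm \<xi>"
proof -
  have \<eta>: "norm \<xi> \<le> 2" if "\<eta> \<xi> \<noteq> 0" for \<xi>
    using dp that closure_subset[of "{\<xi>. \<eta> \<xi> \<noteq> 0}"] by (auto simp: dyadic_partition_def)
  have \<psi>: "1/2 \<le> norm \<xi> \<and> norm \<xi> \<le> 2" if "\<psi> \<xi> \<noteq> 0" for \<xi>
    using dp that closure_subset[of "{\<xi>. \<psi> \<xi> \<noteq> 0}"] by (auto simp: dyadic_partition_def)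
  show "norm \<xi> \<le> 2 * 2 ^ i" "0 < i \<Longrightarrow> 2 ^ i \<le> 2 * norm \<xi>"
    using nz \<eta>[of \<xi>] \<psi>[of "\<xi> /\<^sub>R 2 ^ i"]
    by (auto simp: dyadic_def field_simps split: if_splits)
qed

lemma continuous_zero_limit:
  fixes f :: "'a::real_normed_vector \<Rightarrow> complex"
  assumes "continuous_on UNIV f" and "r \<longlonglongrightarrow> a" and "\<And>n. f (r n *\<^sub>R x) = 0"
  shows "f (a *\<^sub>R x) = 0"
proof -
  have "(\<lambda>n. f (r n *\<^sub>R x)) \<longlonglongrightarrow> f (a *\<^sub>R x)"
    using assms(1,2) by (intro isCont_tendsto_compose[where g = f] tendsto_intros)
      (auto simp: continuous_on_eq_continuous_at)
  then show ?thesis using assms(3) by (simp add: LIMSEQ_const_iff)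
qed

text \<open>On the sphere of radius 2 all terms of the partition of unity except the first dilate of
  \<psi> vanish: the supports of the other terms reach at most their boundary.\<close>

lemma dyadic_partition_unit_sphere:
  fixes \<eta> \<psi> :: "real^'n::finite \<Rightarrow> complex"
  assumes dp: "dyadic_partition \<eta> \<psi>" and e: "norm e = 1"
  shows "\<psi> e = 1"
proof -
  have \<eta>: "norm \<xi> \<le> 2" if "\<eta> \<xi> \<noteq> 0" for \<xi>
    using dp that closure_subset[of "{\<xi>. \<eta> \<xi> \<noteq> 0}"] by (auto simp: dyadic_partition_def)
  have \<psi>: "1/2 \<le> norm \<xi> \<and> norm \<xi> \<le> 2" if "\<psi> \<xi> \<noteq> 0" for \<xi>
    using dp that closure_subset[of "{\<xi>. \<psi> \<xi> \<noteq> 0}"] by (auto simp: dyadic_partition_def)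
  have t: "(\<lambda>n. inverse (real (Suc n))) \<longlonglongrightarrow> 0" by (rule LIMSEQ_inverse_real_of_nat)
  have pos: "0 < inverse (real (Suc n))" for n by simp
  \<comment> \<open>The point lies on the boundary of the region allowed for the support; it is
    approached along its ray from outside that region, where the value is 0. The same is done for
    \<psi> at e/2, from inside the small ball.\<close>
  have "\<eta> (2 *\<^sub>R e) = 0"
  proof (rule continuous_zero_limit)
    show "(\<lambda>n. 2 + inverse (real (Suc n))) \<longlonglongrightarrow> 2"
      using tendsto_add[OF tendsto_const t, of 2] by simp
    show "\<eta> ((2 + inverse (real (Suc n))) *\<^sub>R e) = 0" for n
      using \<eta>[of "(2 + inverse (real (Suc n))) *\<^sub>R e"] e pos[of n] by (auto simp del: of_nat_Suc)
  qed (use dp in \<open>auto simp: dyadic_partition_def intro: schwartz_continuous\<close>)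
  moreover have "\<psi> ((1/2) *\<^sub>R e) = 0"
  proof (rule continuous_zero_limit)
    show "(\<lambda>n. (1/2) * (1 - inverse (real (Suc n)))) \<longlonglongrightarrow> 1/2"
      using tendsto_mult[OF tendsto_const tendsto_diff[OF tendsto_const t], of "1/2" 1] by simp
    show "\<psi> (((1/2) * (1 - inverse (real (Suc n)))) *\<^sub>R e) = 0" for n
    proof -
      have "inverse (real (Suc n)) \<le> 1" by (simp add: inverse_le_1_iff)
      then have "norm (((1/2) * (1 - inverse (real (Suc n)))) *\<^sub>R e) < 1/2"
        using e pos[of n] by (simp del: of_nat_Suc)
      then show ?thesis using \<psi> by (meson not_le)
    qed
  qed (use dp in \<open>auto simp: dyadic_partition_def intro: schwartz_continuous\<close>)
  \<comment> \<open>The argument is e / 2^j. It has norm exactly 1/2 for j = 1, the boundary case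
    just settled, and norm below 1/2 for j \<ge> 2.\<close>
  moreover have "\<psi> ((2 *\<^sub>R e) /\<^sub>R 2 ^ Suc j) = 0" if "j \<ge> 1" for j
  proof (cases "j = 1")
    case True
    then show ?thesis using calculation(2) by simp
  next
    case False
    then have "(2::real) ^ 2 \<le> 2 ^ j" using that by (intro power_increasing) auto
    then have "norm ((2 *\<^sub>R e) /\<^sub>R 2 ^ Suc j) < 1 / 2"
      using e by (simp add: field_simps)
    then show ?thesis using \<psi> by (meson not_le)
  qed
  ultimately have z: "\<psi> ((2 *\<^sub>R e) /\<^sub>R 2 ^ Suc j) = 0" if "j \<notin> {0}" for j
    using that by (metis Suc_leI One_nat_def insertI1 neq0_conv)
  have "(\<lambda>j. \<psi> ((2 *\<^sub>R e) /\<^sub>R 2 ^ Suc j)) sums (\<Sum>j\<in>{0}. \<psi> ((2 *\<^sub>R e) /\<^sub>R 2 ^ Suc j))"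
    using z by (intro sums_finite) auto
  moreover have "(\<lambda>j. \<psi> ((2 *\<^sub>R e) /\<^sub>R 2 ^ Suc j)) sums (1 - \<eta> (2 *\<^sub>R e))"
    using dp unfolding dyadic_partition_def by blast
  ultimately have "(\<Sum>j\<in>{0}. \<psi> ((2 *\<^sub>R e) /\<^sub>R 2 ^ Suc j)) = 1 - \<eta> (2 *\<^sub>R e)"
    by (rule sums_unique2)
  then show ?thesis using \<open>\<eta> (2 *\<^sub>R e) = 0\<close> by simp
qed

text \<open>The function \<psi> is complex-valued, so the lower bound concerns its real part, which
  suffices for an integral against a nonnegative function. The cap 1/4 keeps all frequencies
  \<delta>-close to e at norms between 3/4 and 5/4.\<close>

lemma dyadic_partition_Re_ge:
  fixes \<eta> \<psi> :: "real^'n::finite \<Rightarrow> complex"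
  assumes dp: "dyadic_partition \<eta> \<psi>" and e: "norm e = 1"
  obtains \<delta> where "0 < \<delta>" "\<delta> \<le> 1/4" "\<And>\<xi>. dist \<xi> e < \<delta> \<Longrightarrow> 1/2 \<le> Re (\<psi> \<xi>)"
proof -
  have "continuous_on UNIV \<psi>"
    using dp by (auto simp: dyadic_partition_def intro: schwartz_continuous)
  then have "isCont \<psi> e" by (simp add: continuous_on_eq_continuous_at)
  then obtain d where d: "0 < d" "\<And>\<xi>. dist \<xi> e < d \<Longrightarrow> dist (\<psi> \<xi>) (\<psi> e) < 1/2"
    unfolding continuous_at_eps_delta by (metis half_gt_zero zero_less_one)
  show ?thesis
  proof (rule that[of "min d (1/4)"])
    fix \<xi> assume "dist \<xi> e < min d (1/4)"
    then have "norm (\<psi> \<xi> - 1) < 1/2"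
      using d(2)[of \<xi>] dyadic_partition_unit_sphere[OF dp e] by (simp add: dist_norm)
    then show "1/2 \<le> Re (\<psi> \<xi>)"
      using abs_Re_le_cmod[of "\<psi> \<xi> - 1"] by simp
  qed (use d in auto)
qed

text \<open>The band of f meets only the dyadic pieces whose index differs from j by at most 1. That
  accounts for the factor 3, and the change of the weight within these indices for
  \<open>2 powr \<bar>s\<bar>\<close>.\<close>

lemma besov_norm_le:
  fixes f :: "real^'n::finite \<Rightarrow> complex"
  assumes dp: "dyadic_partition \<eta> \<psi>" and p: "1 \<le> p" and q: "1 \<le> q" and f: "f \<in> schwartz"
    and k: "0 < k" "\<And>i. (LINT x|lborel. norm (inv_fourier (dyadic \<eta> \<psi> i) x)) \<le> k"
    and A: "\<And>x. norm (f x) \<le> A" "0 < A" and B: "(LINT x|lborel. norm (f x)) \<le> B" "0 < B"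
    and supp: "\<And>\<xi>. fourier f \<xi> \<noteq> 0 \<Longrightarrow> 2 ^ j < 2 * norm \<xi> \<and> norm \<xi> < 2 * 2 ^ j"
  shows "besov_norm \<eta> \<psi> p q s (dist_of f) \<le>
    ennreal (3 * k * 2 powr \<bar>s\<bar> * (2 powr (real j * s) * (A powr (1 - recip p) * B powr recip p)))"
proof -
  define X where "X = A powr (1 - recip p) * B powr recip p"
  define Y where "Y = 2 powr \<bar>s\<bar> * 2 powr (real j * s) * (k * X)"
  have X: "0 < X" using A B by (simp add: X_def)
  have Y: "0 < Y" using X k by (simp add: Y_def)
  define u where "u i = ennreal (2 powr (real i * s)) *
       dist_Lnorm p (dist_inv_fourier (dist_mult (dyadic \<eta> \<psi> i) (dist_fourier (dist_of f))))" for i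
  \<comment> \<open>Truncated subtraction turns this into {0..1} for j = 0, hence only
    \<open>card ?I \<le> 3\<close>.\<close>
  let ?I = "{j - 1..j + 1}"
  define w where "w i = ennreal Y * indicator ?I i" for i
  have uw: "u i \<le> w i" for i
  proof (cases "i \<in> ?I")
    case True
    then have ij: "\<bar>real i - real j\<bar> \<le> 1" by auto
    have "dist_Lnorm p (dist_inv_fourier (dist_mult (dyadic \<eta> \<psi> i) (dist_fourier (dist_of f)))) \<le> ennreal (k * X)"
      unfolding X_def using A B k
      by (intro dist_Lnorm_frequency_localization_le p f schwartz_dyadic[OF dp]) auto
    then have "u i \<le> ennreal (2 powr (real i * s)) * ennreal (k * X)"
      unfolding u_def by (rule mult_left_mono) simp
    also have "\<dots> = ennreal (2 powr (real i * s) * (k * X))"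
      using X k by (simp add: ennreal_mult)
    also have "\<dots> \<le> ennreal Y"
    proof (rule ennreal_leI)
      have "real i * s = real j * s + (real i - real j) * s" by (simp add: algebra_simps)
      also have "(real i - real j) * s \<le> \<bar>s\<bar>"
        using mult_right_mono[OF ij abs_ge_zero[of s]] abs_ge_self[of "(real i - real j) * s"]
        by (simp add: abs_mult)
      finally have "2 powr (real i * s) \<le> 2 powr (\<bar>s\<bar> + real j * s)"
        by (simp add: add.commute)
      then show "2 powr (real i * s) * (k * X) \<le> Y"
        unfolding Y_def powr_add using X k by (intro mult_right_mono) auto
    qed
    finally show ?thesis using True by (simp add: w_def)
  next
    case False
    have "dyadic \<eta> \<psi> i \<xi> * fourier f \<xi> = 0" for \<xi>
    proof (rule ccontr)
      assume "dyadic \<eta> \<psi> i \<xi> * fourier f \<xi> \<noteq> 0"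
      then have nz: "dyadic \<eta> \<psi> i \<xi> \<noteq> 0" "2 ^ j < 2 * norm \<xi>" "norm \<xi> < 2 * 2 ^ j"
        using supp[of \<xi>] by auto
      note ds = dyadic_support[OF dp nz(1)]
      show False
      proof (cases "i < j")
        case True
        then have "Suc (Suc i) \<le> j" using False by auto
        then have "(2::real) ^ Suc (Suc i) \<le> 2 ^ j" by (intro power_increasing) auto
        then show False using ds(1) nz by simp
      next
        case False
        then have "Suc (Suc j) \<le> i" using \<open>i \<notin> ?I\<close> by auto
        then have "(2::real) ^ Suc (Suc j) \<le> 2 ^ i" by (intro power_increasing) auto
        then show False using ds(2) \<open>Suc (Suc j) \<le> i\<close> nz by simp
      qed
    qed
    then have z: "(\<lambda>\<xi>. dyadic \<eta> \<psi> i \<xi> * fourier f \<xi>) = (\<lambda>\<xi>. 0)"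
      by (rule ext)
    have "inv_fourier (\<lambda>\<xi>. dyadic \<eta> \<psi> i \<xi> * fourier f \<xi>) = (\<lambda>x. 0)"
      unfolding z by (intro ext) (simp add: inv_fourier_def)
    then have "u i = 0"
      unfolding u_def frequency_localization[OF f schwartz_dyadic[OF dp]]
      by (simp add: dist_Lnorm_dist_of_zero[OF p])
    then show ?thesis by simp
  qed
  have "card ?I \<le> 3" by (cases j) auto
  have "(\<integral>\<^sup>+i. w i \<partial>count_space UNIV) = ennreal Y * ennreal (real (card ?I))"
    unfolding w_def
    by (simp add: nn_integral_cmult_indicator ennreal_of_nat_eq_real_of_nat del: card_atLeastAtMost)
  also have "\<dots> \<le> ennreal (Y * 3)"
    using Y \<open>card ?I \<le> 3\<close> by (subst ennreal_mult'[symmetric]) (auto intro!: ennreal_leI mult_left_mono)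
  \<comment> \<open>The sequence norm is estimated by the same interpolation, on counting measure,
    with supremum bound Y and sum bound 3 Y.\<close>
  finally have "Lnorm q (count_space UNIV) u \<le> ennreal (Y powr (1 - recip q) * (Y * 3) powr recip q)"
    using Y uw by (intro Lnorm_le_interpolation[where w = w] q) (auto simp: w_def indicator_def)
  also have "Y powr (1 - recip q) * (Y * 3) powr recip q = Y * 3 powr recip q"
    using Y by (simp add: powr_mult powr_diff)
  also have "\<dots> \<le> Y * 3 powr 1"
    using Y recip_bounds[OF q] by (intro mult_left_mono powr_mono) auto
  finally show ?thesis
    by (simp add: besov_norm_def u_def Y_def X_def mult_ac ennreal_leI)
qed

text \<open>Parseval's formula: the inverse transform of the conjugate of f is the conjugate of
  \<open>fourier f\<close> divided by (2 pi)^n, which turns the pairing into the integral in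
  hypothesis \<open>D\<close>. The conjugate has the same bounds A and B as f.\<close>

lemma besov_norm_ge:
  fixes f :: "real^'n::finite \<Rightarrow> complex"
  assumes dp: "dyadic_partition \<eta> \<psi>" and p: "1 \<le> p" "p < \<infinity>" and q: "1 \<le> q" and f: "f \<in> schwartz"
    and A: "\<And>x. norm (f x) \<le> A" "0 < A" and B: "(LINT x|lborel. norm (f x)) \<le> B" "0 < B"
    and D: "D \<le> norm (LINT \<xi>|lborel. dyadic \<eta> \<psi> j \<xi> * of_real ((norm (fourier f \<xi>))\<^sup>2))" "0 \<le> D"
  shows "ennreal (2 powr (real j * s) * (D / (2 * pi) ^ CARD('n) / (2 * A powr recip p * B powr (1 - recip p))))
    \<le> besov_norm \<eta> \<psi> p q s (dist_of f)"
proof -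
  let ?m = "dyadic \<eta> \<psi> j"
  let ?U = "dist_inv_fourier (dist_mult ?m (dist_fourier (dist_of f)))"
  let ?h = "\<lambda>x. cnj (f x)"
  have m: "?m \<in> schwartz" by (rule schwartz_dyadic[OF dp])
  have h: "?h \<in> schwartz" by (rule schwartz_cnj[OF f])
  have mf: "(\<lambda>\<xi>. ?m \<xi> * fourier f \<xi>) \<in> schwartz" by (intro schwartz_mult m schwartz_fourier f)
  have ih: "inv_fourier ?h \<xi> = cnj (fourier f \<xi>) / of_real ((2 * pi) ^ CARD('n))" for \<xi>
    by (simp add: inv_fourier_eq_fourier cnj_fourier)
  have "?U ?h = (LINT \<xi>|lborel. ?m \<xi> * fourier f \<xi> * inv_fourier ?h \<xi>)"
    unfolding frequency_localization[OF f m] using h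
    by (simp add: dist_of_def inv_fourier_multiplication[OF mf h])
  also have "\<dots> = (LINT \<xi>|lborel. ?m \<xi> * of_real ((norm (fourier f \<xi>))\<^sup>2) / of_real ((2 * pi) ^ CARD('n)))"
    unfolding ih complex_norm_square by (simp add: mult.assoc)
  finally have "norm (?U ?h) = norm (LINT \<xi>|lborel. ?m \<xi> * of_real ((norm (fourier f \<xi>))\<^sup>2)) / (2 * pi) ^ CARD('n)"
    by (simp only: integral_divide_zero norm_divide norm_of_real) simp
  then have U: "D / (2 * pi) ^ CARD('n) \<le> norm (?U ?h)"
    using D by (simp add: divide_right_mono)
  let ?c = "D / (2 * pi) ^ CARD('n) / (2 * A powr recip p * B powr (1 - recip p))"
  have "ennreal ?c \<le> ennreal (norm (?U ?h) / (2 * A powr recip p * B powr (1 - recip p)))"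
    by (intro ennreal_leI divide_right_mono U) simp
  also have "\<dots> \<le> dist_Lnorm p ?U"
    using A B by (intro dist_Lnorm_ge p h) auto
  finally have "ennreal (2 powr (real j * s)) * ennreal ?c \<le> ennreal (2 powr (real j * s)) * dist_Lnorm p ?U"
    by (rule mult_left_mono) simp
  then have "ennreal (2 powr (real j * s) * ?c) \<le> ennreal (2 powr (real j * s)) * dist_Lnorm p ?U"
    by (simp only: ennreal_mult' powr_ge_zero)
  \<comment> \<open>Only the j-th term of the sequence is kept; the set {j} has counting measure
    1.\<close>
  then have "ennreal (2 powr (real j * s) * ?c * 1 powr recip q) \<le> besov_norm \<eta> \<psi> p q s (dist_of f)"
    unfolding besov_norm_def using D(2) by (intro Lnorm_ge[where E = "{j}"] q) auto
  then show ?thesis by simp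
qed

section \<open>Short-time Fourier transforms of Schwartz functions\<close>

lemma schwartz_lipschitz:
  fixes f :: "real^'n::finite \<Rightarrow> complex"
  assumes f: "f \<in> schwartz"
  obtains L where "0 < L" "\<And>x y. norm (f x - f y) \<le> L * norm (x - y)"
proof -
  have "\<exists>C. \<forall>x. (1 + norm x) ^ 0 * norm (partial i f x) \<le> C" for i
    by (rule schwartz_decay_ex[OF schwartz_partial[OF f]])
  then obtain C where C: "\<And>i x. norm (partial i f x) \<le> C i"
    by (metis mult_1 power_0)
  define L where "L = 1 + (\<Sum>i\<in>UNIV. C i)"
  have "0 \<le> C i" for i using order_trans[OF norm_ge_zero C] .
  then have L: "0 < L" unfolding L_def by (simp add: add_pos_nonneg sum_nonneg)
  have D: "norm (frechet_derivative f (at x) h) \<le> L * norm h" for x h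
  proof -
    have lin: "linear (frechet_derivative f (at x))"
      by (rule linear_frechet_derivative[OF schwartz_differentiable[OF f]])
    have "h = (\<Sum>i\<in>UNIV. h $ i *\<^sub>R axis i 1)"
      using basis_expansion[of h] by (simp add: scalar_mult_eq_scaleR)
    then have "frechet_derivative f (at x) h = frechet_derivative f (at x) (\<Sum>i\<in>UNIV. h $ i *\<^sub>R axis i 1)"
      by (rule arg_cong)
    also have "\<dots> = (\<Sum>i\<in>UNIV. h $ i *\<^sub>R partial i f x)"
      by (simp only: linear_sum[OF lin] linear_scale[OF lin] partial_def)
    also have "norm \<dots> \<le> (\<Sum>i\<in>UNIV. norm h * C i)"
      by (rule sum_norm_le) (auto intro!: mult_mono C component_le_norm_cart)
    also have "\<dots> \<le> L * norm h"
      by (simp add: L_def distrib_right sum_distrib_right mult.commute[of "norm h"])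
    finally show ?thesis .
  qed
  show ?thesis
  proof (rule that[OF L])
    fix x y
    show "norm (f x - f y) \<le> L * norm (x - y)"
      by (rule differentiable_bound[where S = UNIV and f' = "\<lambda>x. frechet_derivative f (at x)"])
        (auto intro!: schwartz_has_derivative f onorm_le D)
  qed
qed

lemma windowed_schwartz:
  fixes f g :: "real^'n::finite \<Rightarrow> complex"
  assumes "f \<in> schwartz" "g \<in> schwartz" "\<mu> \<noteq> 0"
  shows "(\<lambda>u. f u * g (\<mu> *\<^sub>R u - x)) \<in> schwartz"
  using schwartz_affine[OF assms(2,3), of "- x"] by (intro schwartz_mult assms(1)) simp

text \<open>The point is uniformity in the dilation \<mu> \<le> 1. Decay in x comes from 1 + |x|
  \<le> (1 + |u|)(1 + |\<mu> u - x|), which uses \<mu> \<le> 1. Decay in \<xi> comes from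
  integration by parts, where a derivative falling on the window brings out a factor \<mu>, again at
  most 1. Both functions vary in the induction because the derivative may fall on either.\<close>

lemma windowed_fourier_decay:
  fixes f g :: "real^'n::finite \<Rightarrow> complex"
  assumes "f \<in> schwartz" "g \<in> schwartz"
  shows "\<exists>C. \<forall>\<mu> x \<xi>. 0 < \<mu> \<and> \<mu> \<le> 1 \<longrightarrow>
    (1 + norm \<xi>) ^ L * ((1 + norm x) ^ M * norm (fourier (\<lambda>u. f u * g (\<mu> *\<^sub>R u - x)) \<xi>)) \<le> C"
  using assms
proof (induction L arbitrary: f g)
  case 0
  obtain Cg where Cg: "\<And>x. (1 + norm x) ^ M * norm (g x) \<le> Cg" "0 < Cg"
    using schwartz_decay[OF 0(2)] by metis
  define K where "K = (LINT u|lborel. (1 + norm u) ^ M * norm (f u))"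
  have "(1 + norm x) ^ M * norm (fourier (\<lambda>u. f u * g (\<mu> *\<^sub>R u - x)) \<xi>) \<le> Cg * K"
    if \<mu>: "0 < \<mu>" "\<mu> \<le> 1" for \<mu> x \<xi>
  proof -
    have W: "(\<lambda>u. f u * g (\<mu> *\<^sub>R u - x)) \<in> schwartz"
      using 0 \<mu> by (intro windowed_schwartz) auto
    have "(1 + norm x) ^ M * norm (fourier (\<lambda>u. f u * g (\<mu> *\<^sub>R u - x)) \<xi>)
        \<le> (1 + norm x) ^ M * (LINT u|lborel. norm (f u * g (\<mu> *\<^sub>R u - x)))"
      by (intro mult_left_mono fourier_norm_le) auto
    also have "\<dots> = (LINT u|lborel. (1 + norm x) ^ M * norm (f u * g (\<mu> *\<^sub>R u - x)))"
      by simp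
    also have "\<dots> \<le> (LINT u|lborel. Cg * ((1 + norm u) ^ M * norm (f u)))"
    proof (rule integral_mono)
      show "integrable lborel (\<lambda>u. (1 + norm x) ^ M * norm (f u * g (\<mu> *\<^sub>R u - x)))"
        by (intro integrable_mult_right integrable_norm schwartz_integrable W)
      show "integrable lborel (\<lambda>u. Cg * ((1 + norm u) ^ M * norm (f u)))"
        by (intro integrable_mult_right schwartz_integrable_weighted 0)
      fix u
      let ?y = "\<mu> *\<^sub>R u - x"
      have "norm x \<le> norm (\<mu> *\<^sub>R u) + norm ?y"
        using norm_triangle_ineq4[of "\<mu> *\<^sub>R u" ?y] by simp
      also have "norm (\<mu> *\<^sub>R u) \<le> norm u"
        using \<mu> mult_right_mono[of \<mu> 1 "norm u"] by simp
      finally have "norm x \<le> norm u + norm ?y" by simp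
      moreover have "0 \<le> norm u * norm ?y" by simp
      ultimately have "1 + norm x \<le> (1 + norm u) * (1 + norm ?y)"
        unfolding distrib_left distrib_right by linarith
      then have "(1 + norm x) ^ M \<le> ((1 + norm u) * (1 + norm ?y)) ^ M"
        by (intro power_mono) auto
      then have "(1 + norm x) ^ M * norm (f u * g ?y)
         \<le> ((1 + norm u) * (1 + norm ?y)) ^ M * norm (f u * g ?y)"
        by (intro mult_right_mono) auto
      also have "\<dots> = ((1 + norm u) ^ M * norm (f u)) * ((1 + norm ?y) ^ M * norm (g ?y))"
        by (simp add: norm_mult power_mult_distrib)
      also have "\<dots> \<le> ((1 + norm u) ^ M * norm (f u)) * Cg"
        by (intro mult_left_mono Cg) auto
      finally show "(1 + norm x) ^ M * norm (f u * g ?y) \<le> Cg * ((1 + norm u) ^ M * norm (f u))"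
        by (simp add: mult.commute)
    qed
    also have "\<dots> = Cg * K" by (simp add: K_def)
    finally show ?thesis .
  qed
  then show ?case by auto
next
  case (Suc L)
  define V where "V f g \<mu> x \<xi> = fourier (\<lambda>u. f u * g (\<mu> *\<^sub>R u - x)) \<xi>" for f g :: "real^'n \<Rightarrow> complex" and \<mu> x \<xi>
  have IH: "\<exists>C. \<forall>\<mu> x \<xi>. 0 < \<mu> \<and> \<mu> \<le> 1 \<longrightarrow> (1 + norm \<xi>) ^ L * ((1 + norm x) ^ M * norm (V f g \<mu> x \<xi>)) \<le> C"
    if "f \<in> schwartz" "g \<in> schwartz" for f g
    using Suc.IH[OF that] by (simp add: V_def)
  obtain C0 where C0: "\<And>\<mu> x \<xi>. 0 < \<mu> \<Longrightarrow> \<mu> \<le> 1 \<Longrightarrow>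
      (1 + norm \<xi>) ^ L * ((1 + norm x) ^ M * norm (V f g \<mu> x \<xi>)) \<le> C0"
    using IH[OF Suc.prems] by blast
  obtain C1 where C1: "\<And>i \<mu> x \<xi>. 0 < \<mu> \<Longrightarrow> \<mu> \<le> 1 \<Longrightarrow>
      (1 + norm \<xi>) ^ L * ((1 + norm x) ^ M * norm (V (partial i f) g \<mu> x \<xi>)) \<le> C1 i"
    using IH[OF schwartz_partial[OF Suc.prems(1)] Suc.prems(2)] by metis
  obtain C2 where C2: "\<And>i \<mu> x \<xi>. 0 < \<mu> \<Longrightarrow> \<mu> \<le> 1 \<Longrightarrow>
      (1 + norm \<xi>) ^ L * ((1 + norm x) ^ M * norm (V f (partial i g) \<mu> x \<xi>)) \<le> C2 i"
    using IH[OF Suc.prems(1) schwartz_partial[OF Suc.prems(2)]] by metis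
  have "(1 + norm \<xi>) ^ Suc L * ((1 + norm x) ^ M * norm (V f g \<mu> x \<xi>)) \<le> C0 + (\<Sum>i\<in>UNIV. C1 i + C2 i)"
    if \<mu>: "0 < \<mu>" "\<mu> \<le> 1" for \<mu> x \<xi>
  proof -
    have k: "(\<lambda>u. f u * g (\<mu> *\<^sub>R u - x)) \<in> schwartz"
      using Suc.prems \<mu> by (intro windowed_schwartz) auto
    have g': "(\<lambda>u. h (\<mu> *\<^sub>R u - x)) \<in> schwartz" if "h \<in> schwartz" for h
      using schwartz_affine[OF that, of \<mu> "- x"] \<mu> by simp
    let ?w = "\<lambda>r. (1 + norm \<xi>) ^ L * ((1 + norm x) ^ M * r)"
    have w_mono: "?w r \<le> ?w r'" if "r \<le> r'" for r r'
      using that by (intro mult_left_mono) auto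
    have step: "\<bar>\<xi> $ i\<bar> * norm (V f g \<mu> x \<xi>) \<le> norm (V (partial i f) g \<mu> x \<xi>) + norm (V f (partial i g) \<mu> x \<xi>)" for i
    proof -
      have eq: "partial i (\<lambda>u. f u * g (\<mu> *\<^sub>R u - x)) =
         (\<lambda>u. of_real \<mu> * (f u * partial i g (\<mu> *\<^sub>R u - x)) + partial i f u * g (\<mu> *\<^sub>R u - x))"
        using partial_mult[OF Suc.prems(1) g'[OF Suc.prems(2)], of i]
          partial_affine[OF Suc.prems(2), of i \<mu> "- x"]
        by (simp add: mult_ac)
      have s1: "(\<lambda>u. f u * partial i g (\<mu> *\<^sub>R u - x)) \<in> schwartz"
        and s2: "(\<lambda>u. partial i f u * g (\<mu> *\<^sub>R u - x)) \<in> schwartz"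
        using Suc.prems \<mu> by (auto intro!: windowed_schwartz schwartz_partial)
      have "\<i> * of_real (\<xi> $ i) * V f g \<mu> x \<xi> = fourier (partial i (\<lambda>u. f u * g (\<mu> *\<^sub>R u - x))) \<xi>"
        using fourier_partial[OF k] by (simp add: V_def)
      also have "\<dots> = of_real \<mu> * V f (partial i g) \<mu> x \<xi> + V (partial i f) g \<mu> x \<xi>"
        unfolding eq V_def fourier_def distrib_left
        using cis_mult_integrable(2)[OF schwartz_integrable[OF s1], of \<xi>]
          cis_mult_integrable(2)[OF schwartz_integrable[OF s2], of \<xi>]
        by (simp add: mult.left_commute[of _ "of_real \<mu>"])
      finally have "\<bar>\<xi> $ i\<bar> * norm (V f g \<mu> x \<xi>) = norm (of_real \<mu> * V f (partial i g) \<mu> x \<xi> + V (partial i f) g \<mu> x \<xi>)"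
        by (metis mult_1 norm_ii norm_mult norm_of_real)
      also have "\<dots> \<le> \<mu> * norm (V f (partial i g) \<mu> x \<xi>) + norm (V (partial i f) g \<mu> x \<xi>)"
        using \<mu> by (intro order_trans[OF norm_triangle_ineq]) (simp add: norm_mult)
      also have "\<mu> * norm (V f (partial i g) \<mu> x \<xi>) \<le> norm (V f (partial i g) \<mu> x \<xi>)"
        using \<mu> by (intro mult_left_le_one_le) auto
      finally show ?thesis by simp
    qed
    have "(1 + norm \<xi>) ^ Suc L * ((1 + norm x) ^ M * norm (V f g \<mu> x \<xi>)) = (1 + norm \<xi>) * ?w (norm (V f g \<mu> x \<xi>))"
      by simp
    also have "\<dots> \<le> (1 + (\<Sum>i\<in>UNIV. \<bar>\<xi> $ i\<bar>)) * ?w (norm (V f g \<mu> x \<xi>))"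
      by (intro mult_right_mono one_plus_norm_le_sum) auto
    also have "\<dots> = ?w (norm (V f g \<mu> x \<xi>)) + (\<Sum>i\<in>UNIV. ?w (\<bar>\<xi> $ i\<bar> * norm (V f g \<mu> x \<xi>)))"
      unfolding distrib_right sum_distrib_right mult_1
      by (intro arg_cong2[where f = "(+)"] sum.cong refl) (simp only: mult_ac)
    also have "\<dots> \<le> C0 + (\<Sum>i\<in>UNIV. C1 i + C2 i)"
    proof (intro add_mono sum_mono)
      show "?w (norm (V f g \<mu> x \<xi>)) \<le> C0" by (rule C0[OF \<mu>])
      fix i
      have "?w (\<bar>\<xi> $ i\<bar> * norm (V f g \<mu> x \<xi>)) \<le> ?w (norm (V (partial i f) g \<mu> x \<xi>) + norm (V f (partial i g) \<mu> x \<xi>))"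
        by (intro w_mono step)
      also have "\<dots> = ?w (norm (V (partial i f) g \<mu> x \<xi>)) + ?w (norm (V f (partial i g) \<mu> x \<xi>))"
        by (simp add: distrib_left)
      also have "\<dots> \<le> C1 i + C2 i" by (intro add_mono C1 C2 \<mu>)
      finally show "?w (\<bar>\<xi> $ i\<bar> * norm (V f g \<mu> x \<xi>)) \<le> C1 i + C2 i" .
    qed
    finally show ?thesis .
  qed
  then show ?case unfolding V_def by blast
qed

lemma windowed_fourier_bound:
  fixes f g :: "real^'n::finite \<Rightarrow> complex"
  assumes "f \<in> schwartz" "g \<in> schwartz"
  shows "\<exists>C>0. \<forall>\<mu> x \<xi>. 0 < \<mu> \<longrightarrow> \<mu> \<le> 1 \<longrightarrow>
    norm (fourier (\<lambda>u. f u * g (\<mu> *\<^sub>R u - x)) \<xi>) \<le> C * (1 / (1 + norm \<xi>) ^ L) * (1 / (1 + norm x) ^ M)"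
proof -
  obtain C where C: "\<And>\<mu> x \<xi>. 0 < \<mu> \<Longrightarrow> \<mu> \<le> 1 \<Longrightarrow>
    (1 + norm \<xi>) ^ L * ((1 + norm x) ^ M * norm (fourier (\<lambda>u. f u * g (\<mu> *\<^sub>R u - x)) \<xi>)) \<le> C"
    using windowed_fourier_decay[OF assms, of L M] by blast
  show ?thesis
  proof (intro exI[of _ "max 1 C"] conjI allI impI)
    fix \<mu> :: real and x \<xi> :: "real^'n" assume "0 < \<mu>" "\<mu> \<le> 1"
    then have "(1 + norm \<xi>) ^ L * ((1 + norm x) ^ M * norm (fourier (\<lambda>u. f u * g (\<mu> *\<^sub>R u - x)) \<xi>)) \<le> max 1 C"
      using C[of \<mu> \<xi> x] by simp
    moreover have "0 < (1 + norm \<xi>) ^ L" "0 < (1 + norm x) ^ M"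
      by (intro zero_less_power one_plus_norm_pos)+
    ultimately show "norm (fourier (\<lambda>u. f u * g (\<mu> *\<^sub>R u - x)) \<xi>) \<le> max 1 C * (1 / (1 + norm \<xi>) ^ L) * (1 / (1 + norm x) ^ M)"
      by (simp add: pos_le_divide_eq mult_ac)
  qed simp
qed

text \<open>As \<mu> and \<xi> tend to 0 and x tends to \<open>x\<^sub>0\<close>, the window becomes
  the constant \<open>g (- x\<^sub>0)\<close> and the expression tends to
  \<open>g (- x\<^sub>0) * fourier f 0\<close>. The Lipschitz bounds for g and for the exponential
  make the error at most \<epsilon> K.\<close>

lemma windowed_fourier_lower_bound:
  fixes f g :: "real^'n::finite \<Rightarrow> complex"
  assumes f: "f \<in> schwartz" and g: "g \<in> schwartz" and g0: "g (- x\<^sub>0) \<noteq> 0" and f0: "fourier f 0 \<noteq> 0"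
  shows "\<exists>c>0. \<exists>\<epsilon>>0. \<epsilon> < 1/2 \<and> (\<forall>\<mu> x \<xi>. 0 < \<mu> \<longrightarrow> \<mu> \<le> \<epsilon> \<longrightarrow> norm (x - x\<^sub>0) < \<epsilon> \<longrightarrow> norm \<xi> < \<epsilon> \<longrightarrow>
    c \<le> norm (fourier (\<lambda>u. f u * g (\<mu> *\<^sub>R u - x)) \<xi>))"
proof -
  obtain L where L: "0 < L" "\<And>x y. norm (g x - g y) \<le> L * norm (x - y)"
    using schwartz_lipschitz[OF g] by blast
  define G where "G = L + norm (g (- x\<^sub>0))"
  define K where "K = G * (LINT u|lborel. (1 + norm u) ^ 1 * norm (f u))"
  \<comment> \<open>Half of the limit value: an error of at most c still leaves c.\<close>
  define c where "c = norm (g (- x\<^sub>0) * fourier f 0) / 2"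
  \<comment> \<open>The bound c / (1 + K) gives \<epsilon> K \<le> c, also for K = 0. The cap 1/4
    ensures \<epsilon> < 1/2, which makes the frequency balls in
    \<open>packet_modulation_norm_ge\<close> disjoint.\<close>
  define \<epsilon> where "\<epsilon> = min (1/4) (c / (1 + K))"
  have G: "0 < G" using L by (simp add: G_def add_pos_nonneg)
  have K: "0 \<le> K" using G by (simp add: K_def)
  have c: "0 < c" using f0 g0 by (simp add: c_def)
  have \<epsilon>: "0 < \<epsilon>" "\<epsilon> < 1/2" using c K by (auto simp: \<epsilon>_def)
  have "\<epsilon> * K \<le> c"
  proof -
    have "\<epsilon> * K \<le> c / (1 + K) * (1 + K)"
      using K c by (intro mult_mono) (auto simp: \<epsilon>_def)
    then show ?thesis using K by simp
  qed
  show ?thesis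
  proof (rule exI[of _ c], rule conjI[OF c], rule exI[of _ \<epsilon>], intro conjI allI impI \<epsilon>)
    fix \<mu> :: real and x \<xi> :: "real^'n"
    assume \<mu>: "0 < \<mu>" "\<mu> \<le> \<epsilon>" and x: "norm (x - x\<^sub>0) < \<epsilon>" and \<xi>: "norm \<xi> < \<epsilon>"
    let ?W = "\<lambda>u. f u * g (\<mu> *\<^sub>R u - x)"
    have W: "?W \<in> schwartz" using f g \<mu> by (intro windowed_schwartz) auto
    have int: "integrable lborel (\<lambda>u. cis (- (\<xi> \<bullet> u)) * ?W u)" "integrable lborel f"
      by (intro cis_mult_integrable schwartz_integrable W f)+
    have "fourier ?W \<xi> - g (- x\<^sub>0) * fourier f 0 = (LINT u|lborel. cis (- (\<xi> \<bullet> u)) * ?W u - g (- x\<^sub>0) * f u)"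
      using int by (simp add: fourier_def)
    also have "norm \<dots> \<le> (LINT u|lborel. \<epsilon> * G * ((1 + norm u) ^ 1 * norm (f u)))"
    proof (rule Bochner_Integration.integral_norm_bound_integral)
      show "integrable lborel (\<lambda>u. cis (- (\<xi> \<bullet> u)) * ?W u - g (- x\<^sub>0) * f u)"
        using int by (intro Bochner_Integration.integrable_diff integrable_mult_right)
      show "integrable lborel (\<lambda>u. \<epsilon> * G * ((1 + norm u) ^ 1 * norm (f u)))"
        by (intro integrable_mult_right schwartz_integrable_weighted f)
      fix u
      let ?z = "cis (- (\<xi> \<bullet> u))"
      have "norm (g (\<mu> *\<^sub>R u - x) - g (- x\<^sub>0)) \<le> L * norm ((\<mu> *\<^sub>R u - x) - (- x\<^sub>0))"
        by (rule L)
      also have "norm ((\<mu> *\<^sub>R u - x) - (- x\<^sub>0)) \<le> \<mu> * norm u + norm (x - x\<^sub>0)"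
        using norm_triangle_ineq4[of "\<mu> *\<^sub>R u" "x - x\<^sub>0"] \<mu> by (simp add: algebra_simps)
      also have "\<dots> \<le> \<epsilon> * (1 + norm u)"
        using \<mu> x mult_right_mono[OF \<mu>(2) norm_ge_zero[of u]] by (simp add: algebra_simps)
      finally have 1: "norm (g (\<mu> *\<^sub>R u - x) - g (- x\<^sub>0)) \<le> L * (\<epsilon> * (1 + norm u))"
        using L(1) by simp
      have "norm (?z - 1) \<le> \<bar>\<xi> \<bullet> u\<bar>"
        using iexp_approx1[of "- (\<xi> \<bullet> u)" 0] by (simp add: cis_conv_exp)
      also have "\<dots> \<le> norm \<xi> * norm u" by (rule Cauchy_Schwarz_ineq2)
      also have "\<dots> \<le> \<epsilon> * (1 + norm u)"
        using \<xi> \<epsilon> by (intro mult_mono) auto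
      finally have 2: "norm (g (- x\<^sub>0)) * norm (?z - 1) \<le> norm (g (- x\<^sub>0)) * (\<epsilon> * (1 + norm u))"
        by (intro mult_left_mono) auto
      have "?z * ?W u - g (- x\<^sub>0) * f u = f u * (?z * (g (\<mu> *\<^sub>R u - x) - g (- x\<^sub>0)) + g (- x\<^sub>0) * (?z - 1))"
        by (simp add: algebra_simps)
      also have "norm \<dots> \<le> norm (f u) * (norm (g (\<mu> *\<^sub>R u - x) - g (- x\<^sub>0)) + norm (g (- x\<^sub>0)) * norm (?z - 1))"
        unfolding norm_mult by (intro mult_left_mono order_trans[OF norm_triangle_ineq]) (auto simp: norm_mult)
      also have "\<dots> \<le> norm (f u) * (L * (\<epsilon> * (1 + norm u)) + norm (g (- x\<^sub>0)) * (\<epsilon> * (1 + norm u)))"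
        by (intro mult_left_mono add_mono 1 2) auto
      also have "\<dots> = \<epsilon> * G * ((1 + norm u) ^ 1 * norm (f u))"
        by (simp add: G_def algebra_simps)
      finally show "norm (?z * ?W u - g (- x\<^sub>0) * f u) \<le> \<epsilon> * G * ((1 + norm u) ^ 1 * norm (f u))" .
    qed
    also have "\<dots> = \<epsilon> * K" by (simp add: K_def)
    also have "\<dots> \<le> c" by fact
    finally have "norm (fourier ?W \<xi> - g (- x\<^sub>0) * fourier f 0) \<le> c" .
    then show "c \<le> norm (fourier ?W \<xi>)"
      using norm_triangle_ineq2[of "g (- x\<^sub>0) * fourier f 0" "fourier ?W \<xi>"]
      by (simp add: c_def norm_minus_commute)
  qed
qed

section \<open>Separated frequency sets\<close>

definition separated :: "'a::metric_space set \<Rightarrow> bool" where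
  "separated S \<longleftrightarrow> finite S \<and> S \<noteq> {} \<and> (\<forall>k\<in>S. \<forall>l\<in>S. k \<noteq> l \<longrightarrow> 1 \<le> dist k l)"

text \<open>Comparison with an integral: the balls of radius 1/2 about the points of S are disjoint,
  and on each of them the weight changes by at most a constant factor. The bound depends neither on
  S nor on \<zeta>, which is what lets the number of packets grow.\<close>

lemma separated_sum_bound:
  "\<exists>C>0. \<forall>(S :: (real^'n::finite) set) \<zeta>. separated S \<longrightarrow>
     (\<Sum>k\<in>S. 1 / (1 + norm (\<zeta> - k)) ^ (2 * CARD('n))) \<le> C"
proof -
  let ?L = "2 * CARD('n)"
  let ?w = "\<lambda>x::real^'n. 1 / (1 + norm x) ^ ?L"
  define I where "I = (LINT x|lborel. ?w x)"
  define v where "v = measure lborel (ball (0::real^'n) (1/2))"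
  have v: "0 < v" unfolding v_def by (intro content_ball_pos) simp
  have int: "integrable lborel ?w"
    using integrable_polynomial_decay[where 'a = "real^'n"] by simp
  have I: "0 \<le> I" unfolding I_def by (intro integral_nonneg_AE) auto
  show ?thesis
  proof (intro exI[of _ "1 + 2 ^ ?L * I / v"] conjI allI impI)
    show "0 < 1 + 2 ^ ?L * I / v" using v I by (simp add: add_pos_nonneg)
    fix S :: "(real^'n) set" and \<zeta>
    assume "separated S"
    then have S: "finite S" and sep: "\<And>k l. k \<in> S \<Longrightarrow> l \<in> S \<Longrightarrow> k \<noteq> l \<Longrightarrow> 1 \<le> dist k l"
      by (auto simp: separated_def)
    have disj: "disjoint_family_on (\<lambda>k. ball k (1/2)) S"
      unfolding disjoint_family_on_def
    proof (intro ballI impI)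
      fix k l assume kl: "k \<in> S" "l \<in> S" "k \<noteq> l"
      show "ball k (1/2) \<inter> ball l (1/2) = {}"
      proof (rule equals0I)
        fix z assume "z \<in> ball k (1/2) \<inter> ball l (1/2)"
        then have "dist k z < 1/2" "dist l z < 1/2" by auto
        then show False using dist_triangle2[of k l z] sep[OF kl] by linarith
      qed
    qed
    have wz: "integrable lborel (\<lambda>y. 2 ^ ?L * ?w (\<zeta> - y))"
      using integrable_lborel_affine[OF int, of "-1" \<zeta>] by (intro integrable_mult_right) simp
    have Iz: "(LINT y|lborel. 2 ^ ?L * ?w (\<zeta> - y)) = 2 ^ ?L * I"
    proof -
      have "(LINT y|lborel. ?w (\<zeta> - y)) = I"
        using integral_lborel_affine[OF int, of "-1" \<zeta>] by (simp add: I_def)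
      then show ?thesis by (simp only: integral_mult_right_zero)
    qed
    have ib: "integrable lborel (\<lambda>y. indicat_real (ball k (1/2)) y * c)" for k :: "real^'n" and c
      using emeasure_lborel_ball_finite[of k "1/2"]
      by (intro integrable_mult_left integrable_real_indicator) auto
    have "v * (\<Sum>k\<in>S. ?w (\<zeta> - k)) = (LINT y|lborel. (\<Sum>k\<in>S. indicat_real (ball k (1/2)) y * ?w (\<zeta> - k)))"
    proof -
      have vk: "measure lborel (ball k (1/2)) = v" for k :: "real^'n"
        unfolding v_def by (subst (1 2) content_ball_conv_unit_ball) simp_all
      have "(LINT y|lborel. (\<Sum>k\<in>S. indicat_real (ball k (1/2)) y * ?w (\<zeta> - k))) =
          (\<Sum>k\<in>S. LINT y|lborel. indicat_real (ball k (1/2)) y * ?w (\<zeta> - k))"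
        by (rule Bochner_Integration.integral_sum[OF ib])
      also have "\<dots> = (\<Sum>k\<in>S. v * ?w (\<zeta> - k))"
        by (simp add: vk)
      finally show ?thesis by (simp only: sum_distrib_left)
    qed
    also have "\<dots> \<le> (LINT y|lborel. 2 ^ ?L * ?w (\<zeta> - y))"
    proof (rule integral_mono)
      show "integrable lborel (\<lambda>y. \<Sum>k\<in>S. indicat_real (ball k (1/2)) y * ?w (\<zeta> - k))"
        by (intro Bochner_Integration.integrable_sum ib)
      fix y
      have "(\<Sum>k\<in>S. indicat_real (ball k (1/2)) y * ?w (\<zeta> - k)) \<le> (\<Sum>k\<in>S. indicat_real (ball k (1/2)) y * (2 ^ ?L * ?w (\<zeta> - y)))"
      proof (rule sum_mono)
        fix k
        show "indicat_real (ball k (1/2)) y * ?w (\<zeta> - k) \<le> indicat_real (ball k (1/2)) y * (2 ^ ?L * ?w (\<zeta> - y))"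
        proof (cases "y \<in> ball k (1/2)")
          case True
          have "norm (\<zeta> - y) \<le> norm (\<zeta> - k) + norm (k - y)"
            using norm_triangle_ineq[of "\<zeta> - k" "k - y"] by simp
          also have "norm (k - y) \<le> 1" using True by (simp add: dist_norm)
          finally have "norm (\<zeta> - y) \<le> norm (\<zeta> - k) + 1" by simp
          then have "1 + norm (\<zeta> - y) \<le> 2 * (1 + norm (\<zeta> - k))"
            using norm_ge_zero[of "\<zeta> - k"] by argo
          then have "(1 + norm (\<zeta> - y)) ^ ?L \<le> 2 ^ ?L * (1 + norm (\<zeta> - k)) ^ ?L"
            by (metis power_mono power_mult_distrib one_plus_norm_pos less_imp_le)
          moreover have "0 < (1 + norm (\<zeta> - y)) ^ ?L" "0 < (1 + norm (\<zeta> - k)) ^ ?L"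
            by (intro zero_less_power one_plus_norm_pos)+
          ultimately have "?w (\<zeta> - k) \<le> 2 ^ ?L * ?w (\<zeta> - y)"
            by (simp add: pos_divide_le_eq pos_le_divide_eq mult_ac)
          then show ?thesis by (rule mult_left_mono) simp
        qed simp
      qed
      also have "\<dots> = indicat_real (\<Union>k\<in>S. ball k (1/2)) y * (2 ^ ?L * ?w (\<zeta> - y))"
        by (subst indicator_UN_disjoint[OF S disj]) (rule sum_distrib_right[symmetric])
      also have "\<dots> \<le> 2 ^ ?L * ?w (\<zeta> - y)"
        by (intro mult_left_le_one_le) auto
      finally show "(\<Sum>k\<in>S. indicat_real (ball k (1/2)) y * ?w (\<zeta> - k)) \<le> 2 ^ ?L * ?w (\<zeta> - y)" .
    qed (rule wz)
    also have "\<dots> = 2 ^ ?L * I" by (rule Iz)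
    finally have "(\<Sum>k\<in>S. ?w (\<zeta> - k)) \<le> 2 ^ ?L * I / v"
      using v by (simp only: pos_le_divide_eq mult.commute)
    then show "(\<Sum>k\<in>S. ?w (\<zeta> - k)) \<le> 1 + 2 ^ ?L * I / v" by simp
  qed
qed

section \<open>Wave packets\<close>

text \<open>The shift is taken after the dilation, so the k-th packet is centred at a(k) / \<rho>.
  This explains the factor \<rho> in the spacing demanded by
  \<open>packet_modulation_norm_ge\<close>.\<close>

definition packet ::
    "(real^'n::finite \<Rightarrow> complex) \<Rightarrow> real \<Rightarrow> real \<Rightarrow> (real^'n) set \<Rightarrow> (real^'n \<Rightarrow> real^'n) \<Rightarrow> real^'n \<Rightarrow> complex" where
  "packet g \<rho> \<tau> S a t =
     of_real (\<tau> * \<rho> ^ CARD('n)) * (\<Sum>k\<in>S. cis ((\<rho> *\<^sub>R k) \<bullet> t) * g (\<rho> *\<^sub>R t - a k))"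

lemma separated_card_pos: "separated S \<Longrightarrow> 0 < real (card S)"
  by (auto simp: separated_def card_gt_0_iff)

lemma schwartz_packet:
  assumes g: "g \<in> schwartz" and S: "finite S" and \<rho>: "0 < \<rho>"
  shows "packet g \<rho> \<tau> S a \<in> schwartz"
proof -
  have "(\<lambda>t. cis ((\<rho> *\<^sub>R k) \<bullet> t) * g (\<rho> *\<^sub>R t + - a k)) \<in> schwartz" for k
    using \<rho> by (intro schwartz_cis_mult schwartz_affine g) auto
  then have "(\<lambda>t. of_real (\<tau> * \<rho> ^ CARD('a)) * (\<Sum>k\<in>S. cis ((\<rho> *\<^sub>R k) \<bullet> t) * g (\<rho> *\<^sub>R t - a k))) \<in> schwartz"
    by (intro schwartz_cmult schwartz_sum S) simp
  then show ?thesis by (simp add: packet_def[abs_def])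
qed

text \<open>The profile may depend on k to cover two uses: the packet itself, where every profile is
  g, and its product with a translated window, where the window seen from a(k) differs with
  k.\<close>

lemma fourier_sum_affine:
  fixes F :: "real^'n::finite \<Rightarrow> real^'n \<Rightarrow> complex"
  assumes F: "\<And>k. F k \<in> schwartz" and \<rho>: "0 < \<rho>"
  shows "fourier (\<lambda>t. of_real (\<tau> * \<rho> ^ CARD('n)) * (\<Sum>k\<in>S. cis ((\<rho> *\<^sub>R k) \<bullet> t) * F k (\<rho> *\<^sub>R t - a k))) \<xi> =
    of_real \<tau> * (\<Sum>k\<in>S. cis ((\<rho> *\<^sub>R k - \<xi>) \<bullet> a k / \<rho>) * fourier (F k) (\<xi> /\<^sub>R \<rho> - k))"
proof -
  let ?G = "\<lambda>k t. cis ((\<rho> *\<^sub>R k) \<bullet> t) * F k (\<rho> *\<^sub>R t - a k)"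
  have G: "?G k \<in> schwartz" for k
    using schwartz_affine[OF F, of \<rho> k "- a k"] \<rho> by (intro schwartz_cis_mult) simp
  have "fourier (\<lambda>t. \<Sum>k\<in>S. ?G k t) \<xi> = (\<Sum>k\<in>S. fourier (?G k) \<xi>)"
    unfolding fourier_def sum_distrib_left
    by (rule Bochner_Integration.integral_sum) (intro cis_mult_integrable schwartz_integrable G)
  also have "\<dots> = (\<Sum>k\<in>S. cis ((\<rho> *\<^sub>R k - \<xi>) \<bullet> a k / \<rho>) * fourier (F k) (\<xi> /\<^sub>R \<rho> - k) / of_real (\<rho> ^ CARD('n)))"
  proof (rule sum.cong[OF refl])
    fix k
    have "(\<xi> - \<rho> *\<^sub>R k) /\<^sub>R \<rho> = \<xi> /\<^sub>R \<rho> - k" using \<rho> by (simp add: scaleR_diff_right)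
    then show "fourier (?G k) \<xi> =
      cis ((\<rho> *\<^sub>R k - \<xi>) \<bullet> a k / \<rho>) * fourier (F k) (\<xi> /\<^sub>R \<rho> - k) / of_real (\<rho> ^ CARD('n))"
      using fourier_affine[OF schwartz_integrable[OF F] \<rho>, of "\<rho> *\<^sub>R k" k "a k" \<xi>] by simp
  qed
  finally show ?thesis
    using \<rho> by (subst fourier_cmult) (simp flip: sum_divide_distrib)
qed

lemma fourier_packet:
  fixes g :: "real^'n::finite \<Rightarrow> complex"
  assumes "g \<in> schwartz" "0 < \<rho>"
  shows "fourier (packet g \<rho> \<tau> S a) \<xi> =
    of_real \<tau> * (\<Sum>k\<in>S. cis ((\<rho> *\<^sub>R k - \<xi>) \<bullet> a k / \<rho>) * fourier g (\<xi> /\<^sub>R \<rho> - k))"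
  unfolding packet_def[abs_def] by (rule fourier_sum_affine[OF assms])

text \<open>In the variable u = \<rho> t - a(k), in which the k-th packet has unit size, the window
  is dilated by 1 / \<rho>. This is the origin of the parameter \<mu> in the windowed
  estimates.\<close>

lemma stft_packet:
  fixes g \<phi> :: "real^'n::finite \<Rightarrow> complex"
  assumes g: "g \<in> schwartz" and \<phi>: "\<phi> \<in> schwartz" and S: "finite S" and \<rho>: "0 < \<rho>"
  shows "stft \<phi> (dist_of (packet g \<rho> \<tau> S a)) x \<xi> =
    of_real \<tau> * (\<Sum>k\<in>S. cis ((\<rho> *\<^sub>R k - \<xi>) \<bullet> a k / \<rho>) *
      fourier (\<lambda>u. g u * cnj (\<phi> ((1 / \<rho>) *\<^sub>R u - (x - a k /\<^sub>R \<rho>)))) (\<xi> /\<^sub>R \<rho> - k))"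
proof -
  define F where "F k = (\<lambda>u. g u * cnj (\<phi> ((1 / \<rho>) *\<^sub>R u - (x - a k /\<^sub>R \<rho>))))" for k
  have F: "F k \<in> schwartz" for k
    unfolding F_def using \<rho> by (intro windowed_schwartz g schwartz_cnj[OF \<phi>]) simp
  have "packet g \<rho> \<tau> S a t * cnj (\<phi> (t - x)) =
    of_real (\<tau> * \<rho> ^ CARD('n)) * (\<Sum>k\<in>S. cis ((\<rho> *\<^sub>R k) \<bullet> t) * F k (\<rho> *\<^sub>R t - a k))" for t
  proof -
    have e: "(1 / \<rho>) *\<^sub>R (\<rho> *\<^sub>R t - a k) - (x - a k /\<^sub>R \<rho>) = t - x" for k
      using \<rho> by (simp add: scaleR_diff_right inverse_eq_divide)
    show ?thesis
      by (simp only: packet_def F_def e sum_distrib_right mult.assoc)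
  qed
  then have "stft \<phi> (dist_of (packet g \<rho> \<tau> S a)) x \<xi> =
      fourier (\<lambda>t. of_real (\<tau> * \<rho> ^ CARD('n)) * (\<Sum>k\<in>S. cis ((\<rho> *\<^sub>R k) \<bullet> t) * F k (\<rho> *\<^sub>R t - a k))) \<xi>"
    by (simp only: stft_dist_of[OF schwartz_packet[OF g S \<rho>] \<phi>])
  also note fourier_sum_affine[OF F \<rho>]
  finally show ?thesis unfolding F_def .
qed

section \<open>Dispersed positions and the size of a packet\<close>

definition dispersed :: "real \<Rightarrow> 'b set \<Rightarrow> ('b \<Rightarrow> 'a::metric_space) \<Rightarrow> bool" where
  "dispersed R S a \<longleftrightarrow> (\<forall>k\<in>S. \<forall>l\<in>S. k \<noteq> l \<longrightarrow> R \<le> dist (a k) (a l))"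

lemma dispersedD: "dispersed R S a \<Longrightarrow> k \<in> S \<Longrightarrow> l \<in> S \<Longrightarrow> k \<noteq> l \<Longrightarrow> R \<le> dist (a k) (a l)"
  by (simp add: dispersed_def)

text \<open>At most one position lies within R of y. Its term is at most 1, and every other term is
  at most 1 / (1 + R).\<close>

lemma dispersed_sum_le:
  fixes a :: "'b \<Rightarrow> 'a::real_normed_vector"
  assumes S: "finite S" and R: "0 \<le> R"
    and far: "dispersed (2 * R) S a"
  shows "(\<Sum>k\<in>S. 1 / (1 + norm (y - a k))) \<le> 1 + real (card S) / (1 + R)"
proof -
  have small: "1 / (1 + norm (y - a k)) \<le> 1 / (1 + R)" if "R \<le> norm (y - a k)" for k
    using that R by (intro divide_left_mono) (auto simp: add_pos_nonneg)
  have one: "1 / (1 + norm z) \<le> 1" for z :: 'a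
    using one_plus_norm_pos[of z] by (simp add: pos_divide_le_eq)
  show ?thesis
  proof (cases "\<exists>j\<in>S. norm (y - a j) < R")
    case True
    then obtain j where j: "j \<in> S" "norm (y - a j) < R" by blast
    have far': "R \<le> norm (y - a k)" if "k \<in> S - {j}" for k
    proof -
      have "2 * R \<le> dist (a j) (a k)" using dispersedD[OF far, of j k] that j by auto
      also have "\<dots> \<le> norm (y - a j) + norm (y - a k)"
        using dist_triangle2[of "a j" "a k" y] by (simp add: dist_norm norm_minus_commute)
      finally show ?thesis using j by simp
    qed
    have "(\<Sum>k\<in>S. 1 / (1 + norm (y - a k))) =
        1 / (1 + norm (y - a j)) + (\<Sum>k\<in>S - {j}. 1 / (1 + norm (y - a k)))"
      by (rule sum.remove[OF S j(1)])
    also have "\<dots> \<le> 1 + (\<Sum>k\<in>S - {j}. 1 / (1 + R))"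
      by (intro add_mono one sum_mono small far')
    also have "(\<Sum>k\<in>S - {j}. 1 / (1 + R)) \<le> (\<Sum>k\<in>S. 1 / (1 + R))"
      using S R by (intro sum_mono2) auto
    finally show ?thesis by simp
  next
    case False
    then have "(\<Sum>k\<in>S. 1 / (1 + norm (y - a k))) \<le> (\<Sum>k\<in>S. 1 / (1 + R))"
      by (intro sum_mono small) (meson not_le)
    then show ?thesis by simp
  qed
qed

text \<open>The supremum bound rests on the dispersion of the positions, the integral bound only on
  the triangle inequality. One constant is taken for both, so that it factors out when powers of the
  two bounds are multiplied.\<close>

lemma packet_size:
  fixes g :: "real^'n::finite \<Rightarrow> complex"
  assumes g: "g \<in> schwartz"
  obtains C where "0 < C" "\<And>\<rho> \<tau> S a t. 1 \<le> \<rho> \<Longrightarrow> 0 < \<tau> \<Longrightarrow> separated S \<Longrightarrow>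
      dispersed (2 * real (card S)) S a \<Longrightarrow>
      norm (packet g \<rho> \<tau> S a t) \<le> \<tau> * C * \<rho> ^ CARD('n)"
    "\<And>\<rho> \<tau> S a. 1 \<le> \<rho> \<Longrightarrow> 0 < \<tau> \<Longrightarrow> separated S \<Longrightarrow>
      (LINT t|lborel. norm (packet g \<rho> \<tau> S a t)) \<le> \<tau> * C * real (card S)"
proof -
  obtain C0 where C0: "0 < C0" "\<And>x. norm (g x) \<le> C0 / (1 + norm x) ^ 1"
    using schwartz_decay'[OF g] by metis
  define I where "I = (LINT x|lborel. norm (g x))"
  have I: "0 \<le> I" by (simp add: I_def)
  define C where "C = 2 * C0 + I"
  have C: "0 < C" "2 * C0 \<le> C" "I \<le> C" using C0(1) I by (auto simp: C_def)
  have trig: "norm (packet g \<rho> \<tau> S a t) \<le> \<tau> * \<rho> ^ CARD('n) * (\<Sum>k\<in>S. norm (g (\<rho> *\<^sub>R t - a k)))"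
    if "1 \<le> \<rho>" "0 < \<tau>" for \<rho> \<tau> S a t
  proof -
    have "norm (\<Sum>k\<in>S. cis ((\<rho> *\<^sub>R k) \<bullet> t) * g (\<rho> *\<^sub>R t - a k)) \<le> (\<Sum>k\<in>S. norm (g (\<rho> *\<^sub>R t - a k)))"
      by (rule sum_norm_le) (simp add: norm_mult)
    moreover have "norm (complex_of_real (\<tau> * \<rho> ^ CARD('n))) = \<tau> * \<rho> ^ CARD('n)"
      using that by (simp only: norm_of_real) simp
    ultimately show ?thesis
      using that unfolding packet_def norm_mult[of "of_real _"] by (simp add: mult_left_mono del: of_real_mult)
  qed
  show ?thesis
  proof (rule that[OF C(1)])
    fix \<rho> \<tau> :: real and S :: "(real^'n) set" and a :: "real^'n \<Rightarrow> real^'n" and t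
    assume *: "1 \<le> \<rho>" "0 < \<tau>" "separated S"
      and far: "dispersed (2 * real (card S)) S a"
    have S: "finite S" using * by (simp add: separated_def)
    have "(\<Sum>k\<in>S. norm (g (\<rho> *\<^sub>R t - a k))) \<le> (\<Sum>k\<in>S. C0 * (1 / (1 + norm (\<rho> *\<^sub>R t - a k))))"
      using C0(2) by (intro sum_mono) simp
    also have "\<dots> = C0 * (\<Sum>k\<in>S. 1 / (1 + norm (\<rho> *\<^sub>R t - a k)))"
      by (rule sum_distrib_left[symmetric])
    \<comment> \<open>Spacing 2 m for m packets corresponds to R = m; the sum then stays below 2
      however many packets there are.\<close>
    also have "\<dots> \<le> C0 * (1 + real (card S) / (1 + real (card S)))"
      using C0(1) by (intro mult_left_mono dispersed_sum_le S far) auto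
    also have "\<dots> \<le> C0 * 2"
      using C0(1) by (intro mult_left_mono) (auto simp: divide_le_eq)
    finally have sum_le: "(\<Sum>k\<in>S. norm (g (\<rho> *\<^sub>R t - a k))) \<le> C" using C by simp
    have "norm (packet g \<rho> \<tau> S a t) \<le> \<tau> * \<rho> ^ CARD('n) * C"
      using * by (intro order_trans[OF trig] mult_left_mono sum_le) auto
    then show "norm (packet g \<rho> \<tau> S a t) \<le> \<tau> * C * \<rho> ^ CARD('n)"
      by (simp add: mult_ac)
  next
    fix \<rho> \<tau> :: real and S :: "(real^'n) set" and a :: "real^'n \<Rightarrow> real^'n"
    assume *: "1 \<le> \<rho>" "0 < \<tau>" "separated S"
    have S: "finite S" using * by (simp add: separated_def)
    have ig: "integrable lborel (\<lambda>x. norm (g x))" by (intro integrable_norm schwartz_integrable g)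
    have ik: "integrable lborel (\<lambda>t. norm (g (\<rho> *\<^sub>R t - a k)))"
      and Ik: "(LINT t|lborel. norm (g (\<rho> *\<^sub>R t - a k))) = I / \<rho> ^ CARD('n)" for k
      using integrable_lborel_affine[OF ig, of \<rho> "- a k"] integral_lborel_affine[OF ig, of \<rho> "- a k"] *
      by (simp_all add: I_def divide_inverse mult.commute)
    have "(LINT t|lborel. norm (packet g \<rho> \<tau> S a t)) \<le>
        (LINT t|lborel. \<tau> * \<rho> ^ CARD('n) * (\<Sum>k\<in>S. norm (g (\<rho> *\<^sub>R t - a k))))"
    proof (rule integral_mono)
      show "integrable lborel (\<lambda>t. norm (packet g \<rho> \<tau> S a t))"
        using * S by (intro integrable_norm schwartz_integrable schwartz_packet g) auto
      show "integrable lborel (\<lambda>t. \<tau> * \<rho> ^ CARD('n) * (\<Sum>k\<in>S. norm (g (\<rho> *\<^sub>R t - a k))))"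
        by (intro integrable_mult_right Bochner_Integration.integrable_sum ik)
    qed (use * in \<open>intro trig\<close>)
    also have "\<dots> = \<tau> * I * real (card S)"
      using ik * by (simp add: Ik)
    also have "\<dots> \<le> \<tau> * C * real (card S)"
      using * C by (intro mult_right_mono mult_left_mono) auto
    finally show "(LINT t|lborel. norm (packet g \<rho> \<tau> S a t)) \<le> \<tau> * C * real (card S)" .
  qed
qed

section \<open>Modulation norms of wave packets\<close>

lemma packet_modulation_norm_le:
  fixes g \<phi> :: "real^'n::finite \<Rightarrow> complex"
  assumes g: "g \<in> schwartz" and \<phi>: "\<phi> \<in> schwartz"
    and p: "1 \<le> p" "p < \<infinity>" and q: "1 \<le> q" "q < \<infinity>"
  shows "\<exists>C>0. \<forall>\<rho> \<tau> S a. 1 \<le> \<rho> \<longrightarrow> 0 < \<tau> \<longrightarrow> separated S \<longrightarrow>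
      modulation_norm \<phi> p q (dist_of (packet g \<rho> \<tau> S a)) \<le>
        ennreal (\<tau> * C * (\<rho> ^ CARD('n) * real (card S)) powr recip q)"
proof -
  let ?L = "2 * CARD('n)"
  define w where "w x = 1 / (1 + norm x) ^ ?L" for x :: "real^'n"
  define I where "I = (LINT x|lborel. w x)"
  have int: "integrable lborel w"
    using integrable_polynomial_decay[where 'a = "real^'n"] by (simp add: w_def[abs_def])
  have w0: "0 \<le> w x" "w x \<le> 1" for x :: "real^'n"
    unfolding w_def by (auto simp: pos_divide_le_eq one_plus_norm_pos)
  have I: "0 \<le> I" unfolding I_def by (intro integral_nonneg_AE) (auto simp: w0)
  obtain C1 where C1: "0 < C1" "\<And>\<mu> x \<xi>. 0 < \<mu> \<Longrightarrow> \<mu> \<le> 1 \<Longrightarrow>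
    norm (fourier (\<lambda>u. g u * cnj (\<phi> (\<mu> *\<^sub>R u - x))) \<xi>) \<le> C1 * w \<xi> * w x"
    using windowed_fourier_bound[OF g schwartz_cnj[OF \<phi>], of ?L ?L] unfolding w_def by blast
  obtain C2 where C2: "0 < C2" "\<And>(S :: (real^'n) set) \<zeta>. separated S \<Longrightarrow> (\<Sum>k\<in>S. w (\<zeta> - k)) \<le> C2"
    using separated_sum_bound[where 'n = 'n] unfolding w_def by blast
  \<comment> \<open>Writing 1 + I for I makes positivity of \<open>C\<close> immediate.\<close>
  define C where "C = C1 * (1 + I) powr recip p * C2 powr (1 - recip q) * (1 + I) powr recip q"
  have C: "0 < C" using C1 C2 I by (simp add: C_def)
  show ?thesis
  proof (rule exI[of _ C], intro conjI allI impI C)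
    fix \<rho> \<tau> :: real and S :: "(real^'n) set" and a :: "real^'n \<Rightarrow> real^'n"
    assume \<rho>: "1 \<le> \<rho>" and \<tau>: "0 < \<tau>" and S: "separated S"
    have fin: "finite S" using S by (simp add: separated_def)
    let ?V = "\<lambda>\<xi> x. norm (stft \<phi> (dist_of (packet g \<rho> \<tau> S a)) x \<xi>)"
    define U where "U \<xi> = (\<Sum>k\<in>S. w (\<xi> /\<^sub>R \<rho> - k))" for \<xi>
    have U: "0 \<le> U \<xi>" "U \<xi> \<le> C2" for \<xi>
      unfolding U_def using C2(2)[OF S] by (auto intro!: sum_nonneg w0)
    \<comment> \<open>The majorant of the transform: each term is a weight in \<xi> centred at
      \<rho> k, of width \<rho>, times a weight in x centred at a(k) / \<rho>, of width 1.\<close>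
    define W where "W \<xi> x = \<tau> * C1 * (\<Sum>k\<in>S. w (\<xi> /\<^sub>R \<rho> - k) * w (x - a k /\<^sub>R \<rho>))" for \<xi> x
    have W0: "0 \<le> W \<xi> x" for \<xi> x unfolding W_def using \<tau> C1 by (auto intro!: mult_nonneg_nonneg sum_nonneg w0)
    have V: "?V \<xi> x \<le> W \<xi> x" for x \<xi>
    proof -
      have "stft \<phi> (dist_of (packet g \<rho> \<tau> S a)) x \<xi> = of_real \<tau> * (\<Sum>k\<in>S. cis ((\<rho> *\<^sub>R k - \<xi>) \<bullet> a k / \<rho>) *
          fourier (\<lambda>u. g u * cnj (\<phi> ((1 / \<rho>) *\<^sub>R u - (x - a k /\<^sub>R \<rho>)))) (\<xi> /\<^sub>R \<rho> - k))"
        using \<rho> by (intro stft_packet g \<phi> fin) simp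
      also have "norm \<dots> \<le> \<tau> * (\<Sum>k\<in>S. C1 * w (\<xi> /\<^sub>R \<rho> - k) * w (x - a k /\<^sub>R \<rho>))"
        unfolding norm_mult using \<tau> \<rho>
        by (intro mult_mono sum_norm_le) (auto simp: norm_mult simp del: times_divide_eq_right intro!: C1(2))
      also have "\<dots> = W \<xi> x" by (simp add: W_def sum_distrib_left mult_ac)
      finally show ?thesis .
    qed
    \<comment> \<open>For fixed \<xi> both the supremum and the integral of W over x are bounded by
      constants times \<open>U \<xi>\<close>, so every p gives the same size, wherever the positions
      are.\<close>
    have inner: "Lnorm p lborel (\<lambda>x. ennreal (?V \<xi> x))
      \<le> ennreal (\<tau> * C1 * (1 + I) powr recip p * U \<xi>)" for \<xi>
    proof -
      have i: "integrable lborel (\<lambda>x. w (\<xi> /\<^sub>R \<rho> - k) * w (x - a k /\<^sub>R \<rho>))"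
        and I': "(LINT x|lborel. w (\<xi> /\<^sub>R \<rho> - k) * w (x - a k /\<^sub>R \<rho>)) = w (\<xi> /\<^sub>R \<rho> - k) * I" for k
      proof -
        have "integrable lborel (\<lambda>x. w (x - a k /\<^sub>R \<rho>))" and I: "(LINT x|lborel. w (x - a k /\<^sub>R \<rho>)) = I"
          using integrable_lborel_affine[OF int, of 1 "- (a k /\<^sub>R \<rho>)"]
            integral_lborel_affine[OF int, of 1 "- (a k /\<^sub>R \<rho>)"]
          by (simp_all add: I_def)
        then show "integrable lborel (\<lambda>x. w (\<xi> /\<^sub>R \<rho> - k) * w (x - a k /\<^sub>R \<rho>))"
          by (intro integrable_mult_right)
        show "(LINT x|lborel. w (\<xi> /\<^sub>R \<rho> - k) * w (x - a k /\<^sub>R \<rho>)) = w (\<xi> /\<^sub>R \<rho> - k) * I"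
          by (simp only: integral_mult_right_zero I)
      qed
      have iW: "integrable lborel (W \<xi>)"
        unfolding W_def by (intro integrable_mult_right Bochner_Integration.integrable_sum i)
      have "(LINT x|lborel. W \<xi> x) = \<tau> * C1 * (\<Sum>k\<in>S. w (\<xi> /\<^sub>R \<rho> - k) * I)"
      proof -
        have "(LINT x|lborel. W \<xi> x) =
            \<tau> * C1 * (LINT x|lborel. (\<Sum>k\<in>S. w (\<xi> /\<^sub>R \<rho> - k) * w (x - a k /\<^sub>R \<rho>)))"
          by (simp only: W_def integral_mult_right_zero)
        then show ?thesis by (simp only: Bochner_Integration.integral_sum[OF i] I')
      qed
      also have "\<dots> = \<tau> * C1 * U \<xi> * I" by (simp only: U_def sum_distrib_right mult.assoc)
      finally have LW: "(LINT x|lborel. W \<xi> x) = \<tau> * C1 * U \<xi> * I" .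
      have "Lnorm p lborel (\<lambda>x. ennreal (?V \<xi> x))
        \<le> ennreal ((\<tau> * C1 * U \<xi>) powr (1 - recip p) * (\<tau> * C1 * U \<xi> * I) powr recip p)"
      proof (rule Lnorm_le_interpolation[OF p(1), where w = "\<lambda>x. ennreal (W \<xi> x)"])
        show "(\<lambda>x. ennreal (W \<xi> x)) \<in> borel_measurable lborel"
          using borel_measurable_integrable[OF iW] by measurable
        show "ennreal (?V \<xi> x) \<le> ennreal (W \<xi> x)" for x
          by (intro ennreal_leI V)
        show "ennreal (W \<xi> x) \<le> ennreal (\<tau> * C1 * U \<xi>)" for x
          unfolding W_def U_def using \<tau> C1(1) w0
          by (intro ennreal_leI mult_left_mono sum_mono mult_left_le) auto
        show "(\<integral>\<^sup>+x. ennreal (W \<xi> x) \<partial>lborel) \<le> ennreal (\<tau> * C1 * U \<xi> * I)"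
          using nn_integral_eq_integral[OF iW] W0 LW by simp
      \<comment> \<open>The finiteness of p discharges the premise on measurability of the transform
        in x.\<close>
      qed (use \<tau> C1 U I p in auto)
      also have "(\<tau> * C1 * U \<xi>) powr (1 - recip p) * (\<tau> * C1 * U \<xi> * I) powr recip p =
          ((\<tau> * C1 * U \<xi>) powr (1 - recip p) * (\<tau> * C1 * U \<xi>) powr recip p) * I powr recip p"
        using \<tau> C1 U I by (simp add: powr_mult)
      also have "(\<tau> * C1 * U \<xi>) powr (1 - recip p) * (\<tau> * C1 * U \<xi>) powr recip p = \<tau> * C1 * U \<xi>"
        using \<tau> C1 U[of \<xi>] by (cases "U \<xi> = 0") (auto simp flip: powr_add)
      also have "\<tau> * C1 * U \<xi> * I powr recip p \<le> \<tau> * C1 * U \<xi> * (1 + I) powr recip p"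
        using \<tau> C1 U[of \<xi>] I recip_bounds[OF p(1)] by (intro mult_left_mono powr_mono2) auto
      finally show ?thesis by (simp add: mult_ac ennreal_leI)
    qed
    let ?K = "\<tau> * C1 * (1 + I) powr recip p"
    have K: "0 < ?K" using \<tau> C1 I by simp
    have i: "integrable lborel (\<lambda>\<xi>. w (\<xi> /\<^sub>R \<rho> - k))"
      and I': "(LINT \<xi>|lborel. w (\<xi> /\<^sub>R \<rho> - k)) = \<rho> ^ CARD('n) * I" for k
      using integrable_lborel_affine[OF int, of "inverse \<rho>" "- k"]
        integral_lborel_affine[OF int, of "inverse \<rho>" "- k"] \<rho>
      by (simp_all add: I_def power_inverse)
    have iU: "integrable lborel U"
      unfolding U_def by (intro Bochner_Integration.integrable_sum i)
    \<comment> \<open>Each of the m weights has width \<rho> in frequency. Together with the uniform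
      bound C2 for U this gives the power 1/q of \<rho>^n m.\<close>
    have LU: "(LINT \<xi>|lborel. U \<xi>) = real (card S) * (\<rho> ^ CARD('n) * I)"
      unfolding U_def Bochner_Integration.integral_sum[OF i] I' by simp
    have "modulation_norm \<phi> p q (dist_of (packet g \<rho> \<tau> S a)) \<le>
       ennreal ((?K * C2) powr (1 - recip q) * (?K * (\<rho> ^ CARD('n) * real (card S) * (1 + I))) powr recip q)"
      unfolding modulation_norm_def
    proof (rule Lnorm_le_interpolation[OF q(1), where w = "\<lambda>\<xi>. ennreal (?K * U \<xi>)"])
      show "(\<lambda>\<xi>. ennreal (?K * U \<xi>)) \<in> borel_measurable lborel"
        using borel_measurable_integrable[OF iU] by measurable
      show "ennreal (?K * U \<xi>) \<le> ennreal (?K * C2)" for \<xi>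
        using U K by (intro ennreal_leI mult_left_mono) auto
      have "(\<integral>\<^sup>+\<xi>. ennreal (?K * U \<xi>) \<partial>lborel) = ennreal (LINT \<xi>|lborel. ?K * U \<xi>)"
        using K U by (intro nn_integral_eq_integral integrable_mult_right iU) auto
      also have "(LINT \<xi>|lborel. ?K * U \<xi>) = ?K * (real (card S) * (\<rho> ^ CARD('n) * I))"
        by (simp only: integral_mult_right_zero LU)
      also have "\<dots> \<le> ?K * (\<rho> ^ CARD('n) * real (card S) * (1 + I))"
        using K \<rho> by (intro mult_left_mono) (auto simp: algebra_simps)
      finally show "(\<integral>\<^sup>+\<xi>. ennreal (?K * U \<xi>) \<partial>lborel) \<le> ennreal (?K * (\<rho> ^ CARD('n) * real (card S) * (1 + I)))"
        by (simp add: ennreal_leI)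
    qed (use inner K C2 \<rho> I q in auto)
    also have "(?K * C2) powr (1 - recip q) * (?K * (\<rho> ^ CARD('n) * real (card S) * (1 + I))) powr recip q =
      (?K powr (1 - recip q) * ?K powr recip q) * (C2 powr (1 - recip q) * (1 + I) powr recip q) * (\<rho> ^ CARD('n) * real (card S)) powr recip q"
      using K C2 \<rho> I by (simp add: powr_mult mult_ac)
    also have "?K powr (1 - recip q) * ?K powr recip q = ?K"
      using K by (simp flip: powr_add)
    finally show "modulation_norm \<phi> p q (dist_of (packet g \<rho> \<tau> S a)) \<le>
        ennreal (\<tau> * C * (\<rho> ^ CARD('n) * real (card S)) powr recip q)"
      by (simp add: C_def mult_ac)
  qed
qed

text \<open>Where x is \<epsilon>-close to a(k) / \<rho> + x0 and \<xi> is \<epsilon> \<rho>-close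
  to \<rho> k, the k-th term has modulus at least c. The spacing makes each other term at most c /
  (2 m), so all of them together cancel at most half of it.\<close>

lemma packet_modulation_norm_ge:
  fixes g \<phi> :: "real^'n::finite \<Rightarrow> complex"
  assumes g: "g \<in> schwartz" and \<phi>: "\<phi> \<in> schwartz" and \<phi>0: "\<phi> \<noteq> (\<lambda>x. 0)" and g0: "fourier g 0 \<noteq> 0"
    and p: "1 \<le> p" and q: "1 \<le> q"
  shows "\<exists>C>0. \<exists>D>0. \<exists>\<rho>\<^sub>0\<ge>1. \<forall>\<rho> \<tau> S a. \<rho>\<^sub>0 \<le> \<rho> \<longrightarrow> 0 < \<tau> \<longrightarrow> separated S \<longrightarrow>
      dispersed (\<rho> * (D * real (card S))) S a \<longrightarrow>
      ennreal (\<tau> * C * (\<rho> ^ CARD('n) * real (card S)) powr recip q)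
        \<le> modulation_norm \<phi> p q (dist_of (packet g \<rho> \<tau> S a))"
proof -
  obtain y where "\<phi> y \<noteq> 0" using \<phi>0 by auto
  define x0 where "x0 = - y"
  have x0: "cnj (\<phi> (- x0)) \<noteq> 0" using \<open>\<phi> y \<noteq> 0\<close> by (simp add: x0_def)
  obtain c \<epsilon> where c: "0 < c" and \<epsilon>: "0 < \<epsilon>" "\<epsilon> < 1/2"
    and lower: "\<And>\<mu> x \<xi>. 0 < \<mu> \<Longrightarrow> \<mu> \<le> \<epsilon> \<Longrightarrow> norm (x - x0) < \<epsilon> \<Longrightarrow> norm \<xi> < \<epsilon> \<Longrightarrow>
      c \<le> norm (fourier (\<lambda>u. g u * cnj (\<phi> (\<mu> *\<^sub>R u - x))) \<xi>)"
    using windowed_fourier_lower_bound[OF g schwartz_cnj[OF \<phi>] x0 g0] by blast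
  obtain C1 where C1: "0 < C1" "\<And>\<mu> x \<xi>. 0 < \<mu> \<Longrightarrow> \<mu> \<le> 1 \<Longrightarrow>
    norm (fourier (\<lambda>u. g u * cnj (\<phi> (\<mu> *\<^sub>R u - x))) \<xi>) \<le> C1 * (1 / (1 + norm \<xi>) ^ 0) * (1 / (1 + norm x) ^ 1)"
    using windowed_fourier_bound[OF g schwartz_cnj[OF \<phi>], of 0 1] by blast
  define v where "v = \<epsilon> ^ CARD('n) * measure lborel (ball (0::real^'n) 1)"
  have v: "0 < v" unfolding v_def using \<epsilon> by (intro mult_pos_pos content_ball_pos) auto
  \<comment> \<open>In the spacing D m between centres, the part \<open>norm x0 + 1\<close> pays for
    the distance of x from its own centre. The part \<open>2 * C1 / c\<close> makes the decay C1 /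
    (1 + distance) at most c / (2 m) at the other centres.\<close>
  define D where "D = norm x0 + 1 + 2 * C1 / c"
  define C where "C = (c / 2) * v powr recip p * v powr recip q"
  have C: "0 < C" using c v by (simp add: C_def)
  have D: "0 < D" using c C1 by (simp add: D_def add_pos_nonneg add_nonneg_pos)
  show ?thesis
  \<comment> \<open>The threshold 1 / \<epsilon> for \<rho> says exactly that the dilation 1 /
    \<rho> of the window is at most \<epsilon>.\<close>
  proof (rule exI[of _ C], rule conjI[OF C], rule exI[of _ D], rule conjI[OF D], rule exI[of _ "1 / \<epsilon>"], intro conjI allI impI)
    show "1 \<le> 1 / \<epsilon>" using \<epsilon> by simp
    fix \<rho> \<tau> :: real and S :: "(real^'n) set" and a :: "real^'n \<Rightarrow> real^'n"
    assume \<rho>\<epsilon>: "1 / \<epsilon> \<le> \<rho>" and \<tau>: "0 < \<tau>" and S: "separated S"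
      and far: "dispersed (\<rho> * (D * real (card S))) S a"
    have fin: "finite S" using S by (simp add: separated_def)
    have m: "1 \<le> real (card S)" using separated_card_pos[OF S] by simp
    have \<rho>: "1 \<le> \<rho>" using \<rho>\<epsilon> \<open>1 \<le> 1 / \<epsilon>\<close> by linarith
    have \<mu>: "0 < 1 / \<rho>" "1 / \<rho> \<le> \<epsilon>" "1 / \<rho> \<le> 1"
      using \<rho> \<rho>\<epsilon> \<epsilon> by (auto simp: field_simps)
    let ?V = "\<lambda>x \<xi>. norm (stft \<phi> (dist_of (packet g \<rho> \<tau> S a)) x \<xi>)"
    let ?W = "\<lambda>k x \<xi>. fourier (\<lambda>u. g u * cnj (\<phi> ((1 / \<rho>) *\<^sub>R u - (x - a k /\<^sub>R \<rho>)))) (\<xi> /\<^sub>R \<rho> - k)"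
    have V: "\<tau> * (c / 2) \<le> ?V x \<xi>"
      if k: "k \<in> S" and x: "norm (x - a k /\<^sub>R \<rho> - x0) < \<epsilon>" and \<xi>: "norm (\<xi> /\<^sub>R \<rho> - k) < \<epsilon>" for k x \<xi>
    proof -
      let ?s = "\<lambda>k. cis ((\<rho> *\<^sub>R k - \<xi>) \<bullet> a k / \<rho>) * ?W k x \<xi>"
      have "stft \<phi> (dist_of (packet g \<rho> \<tau> S a)) x \<xi> = of_real \<tau> * (\<Sum>k\<in>S. ?s k)"
        using \<rho> by (intro stft_packet g \<phi> fin) simp
      then have Veq: "?V x \<xi> = \<tau> * norm (?s k + (\<Sum>l\<in>S - {k}. ?s l))"
        using \<tau> by (simp add: norm_mult sum.remove[OF fin k])
      have main: "c \<le> norm (?s k)"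
        using lower[OF \<mu>(1,2) x \<xi>] by (simp add: norm_mult)
      have rest: "norm (?s l) \<le> c / (2 * real (card S))" if l: "l \<in> S - {k}" for l
      proof -
        have "\<rho> * (D * real (card S)) \<le> dist (a k) (a l)" using dispersedD[OF far, of k l] k l by auto
        then have "D * real (card S) \<le> norm (a k - a l) / \<rho>"
          using \<rho> by (simp add: pos_le_divide_eq dist_norm mult.commute)
        also have "\<dots> = norm (a k /\<^sub>R \<rho> - a l /\<^sub>R \<rho>)"
          using \<rho> by (simp flip: scaleR_diff_right) (simp add: divide_inverse mult.commute)
        also have "\<dots> \<le> norm (x - a l /\<^sub>R \<rho>) + norm (x - a k /\<^sub>R \<rho>)"
          using norm_triangle_ineq4[of "x - a l /\<^sub>R \<rho>" "x - a k /\<^sub>R \<rho>"] by simp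
        also have "norm (x - a k /\<^sub>R \<rho>) \<le> norm x0 + 1"
          using norm_triangle_ineq[of "x - a k /\<^sub>R \<rho> - x0" x0] x \<epsilon> by simp
        finally have 1: "D * real (card S) \<le> norm (x - a l /\<^sub>R \<rho>) + (norm x0 + 1)" by simp
        have "(norm x0 + 1) * 1 \<le> (norm x0 + 1) * real (card S)"
          using m by (intro mult_left_mono) auto
        then have "(norm x0 + 1) + 2 * C1 / c * real (card S) \<le> D * real (card S)"
          unfolding D_def distrib_right[of "norm x0 + 1"] by simp
        with 1 have 2: "2 * C1 / c * real (card S) \<le> norm (x - a l /\<^sub>R \<rho>)" by linarith
        have "norm (?s l) \<le> C1 / (1 + norm (x - a l /\<^sub>R \<rho>))"
          using C1(2)[OF \<mu>(1,3), of "x - a l /\<^sub>R \<rho>" "\<xi> /\<^sub>R \<rho> - l"] by (simp add: norm_mult)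
        also have "\<dots> \<le> C1 / (2 * C1 / c * real (card S))"
          using 2 C1(1) c m by (intro divide_left_mono mult_pos_pos) (auto simp: one_plus_norm_pos)
        also have "\<dots> = c / (2 * real (card S))" using C1(1) by simp
        finally show ?thesis .
      qed
      have "norm (\<Sum>l\<in>S - {k}. ?s l) \<le> (\<Sum>l\<in>S - {k}. c / (2 * real (card S)))"
        by (rule sum_norm_le) (rule rest)
      also have "\<dots> \<le> (\<Sum>l\<in>S. c / (2 * real (card S)))"
        using fin c by (intro sum_mono2) auto
      also have "\<dots> = c / 2" using m by simp
      finally have "c / 2 \<le> norm (?s k + (\<Sum>l\<in>S - {k}. ?s l))"
        using main norm_triangle_ineq4[of "?s k + (\<Sum>l\<in>S - {k}. ?s l)" "\<Sum>l\<in>S - {k}. ?s l"] by simp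
      then show ?thesis unfolding Veq using \<tau> by (intro mult_left_mono) auto
    qed
    have em: "emeasure lborel (ball x (\<epsilon> * r)) = ennreal (r ^ CARD('n) * v)" if "0 < r" for r and x :: "real^'n"
    proof -
      have "measure lborel (ball x (\<epsilon> * r)) = r ^ CARD('n) * v"
        using content_ball_conv_unit_ball[of "\<epsilon> * r" x] that \<epsilon> by (simp add: v_def power_mult_distrib)
      then show ?thesis
        using emeasure_lborel_ball_finite[of x "\<epsilon> * r"] by (simp add: emeasure_eq_ennreal_measure top.not_eq_extremum)
    qed
    \<comment> \<open>The centres \<rho> k are \<rho>-separated and \<epsilon> < 1/2, so these balls
      are disjoint and E has measure m \<rho>^n v.\<close>
    define E where "E = (\<Union>k\<in>S. ball (\<rho> *\<^sub>R k) (\<epsilon> * \<rho>))"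
    have inner: "ennreal (\<tau> * (c / 2) * v powr recip p) \<le> Lnorm p lborel (\<lambda>x. ennreal (?V x \<xi>))" if \<xi>E: "\<xi> \<in> E" for \<xi>
    proof -
      obtain k where k: "k \<in> S" "\<xi> \<in> ball (\<rho> *\<^sub>R k) (\<epsilon> * \<rho>)" using \<xi>E by (auto simp: E_def)
      have eq: "\<xi> /\<^sub>R \<rho> - k = (\<xi> - \<rho> *\<^sub>R k) /\<^sub>R \<rho>" using \<rho> by (simp add: scaleR_diff_right)
      have "norm (\<xi> /\<^sub>R \<rho> - k) = norm (\<xi> - \<rho> *\<^sub>R k) / \<rho>"
        unfolding eq using \<rho> by (simp add: divide_inverse mult.commute)
      then have \<xi>: "norm (\<xi> /\<^sub>R \<rho> - k) < \<epsilon>"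
        using k(2) \<rho> by (simp add: dist_norm norm_minus_commute pos_divide_less_eq)
      show ?thesis
      proof (rule Lnorm_ge[OF p, where E = "ball (a k /\<^sub>R \<rho> + x0) (\<epsilon> * 1)"])
        show "emeasure lborel (ball (a k /\<^sub>R \<rho> + x0) (\<epsilon> * 1)) = ennreal v"
          using em[of 1] by simp
        fix x assume "x \<in> ball (a k /\<^sub>R \<rho> + x0) (\<epsilon> * 1)"
        then have "norm (x - a k /\<^sub>R \<rho> - x0) < \<epsilon>"
          by (simp add: dist_norm norm_minus_commute algebra_simps)
        then show "ennreal (\<tau> * (c / 2)) \<le> ennreal (?V x \<xi>)"
          by (intro ennreal_leI V[OF k(1) _ \<xi>])
      qed (use v \<tau> c in auto)
    qed
    have disj: "disjoint_family_on (\<lambda>k. ball (\<rho> *\<^sub>R k) (\<epsilon> * \<rho>)) S"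
      unfolding disjoint_family_on_def
    proof (intro ballI impI)
      fix k l assume kl: "k \<in> S" "l \<in> S" "k \<noteq> l"
      have "\<rho> * 1 \<le> \<rho> * dist k l"
        using S kl \<rho> by (intro mult_left_mono) (auto simp: separated_def)
      also have "\<dots> = dist (\<rho> *\<^sub>R k) (\<rho> *\<^sub>R l)"
        using \<rho> by (simp add: dist_norm flip: scaleR_diff_right)
      finally have *: "\<rho> \<le> dist (\<rho> *\<^sub>R k) (\<rho> *\<^sub>R l)" by simp
      show "ball (\<rho> *\<^sub>R k) (\<epsilon> * \<rho>) \<inter> ball (\<rho> *\<^sub>R l) (\<epsilon> * \<rho>) = {}"
      proof (rule equals0I)
        fix z assume "z \<in> ball (\<rho> *\<^sub>R k) (\<epsilon> * \<rho>) \<inter> ball (\<rho> *\<^sub>R l) (\<epsilon> * \<rho>)"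
        then have "dist (\<rho> *\<^sub>R k) z < \<epsilon> * \<rho>" "dist (\<rho> *\<^sub>R l) z < \<epsilon> * \<rho>" by auto
        moreover have "\<epsilon> * \<rho> \<le> 1/2 * \<rho>" using \<epsilon> \<rho> by (intro mult_right_mono) auto
        ultimately show False using dist_triangle2[of "\<rho> *\<^sub>R k" "\<rho> *\<^sub>R l" z] * by linarith
      qed
    qed
    have Em: "E \<in> sets lborel"
      unfolding E_def sets_lborel by (intro borel_open open_UN ballI open_ball)
    have "emeasure lborel E = (\<Sum>k\<in>S. emeasure lborel (ball (\<rho> *\<^sub>R k) (\<epsilon> * \<rho>)))"
      unfolding E_def by (rule sum_emeasure[symmetric]) (use disj fin in auto)
    also have "\<dots> = ennreal (real (card S) * (\<rho> ^ CARD('n) * v))"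
      using \<rho> v by (simp add: em ennreal_of_nat_eq_real_of_nat flip: ennreal_mult)
    finally have "ennreal (\<tau> * (c / 2) * v powr recip p * (real (card S) * (\<rho> ^ CARD('n) * v)) powr recip q)
        \<le> modulation_norm \<phi> p q (dist_of (packet g \<rho> \<tau> S a))"
      unfolding modulation_norm_def using inner \<rho> v m \<tau> c Em
      by (intro Lnorm_ge[OF q, where E = E]) auto
    also have "\<tau> * (c / 2) * v powr recip p * (real (card S) * (\<rho> ^ CARD('n) * v)) powr recip q =
        \<tau> * C * (\<rho> ^ CARD('n) * real (card S)) powr recip q"
      using \<rho> v m by (simp add: C_def powr_mult mult_ac)
    finally show "ennreal (\<tau> * C * (\<rho> ^ CARD('n) * real (card S)) powr recip q)
        \<le> modulation_norm \<phi> p q (dist_of (packet g \<rho> \<tau> S a))" .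
  qed
qed

section \<open>Band-limited profiles and Besov norms of wave packets\<close>

lemma dyadic_partition_zero:
  fixes \<eta> \<psi> :: "real^'n::finite \<Rightarrow> complex"
  assumes dp: "dyadic_partition \<eta> \<psi>"
  shows "\<eta> 0 = 1"
proof -
  have "\<psi> 0 = 0"
    using dp closure_subset[of "{\<xi>. \<psi> \<xi> \<noteq> 0}"] by (auto simp: dyadic_partition_def)
  then have "(\<lambda>j. \<psi> (0 /\<^sub>R 2 ^ Suc j)) = (\<lambda>j. 0)" by simp
  moreover have "(\<lambda>j. \<psi> (0 /\<^sub>R 2 ^ Suc j)) sums (1 - \<eta> 0)"
    using dp unfolding dyadic_partition_def by blast
  ultimately have "(\<lambda>j. 0) sums (1 - \<eta> 0)" by (simp only:)
  then show ?thesis using sums_unique2[OF _ sums_zero] by fastforce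
qed

text \<open>The partition of unity already contains a bump function: \<eta> is 1 at the origin and
  vanishes beyond radius 2. Dilated by 4 / r it lives in the ball of radius r/2, and its inverse
  transform is the profile.\<close>

lemma band_limited_bump:
  fixes \<eta> \<psi> :: "real^'n::finite \<Rightarrow> complex"
  assumes dp: "dyadic_partition \<eta> \<psi>" and r: "0 < r"
  obtains g :: "real^'n \<Rightarrow> complex" where "g \<in> schwartz" "fourier g 0 \<noteq> 0" "\<And>\<xi>. fourier g \<xi> \<noteq> 0 \<Longrightarrow> norm \<xi> < r"
proof -
  define \<kappa> where "\<kappa> \<xi> = \<eta> ((4 / r) *\<^sub>R \<xi> + 0)" for \<xi>
  have \<kappa>: "\<kappa> \<in> schwartz"
    unfolding \<kappa>_def using dp r by (intro schwartz_affine) (auto simp: dyadic_partition_def)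
  have F: "fourier (inv_fourier \<kappa>) = \<kappa>"
    by (intro ext fourier_inv_fourier \<kappa>)
  show ?thesis
  proof (rule that[of "inv_fourier \<kappa>"])
    show "inv_fourier \<kappa> \<in> schwartz" by (rule schwartz_inv_fourier[OF \<kappa>])
    show "fourier (inv_fourier \<kappa>) 0 \<noteq> 0"
      unfolding F using dyadic_partition_zero[OF dp] by (simp add: \<kappa>_def)
    fix \<xi> assume "fourier (inv_fourier \<kappa>) \<xi> \<noteq> 0"
    then have "\<eta> ((4 / r) *\<^sub>R \<xi>) \<noteq> 0" unfolding F by (simp add: \<kappa>_def)
    then have "norm ((4 / r) *\<^sub>R \<xi>) \<le> 2"
      using dp closure_subset[of "{\<xi>. \<eta> \<xi> \<noteq> 0}"] unfolding dyadic_partition_def by blast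
    then show "norm \<xi> < r" using r by (simp add: field_simps)
  qed
qed

text \<open>The balls of radius r \<le> 1/2 about 1-separated points are disjoint, so at each \<xi>
  at most one term is nonzero; its phase, and with it the position a(k), disappears in the
  modulus.\<close>

lemma norm_fourier_packet_square:
  fixes g :: "real^'n::finite \<Rightarrow> complex"
  assumes g: "g \<in> schwartz" and supp: "\<And>\<xi>. fourier g \<xi> \<noteq> 0 \<Longrightarrow> norm \<xi> < r" and r: "r \<le> 1/2"
    and S: "separated S" and \<rho>: "0 < \<rho>"
  shows "(norm (fourier (packet g \<rho> \<tau> S a) \<xi>))\<^sup>2 = \<tau>\<^sup>2 * (\<Sum>k\<in>S. (norm (fourier g (\<xi> /\<^sub>R \<rho> - k)))\<^sup>2)"
proof -
  have fin: "finite S" using S by (simp add: separated_def)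
  let ?F = "\<lambda>k. fourier g (\<xi> /\<^sub>R \<rho> - k)"
  let ?c = "\<lambda>k. cis ((\<rho> *\<^sub>R k - \<xi>) \<bullet> a k / \<rho>)"
  have "(norm (\<Sum>k\<in>S. ?c k * ?F k))\<^sup>2 = (\<Sum>k\<in>S. (norm (?F k))\<^sup>2)"
  proof (cases "\<exists>k\<in>S. ?F k \<noteq> 0")
    case True
    then obtain k where k: "k \<in> S" "?F k \<noteq> 0" by blast
    have z: "?F l = 0" if l: "l \<in> S - {k}" for l
    proof (rule ccontr)
      assume "?F l \<noteq> 0"
      then have "norm (\<xi> /\<^sub>R \<rho> - l) < r" by (rule supp)
      moreover have "norm (\<xi> /\<^sub>R \<rho> - k) < r" using k(2) by (rule supp)
      moreover have "1 \<le> dist l k" using S l k by (auto simp: separated_def)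
      moreover have "dist l k \<le> dist l (\<xi> /\<^sub>R \<rho>) + dist k (\<xi> /\<^sub>R \<rho>)"
        by (rule dist_triangle2)
      ultimately show False using r by (simp add: dist_norm norm_minus_commute)
    qed
    have "(\<Sum>k\<in>S. ?c k * ?F k) = ?c k * ?F k"
      using z by (subst sum.remove[OF fin k(1)]) (auto intro!: sum.neutral)
    moreover have "(\<Sum>k\<in>S. (norm (?F k))\<^sup>2) = (norm (?F k))\<^sup>2"
      using z by (subst sum.remove[OF fin k(1)]) (auto intro!: sum.neutral)
    ultimately show ?thesis by (simp add: norm_mult)
  qed (simp cong: sum.cong)
  then show ?thesis
    by (simp add: fourier_packet[OF g \<rho>] norm_mult power_mult_distrib)
qed

text \<open>Admissibility places the frequencies of the packet with dilation \<rho> and frequency set S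
  in the part of the j-th dyadic annulus where the j-th member of the partition of unity is
  bounded below.\<close>

definition admissible :: "real \<Rightarrow> real \<Rightarrow> real^'n::finite \<Rightarrow> real \<Rightarrow> (real^'n) set \<Rightarrow> nat \<Rightarrow> bool" where
  "admissible r \<delta> e \<rho> S j \<longleftrightarrow> separated S \<and> 1 \<le> j \<and> 1 \<le> \<rho> \<and>
     (\<forall>k\<in>S. \<forall>\<omega>. norm (\<omega> /\<^sub>R \<rho> - k) < r \<longrightarrow> dist (\<omega> /\<^sub>R 2 ^ j) e < \<delta>)"

lemma fourier_packet_nonzero:
  fixes g :: "real^'n::finite \<Rightarrow> complex"
  assumes g: "g \<in> schwartz" and supp: "\<And>\<xi>. fourier g \<xi> \<noteq> 0 \<Longrightarrow> norm \<xi> < r"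
    and adm: "admissible r \<delta> e \<rho> S j" and nz: "fourier (packet g \<rho> \<tau> S a) \<xi> \<noteq> 0"
  shows "dist (\<xi> /\<^sub>R 2 ^ j) e < \<delta>"
proof -
  have S: "finite S" "0 < \<rho>" using adm by (auto simp: admissible_def separated_def)
  have "\<exists>k\<in>S. fourier g (\<xi> /\<^sub>R \<rho> - k) \<noteq> 0"
  proof (rule ccontr)
    assume "\<not> (\<exists>k\<in>S. fourier g (\<xi> /\<^sub>R \<rho> - k) \<noteq> 0)"
    then have "(\<Sum>k\<in>S. cis ((\<rho> *\<^sub>R k - \<xi>) \<bullet> a k / \<rho>) * fourier g (\<xi> /\<^sub>R \<rho> - k)) = 0"
      by (intro sum.neutral) auto
    then show False using nz by (simp add: fourier_packet[OF g S(2)])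
  qed
  then show ?thesis using supp adm unfolding admissible_def by blast
qed

lemma packet_besov_norm_le:
  fixes g \<eta> \<psi> :: "real^'n::finite \<Rightarrow> complex"
  assumes dp: "dyadic_partition \<eta> \<psi>" and p: "1 \<le> p" and q: "1 \<le> q"
    and g: "g \<in> schwartz" and supp: "\<And>\<xi>. fourier g \<xi> \<noteq> 0 \<Longrightarrow> norm \<xi> < r"
    and e: "norm e = 1" and \<delta>: "\<delta> \<le> 1/4"
  shows "\<exists>C>0. \<forall>\<rho> \<tau> S a j. admissible r \<delta> e \<rho> S j \<longrightarrow> 0 < \<tau> \<longrightarrow>
      dispersed (2 * real (card S)) S a \<longrightarrow>
      besov_norm \<eta> \<psi> p q s (dist_of (packet g \<rho> \<tau> S a)) \<le>
        ennreal (\<tau> * C * (2 powr (real j * s) * ((\<rho> ^ CARD('n)) powr (1 - recip p) * real (card S) powr recip p)))"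
proof -
  obtain k where k: "0 < k" "\<And>i. (LINT x|lborel. norm (inv_fourier (dyadic \<eta> \<psi> i) x)) \<le> k"
    using dyadic_kernel_bound[OF dp] by blast
  obtain C1 where C1: "0 < C1"
    and sup: "\<And>\<rho> \<tau> S a t. 1 \<le> \<rho> \<Longrightarrow> 0 < \<tau> \<Longrightarrow> separated S \<Longrightarrow>
      dispersed (2 * real (card S)) S a \<Longrightarrow>
      norm (packet g \<rho> \<tau> S a t) \<le> \<tau> * C1 * \<rho> ^ CARD('n)"
    and L1: "\<And>\<rho> \<tau> S a. 1 \<le> \<rho> \<Longrightarrow> 0 < \<tau> \<Longrightarrow> separated S \<Longrightarrow>
      (LINT t|lborel. norm (packet g \<rho> \<tau> S a t)) \<le> \<tau> * C1 * real (card S)"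
    using packet_size[OF g] by metis
  show ?thesis
  proof (intro exI[of _ "3 * k * 2 powr \<bar>s\<bar> * C1"] conjI allI impI)
    show "0 < 3 * k * 2 powr \<bar>s\<bar> * C1" using k C1 by simp
    fix \<rho> \<tau> :: real and S :: "(real^'n) set" and a :: "real^'n \<Rightarrow> real^'n" and j :: nat
    assume adm: "admissible r \<delta> e \<rho> S j" and \<tau>: "0 < \<tau>"
      and far: "dispersed (2 * real (card S)) S a"
    have \<rho>: "1 \<le> \<rho>" and S: "separated S" and fin: "finite S"
      using adm by (auto simp: admissible_def separated_def)
    have m: "0 < real (card S)" by (rule separated_card_pos[OF S])
    have band: "2 ^ j < 2 * norm \<xi> \<and> norm \<xi> < 2 * 2 ^ j" if nz: "fourier (packet g \<rho> \<tau> S a) \<xi> \<noteq> 0" for \<xi>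
    proof -
      \<comment> \<open>With |e| = 1 this puts |\<xi>| / 2^j between 3/4 and 5/4, well within the
        band required by \<open>besov_norm_le\<close>.\<close>
      have d: "norm (\<xi> /\<^sub>R 2 ^ j - e) < 1/4"
        using fourier_packet_nonzero[OF g supp adm nz] \<delta> by (simp add: dist_norm)
      have "norm (\<xi> /\<^sub>R 2 ^ j) = norm \<xi> / 2 ^ j" by (simp add: divide_inverse mult.commute)
      moreover have "norm (\<xi> /\<^sub>R 2 ^ j) \<le> norm (\<xi> /\<^sub>R 2 ^ j - e) + norm e"
        using norm_triangle_ineq[of "\<xi> /\<^sub>R 2 ^ j - e" e] by simp
      moreover have "norm e \<le> norm (\<xi> /\<^sub>R 2 ^ j - e) + norm (\<xi> /\<^sub>R 2 ^ j)"
        using norm_triangle_ineq4[of "\<xi> /\<^sub>R 2 ^ j" "\<xi> /\<^sub>R 2 ^ j - e"] by simp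
      ultimately have "norm \<xi> / 2 ^ j < 2" "1 < 2 * (norm \<xi> / 2 ^ j)"
        using d e by linarith+
      then show ?thesis by (simp add: field_simps)
    qed
    let ?A = "\<tau> * C1 * \<rho> ^ CARD('n)" and ?B = "\<tau> * C1 * real (card S)"
    have "besov_norm \<eta> \<psi> p q s (dist_of (packet g \<rho> \<tau> S a)) \<le>
      ennreal (3 * k * 2 powr \<bar>s\<bar> * (2 powr (real j * s) * (?A powr (1 - recip p) * ?B powr recip p)))"
      using \<tau> C1 \<rho> m fin
      by (intro besov_norm_le[OF dp p q _ k] schwartz_packet g sup[OF \<rho> \<tau> S far] L1[OF \<rho> \<tau> S] band) auto
    \<comment> \<open>The common factor \<tau> C1 of both bounds comes out with total exponent 1, so
      the estimate is linear in \<tau>.\<close>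
    also have "?A powr (1 - recip p) * ?B powr recip p =
      ((\<tau> * C1) powr (1 - recip p) * (\<tau> * C1) powr recip p) * ((\<rho> ^ CARD('n)) powr (1 - recip p) * real (card S) powr recip p)"
      using \<tau> C1 \<rho> by (subst (1 2) powr_mult) (auto simp: mult_ac)
    also have "(\<tau> * C1) powr (1 - recip p) * (\<tau> * C1) powr recip p = \<tau> * C1"
      using \<tau> C1 by (simp flip: powr_add)
    finally show "besov_norm \<eta> \<psi> p q s (dist_of (packet g \<rho> \<tau> S a)) \<le>
        ennreal (\<tau> * (3 * k * 2 powr \<bar>s\<bar> * C1) * (2 powr (real j * s) * ((\<rho> ^ CARD('n)) powr (1 - recip p) * real (card S) powr recip p)))"
      by (simp add: mult_ac)
  qed
qed

lemma integrable_norm_square: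
  assumes "G \<in> schwartz"
  shows "integrable lborel (\<lambda>x. (norm (G x))\<^sup>2)"
proof -
  have "integrable lborel (\<lambda>x. G x * cnj (G x))"
    by (intro schwartz_integrable schwartz_mult schwartz_cnj assms)
  then have "integrable lborel (\<lambda>x. Re (complex_of_real ((norm (G x))\<^sup>2)))"
    unfolding complex_norm_square by (rule integrable_Re)
  then show ?thesis by (simp only: Re_complex_of_real)
qed

lemma integral_norm_square_pos:
  fixes G :: "real^'n::finite \<Rightarrow> complex"
  assumes G: "G \<in> schwartz" and nz: "G x\<^sub>0 \<noteq> 0"
  shows "0 < (LINT x|lborel. (norm (G x))\<^sup>2)"
proof -
  let ?c = "norm (G x\<^sub>0) / 2"
  have c: "0 < ?c" using nz by simp
  have "isCont G x\<^sub>0"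
    using schwartz_continuous[OF G] by (simp add: continuous_on_eq_continuous_at)
  then obtain d where d: "0 < d" "\<And>x. dist x x\<^sub>0 < d \<Longrightarrow> dist (G x) (G x\<^sub>0) < ?c"
    unfolding continuous_at_eps_delta using c by blast
  have G_ge: "?c \<le> norm (G x)" if x: "x \<in> ball x\<^sub>0 d" for x
    using d(2)[of x] x norm_triangle_ineq2[of "G x\<^sub>0" "G x"]
    by (simp add: dist_norm norm_minus_commute)
  have "0 < ?c\<^sup>2 * measure lborel (ball x\<^sub>0 d)"
    using c d(1) by (intro mult_pos_pos content_ball_pos) auto
  also have "\<dots> = (LINT x|lborel. ?c\<^sup>2 * indicat_real (ball x\<^sub>0 d) x)"
    by simp
  also have "\<dots> \<le> (LINT x|lborel. (norm (G x))\<^sup>2)"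
  proof (rule integral_mono)
    show "integrable lborel (\<lambda>x. ?c\<^sup>2 * indicat_real (ball x\<^sub>0 d) x)"
      using emeasure_lborel_ball_finite[of x\<^sub>0 d]
      by (intro integrable_mult_right integrable_real_indicator) auto
    show "?c\<^sup>2 * indicat_real (ball x\<^sub>0 d) x \<le> (norm (G x))\<^sup>2" for x
      using power_mono[OF G_ge less_imp_le[OF c], of x 2] by (auto simp: indicator_def)
  qed (rule integrable_norm_square[OF G])
  finally show ?thesis .
qed

text \<open>The pairing is at least of order \<tau>^2 m \<rho>^n. The dual normalization divides it
  by (\<tau> \<rho>^n)^(1/p) (\<tau> m)^(1 - 1/p), up to constants. The quotient \<tau> \<rho>^(n(1
  - 1/p)) m^(1/p) has the order of the upper bound.\<close>

lemma packet_besov_norm_ge: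
  fixes g \<eta> \<psi> :: "real^'n::finite \<Rightarrow> complex"
  assumes dp: "dyadic_partition \<eta> \<psi>" and p: "1 \<le> p" "p < \<infinity>" and q: "1 \<le> q"
    and g: "g \<in> schwartz" and supp: "\<And>\<xi>. fourier g \<xi> \<noteq> 0 \<Longrightarrow> norm \<xi> < r" and r: "r \<le> 1/2"
    and g0: "fourier g 0 \<noteq> 0"
    and \<psi>: "\<And>\<xi>. dist \<xi> e < \<delta> \<Longrightarrow> 1/2 \<le> Re (\<psi> \<xi>)"
  shows "\<exists>C>0. \<forall>\<rho> \<tau> S a j. admissible r \<delta> e \<rho> S j \<longrightarrow> 0 < \<tau> \<longrightarrow>
      dispersed (2 * real (card S)) S a \<longrightarrow>
      ennreal (\<tau> * C * (2 powr (real j * s) * ((\<rho> ^ CARD('n)) powr (1 - recip p) * real (card S) powr recip p)))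
      \<le> besov_norm \<eta> \<psi> p q s (dist_of (packet g \<rho> \<tau> S a))"
proof -
  obtain C1 where C1: "0 < C1"
    and sup: "\<And>\<rho> \<tau> S a t. 1 \<le> \<rho> \<Longrightarrow> 0 < \<tau> \<Longrightarrow> separated S \<Longrightarrow>
      dispersed (2 * real (card S)) S a \<Longrightarrow>
      norm (packet g \<rho> \<tau> S a t) \<le> \<tau> * C1 * \<rho> ^ CARD('n)"
    and L1: "\<And>\<rho> \<tau> S a. 1 \<le> \<rho> \<Longrightarrow> 0 < \<tau> \<Longrightarrow> separated S \<Longrightarrow>
      (LINT t|lborel. norm (packet g \<rho> \<tau> S a t)) \<le> \<tau> * C1 * real (card S)"
    using packet_size[OF g] by metis
  define J where "J = (LINT \<xi>|lborel. (norm (fourier g \<xi>))\<^sup>2)"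
  have J: "0 < J" unfolding J_def by (rule integral_norm_square_pos[OF schwartz_fourier[OF g] g0])
  define C where "C = J / 2 / (2 * pi) ^ CARD('n) / (2 * C1)"
  have C: "0 < C" using J C1 by (simp add: C_def)
  show ?thesis
  proof (rule exI[of _ C], intro conjI allI impI C)
    fix \<rho> \<tau> :: real and S :: "(real^'n) set" and a :: "real^'n \<Rightarrow> real^'n" and j :: nat
    assume adm: "admissible r \<delta> e \<rho> S j" and \<tau>: "0 < \<tau>"
      and far: "dispersed (2 * real (card S)) S a"
    have \<rho>: "1 \<le> \<rho>" and S: "separated S" and fin: "finite S" and j: "1 \<le> j"
      using adm by (auto simp: admissible_def separated_def)
    have m: "0 < real (card S)" by (rule separated_card_pos[OF S])
    have \<rho>0: "0 < \<rho>" using \<rho> by simp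
    let ?f = "packet g \<rho> \<tau> S a"
    have f: "?f \<in> schwartz" using \<rho> by (intro schwartz_packet g fin) simp
    let ?A = "\<tau> * C1 * \<rho> ^ CARD('n)" and ?B = "\<tau> * C1 * real (card S)"
    let ?D = "\<tau>\<^sup>2 * (real (card S) * (\<rho> ^ CARD('n) * J)) / 2"
    let ?h = "\<lambda>\<xi>. dyadic \<eta> \<psi> j \<xi> * of_real ((norm (fourier ?f \<xi>))\<^sup>2)"
    have ig: "integrable lborel (\<lambda>\<xi>. (norm (fourier g \<xi>))\<^sup>2)" by (intro integrable_norm_square schwartz_fourier g)
    have i: "integrable lborel (\<lambda>\<xi>. (norm (fourier g (\<xi> /\<^sub>R \<rho> - k)))\<^sup>2)"
      and I: "(LINT \<xi>|lborel. (norm (fourier g (\<xi> /\<^sub>R \<rho> - k)))\<^sup>2) = \<rho> ^ CARD('n) * J" for k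
      using integrable_lborel_affine[OF ig, of "inverse \<rho>" "- k"]
        integral_lborel_affine[OF ig, of "inverse \<rho>" "- k"] \<rho>
      by (simp_all add: J_def power_inverse)
    have F: "(LINT \<xi>|lborel. (norm (fourier ?f \<xi>))\<^sup>2) = \<tau>\<^sup>2 * (real (card S) * (\<rho> ^ CARD('n) * J))"
    proof -
      have eq: "(\<lambda>\<xi>. (norm (fourier ?f \<xi>))\<^sup>2) = (\<lambda>\<xi>. \<tau>\<^sup>2 * (\<Sum>k\<in>S. (norm (fourier g (\<xi> /\<^sub>R \<rho> - k)))\<^sup>2))"
        by (intro ext norm_fourier_packet_square[where r = r] g supp r S \<rho>0)
      have "(LINT \<xi>|lborel. (norm (fourier ?f \<xi>))\<^sup>2) =
          \<tau>\<^sup>2 * (LINT \<xi>|lborel. (\<Sum>k\<in>S. (norm (fourier g (\<xi> /\<^sub>R \<rho> - k)))\<^sup>2))"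
        unfolding eq by (rule integral_mult_right_zero)
      then show ?thesis by (simp only: Bochner_Integration.integral_sum[OF i] I) simp
    qed
    have ih: "integrable lborel ?h"
    proof -
      have "(\<lambda>\<xi>. dyadic \<eta> \<psi> j \<xi> * (fourier ?f \<xi> * cnj (fourier ?f \<xi>))) \<in> schwartz"
        by (intro schwartz_mult schwartz_dyadic[OF dp] schwartz_cnj schwartz_fourier f)
      then show ?thesis unfolding complex_norm_square by (rule schwartz_integrable)
    qed
    have "?D = (LINT \<xi>|lborel. (norm (fourier ?f \<xi>))\<^sup>2 / 2)"
      by (simp only: integral_divide_zero F)
    also have "\<dots> \<le> (LINT \<xi>|lborel. Re (?h \<xi>))"
    proof (rule integral_mono)
      show "integrable lborel (\<lambda>\<xi>. (norm (fourier ?f \<xi>))\<^sup>2 / 2)"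
        by (intro integrable_divide integrable_norm_square schwartz_fourier f)
      show "integrable lborel (\<lambda>\<xi>. Re (?h \<xi>))" by (rule integrable_Re[OF ih])
      show "(norm (fourier ?f \<xi>))\<^sup>2 / 2 \<le> Re (?h \<xi>)" for \<xi>
      proof (cases "fourier ?f \<xi> = 0")
        case False
        \<comment> \<open>Here j \<ge> 1 matters: for index 0 the multiplier would be \<eta> in
          place of a dilate of \<psi>.\<close>
        have "1/2 \<le> Re (dyadic \<eta> \<psi> j \<xi>)"
          using \<psi>[OF fourier_packet_nonzero[OF g supp adm False]] j by (simp add: dyadic_def)
        from mult_right_mono[OF this zero_le_power2[of "norm (fourier ?f \<xi>)"]]
        show ?thesis by simp
      qed simp
    qed
    also have "\<dots> = Re (LINT \<xi>|lborel. ?h \<xi>)" by (rule integral_Re[OF ih])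
    also have "\<dots> \<le> norm (LINT \<xi>|lborel. ?h \<xi>)" by (rule complex_Re_le_cmod)
    finally have D: "?D \<le> norm (LINT \<xi>|lborel. ?h \<xi>)" .
    have "ennreal (2 powr (real j * s) * (?D / (2 * pi) ^ CARD('n) / (2 * ?A powr recip p * ?B powr (1 - recip p))))
      \<le> besov_norm \<eta> \<psi> p q s (dist_of ?f)"
      using \<tau> C1 \<rho> m J
      by (intro besov_norm_ge[OF dp p q f] sup[OF \<rho> \<tau> S far] L1[OF \<rho> \<tau> S] D) auto
    also have "?D / (2 * pi) ^ CARD('n) / (2 * ?A powr recip p * ?B powr (1 - recip p)) =
      \<tau> * C * ((\<rho> ^ CARD('n)) powr (1 - recip p) * real (card S) powr recip p)"
    proof -
      let ?N = "\<rho> ^ CARD('n)" and ?m = "real (card S)" and ?P = "recip p"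
      have N: "0 < ?N" using \<rho> by simp
      have "?A powr ?P * ?B powr (1 - ?P) = ((\<tau> * C1) powr ?P * (\<tau> * C1) powr (1 - ?P)) * (?N powr ?P * ?m powr (1 - ?P))"
        using \<tau> C1 N by (subst (1 2) powr_mult) (auto simp: mult_ac)
      also have "(\<tau> * C1) powr ?P * (\<tau> * C1) powr (1 - ?P) = \<tau> * C1"
        using \<tau> C1 by (simp flip: powr_add)
      finally have AB: "2 * ?A powr ?P * ?B powr (1 - ?P) = 2 * (\<tau> * C1 * (?N powr ?P * ?m powr (1 - ?P)))"
        by simp
      \<comment> \<open>Splitting \<rho>^n and m into complementary powers lets the powers in the
        denominator cancel.\<close>
      have 1: "?N = ?N powr ?P * ?N powr (1 - ?P)" and 2: "?m = ?m powr ?P * ?m powr (1 - ?P)"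
        using N m \<rho>0 by (simp_all flip: powr_add)
      have "?D = \<tau>\<^sup>2 * ((?m powr ?P * ?m powr (1 - ?P)) * ((?N powr ?P * ?N powr (1 - ?P)) * J)) / 2"
        using 1 2 by simp
      also have "\<dots> / (2 * pi) ^ CARD('n) / (2 * (\<tau> * C1 * (?N powr ?P * ?m powr (1 - ?P)))) =
        \<tau> * C * (?N powr (1 - ?P) * ?m powr ?P)"
      proof -
        have "0 < ?N powr ?P" "0 < ?m powr (1 - ?P)" using \<rho>0 m by simp_all
        then show ?thesis
          using \<tau> C1 by (simp add: C_def power2_eq_square)
      qed
      finally show ?thesis unfolding AB .
    qed
    finally show "ennreal (\<tau> * C * (2 powr (real j * s) * ((\<rho> ^ CARD('n)) powr (1 - recip p) * real (card S) powr recip p)))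
      \<le> besov_norm \<eta> \<psi> p q s (dist_of ?f)"
      by (simp add: mult_ac)
  qed
qed

section \<open>Choice of the packets and comparison of exponents\<close>

lemma dispersed_exists:
  fixes S :: "'b set" and D :: real
  assumes "finite S" "0 \<le> D"
  obtains a :: "'b \<Rightarrow> real^'n::finite" where "dispersed D S a"
proof -
  obtain f :: "'b \<Rightarrow> nat" where f: "inj_on f S"
    using finite_imp_inj_to_nat_seg[OF assms(1)] by blast
  \<comment> \<open>Equally spaced points on one coordinate axis; \<open>undefined\<close> merely
    names some coordinate.\<close>
  define a where "a k = (D * real (f k)) *\<^sub>R (axis undefined 1 :: real^'n)" for k
  show ?thesis
  proof (rule that[of a], unfold dispersed_def, intro ballI impI)
    fix k l assume "k \<in> S" "l \<in> S" "k \<noteq> l"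
    then have "f k \<noteq> f l" using f by (auto dest: inj_onD)
    then have "1 \<le> \<bar>real (f k) - real (f l)\<bar>" by linarith
    then have "D * 1 \<le> D * \<bar>real (f k) - real (f l)\<bar>" using assms(2) by (rule mult_left_mono)
    also have "\<dots> = dist (a k) (a l)"
      using assms(2) by (simp add: a_def dist_norm abs_mult flip: scaleR_diff_left right_diff_distrib)
    finally show "D \<le> dist (a k) (a l)" by simp
  qed
qed

definition grid :: "nat \<Rightarrow> (real^'n::finite) set" where
  "grid M = (\<lambda>k. \<chi> i. real (k i)) ` (UNIV \<rightarrow>\<^sub>E {..<M})"

lemma card_grid: "card (grid M :: (real^'n::finite) set) = M ^ CARD('n)"
proof -
  have "inj_on (\<lambda>k::'n \<Rightarrow> nat. \<chi> i. real (k i)) (UNIV \<rightarrow>\<^sub>E {..<M})"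
    by (auto simp: inj_on_def vec_eq_iff)
  then show ?thesis
    unfolding grid_def by (simp add: card_image card_funcsetE)
qed

lemma separated_grid:
  assumes "0 < M"
  shows "separated (grid M :: (real^'n::finite) set)"
  unfolding separated_def
proof (intro conjI ballI impI)
  show "finite (grid M :: (real^'n) set)"
    unfolding grid_def by (intro finite_imageI finite_PiE) auto
  show "(grid M :: (real^'n) set) \<noteq> {}"
    using card_grid[of M, where 'n = 'n] assms by (metis card.empty power_eq_0_iff less_numeral_extra(3))
  fix x y :: "real^'n" assume "x \<in> grid M" "y \<in> grid M" "x \<noteq> y"
  then obtain k l :: "'n \<Rightarrow> nat" where kl: "x = (\<chi> i. real (k i))" "y = (\<chi> i. real (l i))"
    by (auto simp: grid_def)
  with \<open>x \<noteq> y\<close> have "k \<noteq> l" by auto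
  then obtain i where "k i \<noteq> l i" by auto
  then have "1 \<le> \<bar>(x - y) $ i\<bar>" unfolding kl by simp
  also have "\<dots> \<le> dist x y" unfolding dist_norm by (rule component_le_norm_cart)
  finally show "1 \<le> dist x y" .
qed

text \<open>The bound uses M - 1 and not M: it is 0 for M = 1, so the one-point grid satisfies the
  size condition of \<open>admissible_grid\<close> for every \<rho>, in particular for \<rho> =
  2^j.\<close>

lemma norm_grid_le:
  assumes "x \<in> grid M"
  shows "norm (x :: real^'n::finite) \<le> real CARD('n) * (real M - 1)"
proof -
  obtain k :: "'n \<Rightarrow> nat" where k: "x = (\<chi> i. real (k i))" "\<And>i. k i < M"
    using assms by (auto simp: grid_def PiE_iff)
  have "norm x \<le> (\<Sum>i\<in>UNIV. \<bar>x $ i\<bar>)" by (rule norm_le_l1_cart)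
  also have "\<dots> \<le> (\<Sum>i\<in>(UNIV::'n set). real M - 1)"
  proof (rule sum_mono)
    fix i
    have "k i + 1 \<le> M" using k(2)[of i] by simp
    then show "\<bar>x $ i\<bar> \<le> real M - 1" using k(1) by simp
  qed
  finally show ?thesis by simp
qed

lemma separated_translate:
  fixes S :: "'a::real_normed_vector set"
  assumes "separated S"
  shows "separated ((+) c ` S)" "card ((+) c ` S) = card S"
  using assms by (auto simp: separated_def card_image)

text \<open>The translate puts \<rho> k near 2^j e. After division by 2^j the radius of the profile
  costs less than \<rho> r / 2^j \<le> \<delta>/2, because \<rho> \<le> 2^j, and the extent of the
  grid costs the other \<delta>/2.\<close>

lemma admissible_grid:
  fixes e :: "real^'n::finite"
  assumes \<delta>: "0 < \<delta>" and r: "0 < r" "r \<le> \<delta> / 2" and j: "1 \<le> j" and \<rho>: "1 \<le> \<rho>" "\<rho> \<le> 2 ^ j"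
    and M: "0 < M" "real CARD('n) * (real M - 1) \<le> \<delta> / (2 * \<rho>) * 2 ^ j"
  shows "admissible r \<delta> e \<rho> ((+) ((2 ^ j / \<rho>) *\<^sub>R e) ` grid M) j"
  unfolding admissible_def
proof (intro conjI j \<rho>(1) ballI allI impI)
  show "separated ((+) ((2 ^ j / \<rho>) *\<^sub>R e) ` grid M)"
    by (intro separated_translate separated_grid M)
  fix k \<omega> assume "k \<in> (+) ((2 ^ j / \<rho>) *\<^sub>R e) ` grid M" and \<omega>: "norm (\<omega> /\<^sub>R \<rho> - k) < r"
  then obtain z :: "real^'n" where z: "z \<in> grid M" "k = (2 ^ j / \<rho>) *\<^sub>R e + z" by auto
  have eq: "\<omega> /\<^sub>R 2 ^ j - e = (\<rho> / 2 ^ j) *\<^sub>R ((\<omega> /\<^sub>R \<rho> - k) + z)"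
    using \<rho> by (simp add: z(2) scaleR_diff_right scaleR_add_right inverse_eq_divide)
  have "dist (\<omega> /\<^sub>R 2 ^ j) e = \<rho> / 2 ^ j * norm ((\<omega> /\<^sub>R \<rho> - k) + z)"
    unfolding dist_norm eq using \<rho> by simp
  also have "\<dots> < \<rho> / 2 ^ j * (r + \<delta> / (2 * \<rho>) * 2 ^ j)"
  proof (rule mult_strict_left_mono)
    have "norm z \<le> \<delta> / (2 * \<rho>) * 2 ^ j" using norm_grid_le[OF z(1)] M(2) by linarith
    then show "norm ((\<omega> /\<^sub>R \<rho> - k) + z) < r + \<delta> / (2 * \<rho>) * 2 ^ j"
      using norm_triangle_ineq[of "\<omega> /\<^sub>R \<rho> - k" z] \<omega> by linarith
  qed (use \<rho> in simp)
  also have "\<dots> = \<rho> / 2 ^ j * r + \<delta> / 2" using \<rho> by (simp add: field_simps)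
  also have "\<dots> \<le> 1 * r + \<delta> / 2"
    using \<rho> r by (intro add_right_mono mult_right_mono) auto
  finally show "dist (\<omega> /\<^sub>R 2 ^ j) e < \<delta>" using r by simp
qed

lemma admissible_large:
  fixes e :: "real^'n::finite"
  assumes \<delta>: "0 < \<delta>" and r: "0 < r" "r \<le> \<delta> / 2" and \<rho>: "1 \<le> \<rho>"
  obtains c j\<^sub>0 where "0 < c"
    "\<And>j. j\<^sub>0 \<le> j \<Longrightarrow> \<rho> \<le> 2 ^ j"
    "\<And>j. j\<^sub>0 \<le> j \<Longrightarrow> \<exists>S. admissible r \<delta> e \<rho> S j \<and> card S = 1"
    "\<And>j. j\<^sub>0 \<le> j \<Longrightarrow> \<exists>S. admissible r \<delta> e (2 ^ j) S j \<and> card S = 1"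
    "\<And>j. j\<^sub>0 \<le> j \<Longrightarrow> \<exists>S. admissible r \<delta> e \<rho> S j \<and> (c * 2 ^ j) ^ CARD('n) \<le> real (card S)"
proof -
  obtain i where i: "\<rho> < 2 ^ i" using real_arch_pow[of 2 \<rho>] by auto
  \<comment> \<open>With this c the size condition n (M - 1) \<le> \<delta> 2^j / (2 \<rho>) of
    \<open>admissible_grid\<close> becomes M - 1 \<le> c 2^j.\<close>
  define c where "c = \<delta> / (2 * \<rho>) / real CARD('n)"
  have c: "0 < c" using \<delta> \<rho> by (simp add: c_def)
  have large: "\<rho> \<le> 2 ^ j" "1 \<le> j" if "max 1 i \<le> j" for j
  proof -
    have "(2::real) ^ i \<le> 2 ^ j" using that by (intro power_increasing) auto
    then show "\<rho> \<le> 2 ^ j" using i by linarith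
    show "1 \<le> j" using that by simp
  qed
  show ?thesis
  proof (rule that[OF c])
    fix j assume j: "max 1 i \<le> j"
    show "\<rho> \<le> 2 ^ j" by (rule large(1)[OF j])
    show "\<exists>S. admissible r \<delta> e \<rho> S j \<and> card S = 1"
      using admissible_grid[OF \<delta> r large(2)[OF j] \<rho> large(1)[OF j], of 1 e] \<delta> \<rho>
        separated_translate(2)[OF separated_grid[of 1, where 'n = 'n]] card_grid[of 1, where 'n = 'n]
      by (intro exI conjI) (assumption | simp)+
    show "\<exists>S. admissible r \<delta> e (2 ^ j) S j \<and> card S = 1"
      using admissible_grid[OF \<delta> r large(2)[OF j], of "2 ^ j" 1 e] \<delta>
        separated_translate(2)[OF separated_grid[of 1, where 'n = 'n]] card_grid[of 1, where 'n = 'n]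
      by (intro exI conjI) (assumption | simp)+
    \<comment> \<open>One more than the floor: M - 1 \<le> c 2^j lets the grid fit, while M \<ge> c
      2^j gives the required number of points.\<close>
    define M where "M = nat \<lfloor>c * 2 ^ j\<rfloor> + 1"
    have cj: "0 \<le> c * 2 ^ j" using c by simp
    have M: "0 < M" "real M - 1 \<le> c * 2 ^ j" "c * 2 ^ j \<le> real M"
      using cj by (auto simp: M_def) linarith+
    have "real CARD('n) * (real M - 1) \<le> real CARD('n) * (c * 2 ^ j)"
      using M by (intro mult_left_mono) auto
    also have "\<dots> = \<delta> / (2 * \<rho>) * 2 ^ j" by (simp add: c_def)
    finally have adm: "admissible r \<delta> e \<rho> ((+) ((2 ^ j / \<rho>) *\<^sub>R e) ` grid M) j"
      by (intro admissible_grid[OF \<delta> r large(2)[OF j] \<rho> large(1)[OF j] M(1)])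
    have "(c * 2 ^ j) ^ CARD('n) \<le> real M ^ CARD('n)"
      using M cj by (intro power_mono) auto
    also have "\<dots> = real (card ((+) ((2 ^ j / \<rho>) *\<^sub>R e) ` (grid M :: (real^'n) set)))"
      using separated_translate(2)[OF separated_grid[OF M(1), where 'n = 'n]]
      by (simp add: card_grid[where 'n = 'n])
    finally show "\<exists>S. admissible r \<delta> e \<rho> S j \<and> (c * 2 ^ j) ^ CARD('n) \<le> real (card S)"
      using adm by blast
  qed
qed

section \<open>Comparison of exponents for large j\<close>

lemma exponent_nonpos:
  fixes \<alpha> K :: real
  assumes "\<And>j::nat. j\<^sub>0 \<le> j \<Longrightarrow> 2 powr (real j * \<alpha>) \<le> K"
  shows "\<alpha> \<le> 0"
proof (rule ccontr)
  assume "\<not> \<alpha> \<le> 0"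
  then have "1 < 2 powr \<alpha>" by simp
  then obtain n where n: "K < (2 powr \<alpha>) ^ n" using real_arch_pow by blast
  have "(2 powr \<alpha>) ^ n \<le> (2 powr \<alpha>) ^ max j\<^sub>0 n"
    using \<open>1 < 2 powr \<alpha>\<close> by (intro power_increasing) auto
  also have "\<dots> = 2 powr (real (max j\<^sub>0 n) * \<alpha>)"
    by (simp add: powr_powr mult.commute flip: powr_realpow)
  also have "\<dots> \<le> K" by (rule assms) simp
  finally show False using n by simp
qed

text \<open>In the following two lemmas P and Q stand for 1/p and 1/q, and N for the dimension; the
  three families of packets have (dilation, number of packets) equal to (\<rho>, 1), (\<rho>, m) with m of
  order 2 ^ (j * N), and (2 ^ j, 1).\<close>

lemma exponent_lower_bound:
  fixes P Q s \<rho> c K :: real and N :: nat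
  assumes \<rho>: "1 \<le> \<rho>" and c: "0 < c" and K: "0 < K"
    and one: "\<And>j. j\<^sub>0 \<le> j \<Longrightarrow> (\<rho> ^ N * 1) powr Q \<le> K * (2 powr (real j * s) * ((\<rho> ^ N) powr (1 - P) * 1 powr P))"
    and many: "\<And>j. j\<^sub>0 \<le> j \<Longrightarrow> \<exists>m. (c * 2 ^ j) ^ N \<le> m \<and>
      (\<rho> ^ N * m) powr Q \<le> K * (2 powr (real j * s) * ((\<rho> ^ N) powr (1 - P) * m powr P))"
    and wide: "\<And>j. j\<^sub>0 \<le> j \<Longrightarrow> ((2 ^ j) ^ N * 1) powr Q \<le> K * (2 powr (real j * s) * (((2 ^ j) ^ N) powr (1 - P) * 1 powr P))"
  shows "s \<ge> real N * max 0 (Q - min P (1 - P))"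
proof -
  define L where "L = (\<rho> ^ N) powr Q / (K * (\<rho> ^ N) powr (1 - P))"
  have L: "0 < L" using \<rho> K by (simp add: L_def)
  have s0: "0 \<le> s"
  proof -
    have "2 powr (real j * (- s)) \<le> 1 / L" if "j\<^sub>0 \<le> j" for j
      using one[OF that] \<rho> K by (simp add: L_def powr_minus field_simps)
    then have "- s \<le> 0" by (rule exponent_nonpos)
    then show ?thesis by simp
  qed
  moreover have "real N * (Q - P) \<le> s"
  \<comment> \<open>Only a lower bound for m is available; it yields a lower bound for m^(Q - P)
    when the exponent is positive. For Q \<le> P the claim follows from s \<ge> 0.\<close>
  proof (cases "Q - P \<le> 0")
    case True
    then have "real N * (Q - P) \<le> 0" by (simp add: mult_nonneg_nonpos)
    then show ?thesis using s0 by linarith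
  next
    case False
    define L' where "L' = (c ^ N) powr (Q - P) * L"
    have L': "0 < L'" using L c by (simp add: L'_def)
    have "2 powr (real j * (real N * (Q - P) - s)) \<le> 1 / L'" if j: "j\<^sub>0 \<le> j" for j
    proof -
      obtain m where m: "(c * 2 ^ j) ^ N \<le> m"
        "(\<rho> ^ N * m) powr Q \<le> K * (2 powr (real j * s) * ((\<rho> ^ N) powr (1 - P) * m powr P))"
        using many[OF j] by blast
      have cm: "0 < (c * 2 ^ j) ^ N" using c by simp
      then have m0: "0 < m" using m(1) by linarith
      have "(c ^ N) powr (Q - P) * 2 powr (real j * (real N * (Q - P))) = ((c * 2 ^ j) ^ N) powr (Q - P)"
        using c by (simp add: power_mult_distrib powr_mult powr_powr mult_ac flip: power_mult powr_realpow)
      also have "\<dots> \<le> m powr (Q - P)"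
        using cm m(1) False by (intro powr_mono2) auto
      also have "\<dots> \<le> 2 powr (real j * s) / L"
        using m(2) m0 \<rho> K by (simp add: L_def powr_mult powr_diff field_simps)
      finally show ?thesis
        using L c by (simp add: L'_def right_diff_distrib powr_diff powr_add field_simps)
    qed
    then have "real N * (Q - P) - s \<le> 0" by (rule exponent_nonpos)
    then show ?thesis by simp
  qed
  moreover have "real N * (Q - (1 - P)) \<le> s"
  proof -
    have "2 powr (real j * (real N * (Q - (1 - P)) - s)) \<le> K" if j: "j\<^sub>0 \<le> j" for j
    proof -
      have "((2::real) ^ j) ^ N = 2 powr (real j * real N)"
        by (simp add: powr_powr flip: power_mult powr_realpow)
      then show ?thesis
        using wide[OF j] by (simp add: powr_powr right_diff_distrib powr_diff powr_add field_simps)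
    qed
    then have "real N * (Q - (1 - P)) - s \<le> 0" by (rule exponent_nonpos)
    then show ?thesis by simp
  qed
  ultimately show ?thesis
    by (simp add: max_def min_def)
qed

lemma exponent_upper_bound:
  fixes P Q s \<rho> c K :: real and N :: nat
  assumes \<rho>: "1 \<le> \<rho>" and c: "0 < c" and K: "0 < K"
    and one: "\<And>j. j\<^sub>0 \<le> j \<Longrightarrow> 2 powr (real j * s) * ((\<rho> ^ N) powr (1 - P) * 1 powr P) \<le> K * (\<rho> ^ N * 1) powr Q"
    and many: "\<And>j. j\<^sub>0 \<le> j \<Longrightarrow> \<exists>m. (c * 2 ^ j) ^ N \<le> m \<and>
      2 powr (real j * s) * ((\<rho> ^ N) powr (1 - P) * m powr P) \<le> K * (\<rho> ^ N * m) powr Q"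
    and wide: "\<And>j. j\<^sub>0 \<le> j \<Longrightarrow> 2 powr (real j * s) * (((2 ^ j) ^ N) powr (1 - P) * 1 powr P) \<le> K * ((2 ^ j) ^ N * 1) powr Q"
  shows "s \<le> real N * min 0 (Q - max P (1 - P))"
proof -
  define L where "L = K * (\<rho> ^ N) powr Q / (\<rho> ^ N) powr (1 - P)"
  have L: "0 < L" using \<rho> K by (simp add: L_def)
  have s0: "s \<le> 0"
  proof -
    have "2 powr (real j * s) \<le> L" if "j\<^sub>0 \<le> j" for j
      using one[OF that] \<rho> K by (simp add: L_def field_simps)
    then show ?thesis by (rule exponent_nonpos)
  qed
  moreover have "s \<le> real N * (Q - P)"
  \<comment> \<open>Here m^(Q - P) must be bounded above, which the lower bound for m allows when
    the exponent is negative. For Q \<ge> P the claim follows from s \<le> 0.\<close>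
  proof (cases "0 \<le> Q - P")
    case True
    then have "0 \<le> real N * (Q - P)" by simp
    then show ?thesis using s0 by linarith
  next
    case False
    have "2 powr (real j * (s - real N * (Q - P))) \<le> L * (c ^ N) powr (Q - P)" if j: "j\<^sub>0 \<le> j" for j
    proof -
      obtain m where m: "(c * 2 ^ j) ^ N \<le> m"
        "2 powr (real j * s) * ((\<rho> ^ N) powr (1 - P) * m powr P) \<le> K * (\<rho> ^ N * m) powr Q"
        using many[OF j] by blast
      have cm: "0 < (c * 2 ^ j) ^ N" using c by simp
      then have m0: "0 < m" using m(1) by linarith
      have "2 powr (real j * s) \<le> L * m powr (Q - P)"
        using m(2) m0 \<rho> K by (simp add: L_def powr_mult powr_diff field_simps)
      also have "\<dots> \<le> L * ((c * 2 ^ j) ^ N) powr (Q - P)"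
        using cm m(1) False L by (intro mult_left_mono powr_mono2') auto
      also have "((c * 2 ^ j) ^ N) powr (Q - P) = (c ^ N) powr (Q - P) * 2 powr (real j * (real N * (Q - P)))"
        using c by (simp add: power_mult_distrib powr_mult powr_powr mult_ac flip: power_mult powr_realpow)
      finally show ?thesis
        using c by (simp add: right_diff_distrib powr_diff powr_add field_simps)
    qed
    then have "s - real N * (Q - P) \<le> 0" by (rule exponent_nonpos)
    then show ?thesis by simp
  qed
  moreover have "s \<le> real N * (Q - (1 - P))"
  proof -
    have "2 powr (real j * (s - real N * (Q - (1 - P)))) \<le> K" if j: "j\<^sub>0 \<le> j" for j
    proof -
      have "((2::real) ^ j) ^ N = 2 powr (real j * real N)"
        by (simp add: powr_powr flip: power_mult powr_realpow)
      then show ?thesis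
        using wide[OF j] by (simp add: powr_powr right_diff_distrib powr_diff powr_add field_simps)
    qed
    then have "s - real N * (Q - (1 - P)) \<le> 0" by (rule exponent_nonpos)
    then show ?thesis by simp
  qed
  ultimately show ?thesis
    by (simp add: max_def min_def)
qed

section \<open>The embeddings\<close>

text \<open>Continuity is applied at the zero distribution with \<epsilon> = 1. The premise
  \<open>zero\<close> ensures that this point belongs to the source space.\<close>

lemma continuously_included_at_zero:
  fixes NX NY :: "'n::finite functional \<Rightarrow> ennreal"
  assumes incl: "continuously_included {T \<in> tempered. NX T < \<infinity>} NX {T \<in> tempered. NY T < \<infinity>} NY"
    and zero: "NX (dist_of (\<lambda>x. 0)) < \<infinity>"
  obtains \<delta> where "0 < \<delta>" "\<And>f. f \<in> schwartz \<Longrightarrow> NX (dist_of f) < ennreal \<delta> \<Longrightarrow> NY (dist_of f) < ennreal 1"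
proof -
  let ?X = "{T \<in> tempered. NX T < \<infinity>}"
  have 0: "dist_of (\<lambda>x::real^'n. 0) \<in> ?X"
    using zero dist_of_tempered[OF schwartz_zero] by simp
  have "\<forall>T\<in>?X. \<forall>\<epsilon>::real>0. \<exists>\<delta>::real>0. \<forall>U\<in>?X.
      NX (dist_diff U T) < ennreal \<delta> \<longrightarrow> NY (dist_diff U T) < ennreal \<epsilon>"
    using incl unfolding continuously_included_def by (rule conjunct2)
  from this[rule_format, OF 0 zero_less_one] obtain \<delta> :: real where \<delta>: "0 < \<delta>"
    "\<forall>U\<in>?X. NX (dist_diff U (dist_of (\<lambda>x. 0))) < ennreal \<delta> \<longrightarrow> NY (dist_diff U (dist_of (\<lambda>x. 0))) < ennreal 1"
    by blast
  show ?thesis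
  proof (rule that[OF \<delta>(1)])
    fix f :: "real^'n \<Rightarrow> complex" assume f: "f \<in> schwartz" and less: "NX (dist_of f) < ennreal \<delta>"
    have "NX (dist_of f) < \<infinity>"
      using less by (rule order_less_trans) simp
    then have "dist_of f \<in> ?X" using dist_of_tempered[OF f] by simp
    from \<delta>(2)[rule_format, OF this] show "NY (dist_of f) < ennreal 1"
      unfolding dist_diff_dist_of[OF f] using less by blast
  qed
qed

text \<open>The factor \<tau> replaces homogeneity of the norms: it is chosen so that the packet has
  X-norm less than \<delta>.\<close>

lemma comparison_of_bounds:
  fixes NX NY :: "'n::finite functional \<Rightarrow> ennreal"
  assumes \<delta>: "0 < \<delta>" "\<And>f. f \<in> schwartz \<Longrightarrow> NX (dist_of f) < ennreal \<delta> \<Longrightarrow> NY (dist_of f) < ennreal 1"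
    and f: "\<And>\<tau>. 0 < \<tau> \<Longrightarrow> f \<tau> \<in> schwartz"
    and X: "\<And>\<tau>. 0 < \<tau> \<Longrightarrow> NX (dist_of (f \<tau>)) \<le> ennreal (\<tau> * C * x)"
    and Y: "\<And>\<tau>. 0 < \<tau> \<Longrightarrow> ennreal (\<tau> * C' * y) \<le> NY (dist_of (f \<tau>))"
    and pos: "0 < C" "0 < C'" "0 < x"
  shows "y \<le> 2 * C / (\<delta> * C') * x"
proof -
  \<comment> \<open>The 2 brings the norm down to \<delta>/2, strictly below \<delta>.\<close>
  define \<tau> where "\<tau> = \<delta> / (2 * C * x)"
  have \<tau>: "0 < \<tau>" using \<delta> pos by (simp add: \<tau>_def)
  have "NX (dist_of (f \<tau>)) \<le> ennreal (\<delta> / 2)"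
    using X[OF \<tau>] pos by (simp add: \<tau>_def)
  also have "\<dots> < ennreal \<delta>" using \<delta>(1) by (intro ennreal_lessI) auto
  finally have "NY (dist_of (f \<tau>)) < ennreal 1" by (rule \<delta>(2)[OF f[OF \<tau>]])
  then have "ennreal (\<tau> * C' * y) < ennreal 1"
    using Y[OF \<tau>] by (rule order_le_less_trans[rotated])
  then have "\<tau> * C' * y < 1" by (meson ennreal_leI not_le)
  then show ?thesis using \<delta>(1) pos by (simp add: \<tau>_def field_simps)
qed

lemma modulation_norm_zero:
  assumes "\<phi> \<in> schwartz" "1 \<le> p" "1 \<le> q"
  shows "modulation_norm \<phi> p q (dist_of (\<lambda>x. 0)) = 0"
  using assms by (simp add: modulation_norm_def stft_dist_of schwartz_zero fourier_def Lnorm_zero)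

text \<open>The general upper bound applies with A = B = 1 and j = 0, since the zero function
  satisfies every support condition.\<close>

lemma besov_norm_zero_finite:
  fixes \<eta> \<psi> :: "real^'n::finite \<Rightarrow> complex"
  assumes dp: "dyadic_partition \<eta> \<psi>" and p: "1 \<le> p" and q: "1 \<le> q"
  shows "besov_norm \<eta> \<psi> p q s (dist_of (\<lambda>x. 0)) < \<infinity>"
proof -
  obtain k where k: "0 < k" "\<And>i. (LINT x|lborel. norm (inv_fourier (dyadic \<eta> \<psi> i) x)) \<le> k"
    using dyadic_kernel_bound[OF dp] by blast
  have "besov_norm \<eta> \<psi> p q s (dist_of (\<lambda>x. 0)) \<le>
      ennreal (3 * k * 2 powr \<bar>s\<bar> * (2 powr (real 0 * s) * (1 powr (1 - recip p) * 1 powr recip p)))"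
    by (intro besov_norm_le[OF dp p q schwartz_zero k]) (auto simp: fourier_def)
  then show ?thesis by (rule order_le_less_trans) simp
qed

theorem theorem1p2:
  fixes p q :: ennreal and s :: real
    and \<phi> \<eta> \<psi> :: "real^'n::finite \<Rightarrow> complex"
  assumes "1 \<le> p" and "1 \<le> q"
    and "\<phi> \<in> schwartz" and "\<phi> \<noteq> (\<lambda>x. 0)"
    and "dyadic_partition \<eta> \<psi>"
  shows "(continuously_included
            (besov_space \<eta> \<psi> p q s) (besov_norm \<eta> \<psi> p q s)
            (modulation_space \<phi> p q) (modulation_norm \<phi> p q)
          \<longrightarrow> s \<ge> real CARD('n) * nu1 p q) \<and>
         (continuously_included
            (modulation_space \<phi> p q) (modulation_norm \<phi> p q)
            (besov_space \<eta> \<psi> p q s) (besov_norm \<eta> \<psi> p q s)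
          \<and> p < \<infinity> \<and> q < \<infinity>
          \<longrightarrow> s \<le> real CARD('n) * nu2 p q)"
proof -
  note p = assms(1) and q = assms(2) and \<phi> = assms(3) and \<phi>0 = assms(4) and dp = assms(5)
  \<comment> \<open>Any unit vector would serve: by \<open>dyadic_partition_unit_sphere\<close> the
    function \<psi> equals 1 on the whole unit sphere.\<close>
  define e :: "real^'n" where "e = axis undefined 1"
  have e: "norm e = 1" by (simp add: e_def)
  obtain \<delta> where \<delta>: "0 < \<delta>" "\<delta> \<le> 1/4" and \<psi>: "\<And>\<xi>. dist \<xi> e < \<delta> \<Longrightarrow> 1/2 \<le> Re (\<psi> \<xi>)"
    using dyadic_partition_Re_ge[OF dp e] by blast
  \<comment> \<open>The other half of \<delta> is left to the grid in
    \<open>admissible_grid\<close>. As \<delta> \<le> 1/4, also r \<le> 1/2, which separates the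
    Fourier supports of the packets.\<close>
  define r where "r = \<delta> / 2"
  have r: "0 < r" "r \<le> \<delta> / 2" "r \<le> 1/2" using \<delta> by (auto simp: r_def)
  obtain g :: "real^'n \<Rightarrow> complex" where g: "g \<in> schwartz" and g0: "fourier g 0 \<noteq> 0"
    and supp: "\<And>\<xi>. fourier g \<xi> \<noteq> 0 \<Longrightarrow> norm \<xi> < r"
    using band_limited_bump[OF dp r(1)] by blast
  let ?N = "CARD('n)" and ?P = "recip p" and ?Q = "recip q"
  let ?x = "\<lambda>\<rho> m j. 2 powr (real j * s) * ((\<rho> ^ ?N) powr (1 - ?P) * m powr ?P)"
  let ?y = "\<lambda>\<rho> m. (\<rho> ^ ?N * m) powr ?Q"
  let ?B = "besov_norm \<eta> \<psi> p q s" and ?M = "modulation_norm \<phi> p q"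
  obtain CB where CB: "0 < CB" and B_le: "\<And>\<rho> \<tau> S a j. admissible r \<delta> e \<rho> S j \<Longrightarrow> 0 < \<tau> \<Longrightarrow>
      dispersed (2 * real (card S)) S a \<Longrightarrow>
      ?B (dist_of (packet g \<rho> \<tau> S a)) \<le> ennreal (\<tau> * CB * ?x \<rho> (real (card S)) j)"
    using packet_besov_norm_le[OF dp p q g supp e \<delta>(2), of s] by blast
  obtain CM D \<rho>\<^sub>0 where CM: "0 < CM" "0 < D" "1 \<le> \<rho>\<^sub>0"
    and M_ge: "\<And>\<rho> \<tau> S a. \<rho>\<^sub>0 \<le> \<rho> \<Longrightarrow> 0 < \<tau> \<Longrightarrow> separated S \<Longrightarrow>
      dispersed (\<rho> * (D * real (card S))) S a \<Longrightarrow>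
      ennreal (\<tau> * CM * ?y \<rho> (real (card S))) \<le> ?M (dist_of (packet g \<rho> \<tau> S a))"
    using packet_modulation_norm_ge[OF g \<phi> \<phi>0 g0 p q] by blast
  obtain c j\<^sub>0 where c: "0 < c"
    and wide: "\<And>j. j\<^sub>0 \<le> j \<Longrightarrow> \<rho>\<^sub>0 \<le> 2 ^ j"
    and S1: "\<And>j. j\<^sub>0 \<le> j \<Longrightarrow> \<exists>S. admissible r \<delta> e \<rho>\<^sub>0 S j \<and> card S = 1"
    and S2: "\<And>j. j\<^sub>0 \<le> j \<Longrightarrow> \<exists>S. admissible r \<delta> e (2 ^ j) S j \<and> card S = 1"
    and S3: "\<And>j. j\<^sub>0 \<le> j \<Longrightarrow> \<exists>S. admissible r \<delta> e \<rho>\<^sub>0 S j \<and> (c * 2 ^ j) ^ ?N \<le> real (card S)"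
    using admissible_large[OF \<delta>(1) r(1,2) CM(3), of e] by blast
  \<comment> \<open>The first spacing is for the lower modulation bound, the second for the supremum
    bound behind the Besov estimates; positions dispersed by the maximum of the two serve
    both.\<close>
  have positions: "\<exists>a :: real^'n \<Rightarrow> real^'n. dispersed (\<rho> * (D * real (card S))) S a \<and> dispersed (2 * real (card S)) S a"
    if S: "separated S" for S and \<rho> :: real
  proof -
    have fin: "finite S" using S by (simp add: separated_def)
    have nonneg: "0 \<le> max (\<rho> * (D * real (card S))) (2 * real (card S))" by (simp add: le_max_iff_disj)
    obtain a :: "real^'n \<Rightarrow> real^'n" where "dispersed (max (\<rho> * (D * real (card S))) (2 * real (card S))) S a"
      by (rule dispersed_exists[OF fin nonneg])
    then show ?thesis by (auto simp: dispersed_def)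
  qed
  have xpos: "0 < ?x \<rho> (real (card S)) j" "0 < ?y \<rho> (real (card S))"
    if "admissible r \<delta> e \<rho> S j" for \<rho> S j
    using that separated_card_pos[of S] by (auto simp: admissible_def)
  have part1: "real ?N * nu1 p q \<le> s"
    if incl: "continuously_included (besov_space \<eta> \<psi> p q s) ?B (modulation_space \<phi> p q) ?M"
  proof -
    obtain d where d: "0 < d"
      "\<And>f. f \<in> schwartz \<Longrightarrow> ?B (dist_of f) < ennreal d \<Longrightarrow> ?M (dist_of f) < ennreal 1"
      using continuously_included_at_zero[OF incl[unfolded besov_space_def modulation_space_def]
          besov_norm_zero_finite[OF dp p q]] by blast
    let ?K = "2 * CB / (d * CM)"
    have K: "0 < ?K" using CB d(1) CM by simp
    \<comment> \<open>The condition on \<rho> comes from the lower modulation bound. It holds for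
      the two families with dilation \<open>\<rho>\<^sub>0\<close>, and by \<open>wide\<close> for
      the dilation 2^j once j is large.\<close>
    have main: "?y \<rho> (real (card S)) \<le> ?K * ?x \<rho> (real (card S)) j"
      if adm: "admissible r \<delta> e \<rho> S j" and \<rho>: "\<rho>\<^sub>0 \<le> \<rho>" for \<rho> S j
    proof -
      have S: "separated S" "finite S" "0 < \<rho>" using adm by (auto simp: admissible_def separated_def)
      obtain a :: "real^'n \<Rightarrow> real^'n" where a: "dispersed (\<rho> * (D * real (card S))) S a" "dispersed (2 * real (card S)) S a"
        using positions[OF S(1), of \<rho>] by blast
      show ?thesis
      proof (rule comparison_of_bounds[where NX = ?B and NY = ?M and f = "\<lambda>\<tau>. packet g \<rho> \<tau> S a"])
        show "packet g \<rho> \<tau> S a \<in> schwartz" for \<tau> by (rule schwartz_packet[OF g S(2,3)])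
        show "?B (dist_of (packet g \<rho> \<tau> S a)) \<le> ennreal (\<tau> * CB * ?x \<rho> (real (card S)) j)" if "0 < \<tau>" for \<tau>
          by (rule B_le[OF adm that a(2)])
        show "ennreal (\<tau> * CM * ?y \<rho> (real (card S))) \<le> ?M (dist_of (packet g \<rho> \<tau> S a))" if "0 < \<tau>" for \<tau>
          by (rule M_ge[OF \<rho> that S(1) a(1)])
      qed (rule d CB CM(1) xpos(1)[OF adm] | assumption)+
    qed
    have "s \<ge> real ?N * max 0 (?Q - min ?P (1 - ?P))"
    proof (rule exponent_lower_bound[OF CM(3) c K])
      fix j assume j: "j\<^sub>0 \<le> j"
      show "?y \<rho>\<^sub>0 1 \<le> ?K * ?x \<rho>\<^sub>0 1 j"
        using S1[OF j] main[OF _ order_refl] by (metis of_nat_1)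
      show "?y (2 ^ j) 1 \<le> ?K * ?x (2 ^ j) 1 j"
        using S2[OF j] main[OF _ wide[OF j]] by (metis of_nat_1)
      show "\<exists>m. (c * 2 ^ j) ^ ?N \<le> m \<and> ?y \<rho>\<^sub>0 m \<le> ?K * ?x \<rho>\<^sub>0 m j"
        using S3[OF j] main[OF _ order_refl] by blast
    qed
    then show ?thesis by (simp add: nu1_def recip_conj_exponent[OF p])
  qed
  have part2: "s \<le> real ?N * nu2 p q"
    if incl: "continuously_included (modulation_space \<phi> p q) ?M (besov_space \<eta> \<psi> p q s) ?B"
      and fin: "p < \<infinity>" "q < \<infinity>"
  proof -
    obtain CB' where CB': "0 < CB'" and B_ge: "\<And>\<rho> \<tau> S a j. admissible r \<delta> e \<rho> S j \<Longrightarrow> 0 < \<tau> \<Longrightarrow>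
        dispersed (2 * real (card S)) S a \<Longrightarrow>
        ennreal (\<tau> * CB' * ?x \<rho> (real (card S)) j) \<le> ?B (dist_of (packet g \<rho> \<tau> S a))"
      using packet_besov_norm_ge[OF dp p fin(1) q g supp r(3) g0 \<psi>, where s = s] by blast
    obtain CM' where CM': "0 < CM'" and M_le: "\<And>\<rho> \<tau> S a. 1 \<le> \<rho> \<Longrightarrow> 0 < \<tau> \<Longrightarrow> separated S \<Longrightarrow>
        ?M (dist_of (packet g \<rho> \<tau> S a)) \<le> ennreal (\<tau> * CM' * ?y \<rho> (real (card S)))"
      using packet_modulation_norm_le[OF g \<phi> p fin(1) q fin(2)] by blast
    have "?M (dist_of (\<lambda>x. 0)) < \<infinity>"
      by (simp add: modulation_norm_zero[OF \<phi> p q])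
    then obtain d where d: "0 < d"
      "\<And>f. f \<in> schwartz \<Longrightarrow> ?M (dist_of f) < ennreal d \<Longrightarrow> ?B (dist_of f) < ennreal 1"
      using continuously_included_at_zero[OF incl[unfolded besov_space_def modulation_space_def]] by blast
    let ?K = "2 * CM' / (d * CB')"
    have K: "0 < ?K" using CB' d(1) CM' by simp
    have main: "?x \<rho> (real (card S)) j \<le> ?K * ?y \<rho> (real (card S))"
      if adm: "admissible r \<delta> e \<rho> S j" for \<rho> S j
    proof -
      have S: "separated S" "finite S" "0 < \<rho>" "1 \<le> \<rho>" using adm by (auto simp: admissible_def separated_def)
      obtain a :: "real^'n \<Rightarrow> real^'n" where a: "dispersed (2 * real (card S)) S a"
        using positions[OF S(1), of \<rho>] by blast
      show ?thesis
      proof (rule comparison_of_bounds[where NX = ?M and NY = ?B and f = "\<lambda>\<tau>. packet g \<rho> \<tau> S a"])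
        show "packet g \<rho> \<tau> S a \<in> schwartz" for \<tau> by (rule schwartz_packet[OF g S(2,3)])
        show "?M (dist_of (packet g \<rho> \<tau> S a)) \<le> ennreal (\<tau> * CM' * ?y \<rho> (real (card S)))" if "0 < \<tau>" for \<tau>
          by (rule M_le[OF S(4) that S(1)])
        show "ennreal (\<tau> * CB' * ?x \<rho> (real (card S)) j) \<le> ?B (dist_of (packet g \<rho> \<tau> S a))" if "0 < \<tau>" for \<tau>
          by (rule B_ge[OF adm that a])
      qed (rule d CB' CM' xpos(2)[OF adm] | assumption)+
    qed
    have "s \<le> real ?N * min 0 (?Q - max ?P (1 - ?P))"
    proof (rule exponent_upper_bound[OF CM(3) c K])
      fix j assume j: "j\<^sub>0 \<le> j"
      show "?x \<rho>\<^sub>0 1 j \<le> ?K * ?y \<rho>\<^sub>0 1"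
        using S1[OF j] main by (metis of_nat_1)
      show "?x (2 ^ j) 1 j \<le> ?K * ?y (2 ^ j) 1"
        using S2[OF j] main by (metis of_nat_1)
      show "\<exists>m. (c * 2 ^ j) ^ ?N \<le> m \<and> ?x \<rho>\<^sub>0 m j \<le> ?K * ?y \<rho>\<^sub>0 m"
        using S3[OF j] main by blast
    qed
    then show ?thesis by (simp add: nu2_def recip_conj_exponent[OF p])
  qed
  show ?thesis using part1 part2 by blast
qed

end
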